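(* Let $p$ be a prime, let $b$ be an integer not divisible by $p$, and let $0<\varepsilon<\frac15$ be a real number. For any integer $y$ in the range $p^{1/(4\sqrt e)+\varepsilon}<y<p$, \[ S_y(b) = \frac{2^y}{p-1} + O_\varepsilon\!\left(\frac{2^y}{p^2}\right), \] that is, there is a constant $C_\varepsilon$ depending only on $\varepsilon$ such that $\left|S_y(b)-\frac{2^y}{p-1}\right|\le C_\varepsilon \frac{2^y}{p^2}$ for all such $p$, $b$, $y$.
   Context: For a prime $p$, a positive integer $y$ and an integer $b$ coprime to $p$, $S_y(b)$ denotes the number of subsets of $\{1,2,\dots,y\}$ whose product (the empty product being $1$) is congruent to $b \pmod p$. *)

theory Defs
  imports "HOL-Analysis.Analysis" "HOL-Number_Theory.Number_Theory"
begin

definition S :: "nat \<Rightarrow> nat \<Rightarrow> int \<Rightarrow> nat" where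
  "S p y b = card {A. A \<subseteq> {1..y} \<and> [int (\<Prod>A) = b] (mod int p)}"

end

theory Submission
  imports Defs "HOL-Real_Asymp.Real_Asymp" "Berlekamp_Zassenhaus.Finite_Field"
begin

text \<open>
  By orthogonality, \<open>(p - 1) S\<^sub>y(b)\<close> is the sum over all characters \<open>\<psi>\<close> modulo \<open>p\<close> of the conjugate of \<open>\<psi>(b)\<close>
  times \<open>\<Prod>(1 + \<psi>(n))\<close> over \<open>n \<le> y\<close>, and the trivial character contributes the main term. Since
  \<open>|1 + z| \<le> 2 exp(-|1 - z|\<^sup>2 / 8)\<close> on the unit circle, it suffices that \<open>\<Sum>|1 - \<psi>(n)|\<^sup>2 \<ge> 16 ln p\<close> for every
  nontrivial \<open>\<psi>\<close>. Suppose not. By multiplicativity, \<open>\<psi>\<close> is then very close to 1 at every \<open>n \<le> Z\<close>,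
  where \<open>Z\<close> is slightly smaller than \<open>y\<close>. A positive proportion of all residues are products of eight
  integers at most \<open>Z\<close>, which bounds the order of \<open>\<psi>\<close>, and so \<open>\<psi> = 1\<close> on \<open>[1, Z]\<close>. By Mertens' theorem
  (the Vinogradov trick, which is where \<open>\<surd>e\<close> comes from) the sum of \<open>\<psi>\<close> over \<open>n \<le> p\<^bsup>1/4 + \<epsilon>/4\<^esup>\<close> is
  large, contradicting Burgess' bound. As the order is bounded, the complete character sums needed for the
  latter follow from Stepanov's elementary method applied to each fibre of \<open>\<psi>\<close>.
\<close>

text \<open>If \<psi> is 1 up to Z, then for n up to N it can differ from 1 only at multiples of
  primes q between Z and N. Their density is at most the sum of 1/q, about ln(ln N / ln Z), and this
  is below 1/2 exactly when the ratio of the two exponents is below \<surd>e; the sum of \<psi> up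
  to N then cannot be o(N). The obstacle is that the order d of \<psi> is not bounded in advance,
  while Stepanov's method works with constants that grow with d (its smallness condition contains
  2^d). Hence the order has to be bounded before Burgess' bound can be used, from values of \<psi>
  at small integers alone. The exponent 2/15 is chosen for this: it lies below 1/(4\<surd>e), so
  such integers are below Z, and eight of them together can still reach p. Stepanov's method bounds
  fibres only from above. This is enough, since the fibres partition the residues and the values of
  \<psi> on them, the d-th roots of unity, sum to 0.\<close>

hide_const (open) module.smult up_ring.monom up_ring.coeff Coset.order

(* The unqualified name cong_def refers to a fact of BNF_Corec here. *)
lemmas mod_cong_def = Cong.unique_euclidean_semiring_class.cong_def

section \<open>Stepanov's method\<close>

lemma pderiv_power_Suc_mult:
  fixes P :: "'a::field poly"
  shows "pderiv ([:c,1:] ^ Suc n * P) = [:c,1:] ^ n * (smult (of_nat (Suc n)) P + [:c,1:] * pderiv P)"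
proof -
  define L where "L = [:c,1:]"
  have "pderiv L = 1" by (simp add: L_def pderiv_pCons)
  thus ?thesis unfolding L_def[symmetric]
    by (simp only: pderiv_mult pderiv_power_Suc) (simp add: algebra_simps)
qed

text \<open>Were the order n of R at x at most k, then n would be nonzero in the field and
  differentiation would lower the order to exactly n - 1, although the derivative vanishes to order
  k.\<close>

lemma power_dvd_of_pderiv:
  fixes R :: "'a::field poly"
  assumes "[:-x,1:] ^ k dvd pderiv R" "poly R x = 0" "\<And>j. 0 < j \<Longrightarrow> j \<le> k \<Longrightarrow> of_nat j \<noteq> (0::'a)"
  shows "[:-x,1:] ^ Suc k dvd R"
proof (cases "R = 0")
  case False
  define n where "n = order x R"
  have n0: "n > 0" using assms(2) False by (simp add: n_def order_gt_0_iff)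
  obtain Q where Q: "R = [:-x,1:] ^ n * Q" "\<not> [:-x,1:] dvd Q"
    using order_decomp[OF False, of x] unfolding n_def by auto
  have Qx: "poly Q x \<noteq> 0" using Q(2) by (simp add: poly_eq_0_iff_dvd)
  show ?thesis
  proof (cases "n \<ge> Suc k")
    case True
    then show ?thesis using order_divides n_def by blast
  next
    case le: False
    obtain j where j: "n = Suc j" using n0 by (cases n) auto
    have "pderiv R = [:-x,1:] ^ j * (smult (of_nat n) Q + [:-x,1:] * pderiv Q)"
      unfolding Q(1) j by (rule pderiv_power_Suc_mult)
    moreover have "[:-x,1:] ^ Suc j dvd pderiv R"
      using assms(1) le j by (meson dvd_trans le_imp_power_dvd not_less_eq_eq Suc_leI)
    ultimately have "[:-x,1:] ^ j * [:-x,1:] dvd [:-x,1:] ^ j * (smult (of_nat n) Q + [:-x,1:] * pderiv Q)"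
      by (simp only: power_Suc2)
    hence "[:-x,1:] dvd smult (of_nat n) Q + [:-x,1:] * pderiv Q"
      by (subst (asm) dvd_mult_cancel_left) auto
    hence "poly (smult (of_nat n) Q + [:-x,1:] * pderiv Q) x = 0" by (simp only: poly_eq_0_iff_dvd)
    hence "of_nat n = (0::'a)" using Qx by simp
    then show ?thesis using assms(3)[of n] n0 le by auto
  qed
qed auto

text \<open>In characteristic p, ordinary derivatives detect multiplicities only up to p. This is
  where the condition \<open>l \<le> p\<close> of Stepanov's method comes from.\<close>

lemma power_dvd_of_derivatives_vanish:
  fixes R :: "'a::field poly"
  assumes "\<And>k. k < l \<Longrightarrow> poly ((pderiv ^^ k) R) x = 0" and "\<And>j. 0 < j \<Longrightarrow> j < l \<Longrightarrow> of_nat j \<noteq> (0::'a)"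
  shows "[:-x,1:] ^ l dvd R"
  using assms
proof (induction l arbitrary: R)
  case (Suc l)
  have "[:-x,1:] ^ l dvd pderiv R"
  proof (rule Suc.IH)
    fix k assume "k < l"
    then show "poly ((pderiv ^^ k) (pderiv R)) x = 0"
      using Suc.prems(1)[of "Suc k"] by (simp add: funpow_Suc_right del: funpow.simps)
  qed (use Suc.prems in auto)
  moreover have "poly R x = 0" using Suc.prems(1)[of 0] by simp
  ultimately show ?case using power_dvd_of_pderiv Suc.prems(2) by (metis le_imp_less_Suc)
qed simp

lemma card_multiple_roots_le:
  fixes R :: "'a::idom poly"
  assumes "R \<noteq> 0" "finite Z" "\<And>x. x \<in> Z \<Longrightarrow> [:-x,1:] ^ l dvd R"
  shows "l * card Z \<le> degree R"
proof (cases "l = 0")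
  case False
  have le: "l \<le> count (proots R) x" if "x \<in> Z" for x
    using assms that by (simp add: order_divides)
  have sub: "Z \<subseteq> set_mset (proots R)"
    using le False by (metis count_eq_zero_iff le_zero_eq subsetI)
  have "l * card Z = (\<Sum>x\<in>Z. l)" by simp
  also have "\<dots> \<le> (\<Sum>x\<in>Z. count (proots R) x)" by (intro sum_mono le)
  also have "\<dots> \<le> (\<Sum>x\<in>set_mset (proots R). count (proots R) x)"
    by (intro sum_mono2 sub) auto
  also have "\<dots> = size (proots R)" by (simp add: size_multiset_overloaded_eq)
  also have "\<dots> \<le> degree R" by (rule size_proots_le)
  finally show ?thesis .
qed simp

text \<open>Counting replaces rank theory: over a finite field there are more vectors c than
  patterns of values of \<open>L c\<close> on B, so two vectors share a pattern and their difference
  is a nonzero solution.\<close>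

lemma homogeneous_system_solution:
  fixes L :: "('i \<Rightarrow> 'a::{finite,field}) \<Rightarrow> 'k \<Rightarrow> 'a"
  assumes "finite A" "finite B" "card B < card A"
    and additive: "\<And>c c' k. L (\<lambda>i. c i - c' i) k = L c k - L c' k"
  obtains c where "\<exists>i\<in>A. c i \<noteq> 0" "\<And>k. k \<in> B \<Longrightarrow> L c k = 0"
proof -
  define ext where "ext c = (\<lambda>i. if i \<in> A then c i else (0::'a))" for c
  define \<Phi> where "\<Phi> c = restrict (L (ext c)) B" for c
  have q: "CARD('a) > 1"
    using card_mono[of UNIV "{0::'a,1}"] by simp
  have "\<Phi> ` (A \<rightarrow>\<^sub>E UNIV) \<subseteq> (B \<rightarrow>\<^sub>E UNIV)" unfolding \<Phi>_def by auto
  moreover have "card (B \<rightarrow>\<^sub>E (UNIV::'a set)) < card (A \<rightarrow>\<^sub>E (UNIV::'a set))"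
    using assms q by (simp add: card_PiE)
  ultimately have "\<not> inj_on \<Phi> (A \<rightarrow>\<^sub>E UNIV)"
    using assms by (metis card_inj_on_le finite_PiE finite leD)
  then obtain c c' where c: "c \<in> A \<rightarrow>\<^sub>E UNIV" "c' \<in> A \<rightarrow>\<^sub>E UNIV" "c \<noteq> c'" "\<Phi> c = \<Phi> c'"
    unfolding inj_on_def by blast
  obtain i where i: "i \<in> A" "c i \<noteq> c' i" using c PiE_ext by blast
  show thesis
  proof (rule that[of "\<lambda>i. ext c i - ext c' i"])
    show "\<exists>i\<in>A. ext c i - ext c' i \<noteq> 0" using i by (auto simp: ext_def)
    show "L (\<lambda>i. ext c i - ext c' i) k = 0" if "k \<in> B" for k
      using fun_cong[OF c(4), of k] that by (simp add: additive \<Phi>_def)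
  qed
qed

text \<open>With s standing for an exponent i*e read in the field, this is the polynomial h_k for
  which the k-th derivative of f^(l+s) h is f^(l+s-k) h_k. Each derivative costs only
  \<open>degree f\<close> in degree, however large the exponent. The truncated \<open>l - k\<close>
  is a true difference, as only steps with k < l are used.\<close>

primrec twisted_deriv :: "'a::field poly \<Rightarrow> nat \<Rightarrow> 'a \<Rightarrow> nat \<Rightarrow> 'a poly \<Rightarrow> 'a poly" where
  "twisted_deriv f l s 0 h = h"
| "twisted_deriv f l s (Suc k) h = f * pderiv (twisted_deriv f l s k h)
     + smult (of_nat (l - k) + s) (pderiv f * twisted_deriv f l s k h)"

lemma twisted_deriv_diff:
  "twisted_deriv f l s k (h - h') = twisted_deriv f l s k h - twisted_deriv f l s k h'"
proof (induction k)
  case (Suc k)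
  show ?case
    unfolding twisted_deriv.simps Suc by (simp only: pderiv_diff right_diff_distrib smult_diff_right) simp
qed simp

lemma degree_pderiv_le_degree: "degree (pderiv h) \<le> degree (h :: 'a::field poly)"
  by (meson degree_pderiv_le diff_le_self le_trans)

lemma degree_twisted_deriv_le:
  "degree (twisted_deriv f l s k h) \<le> degree h + k * degree f"
proof (induction k)
  case (Suc k)
  let ?h = "twisted_deriv f l s k h"
  have "degree (f * pderiv ?h) \<le> degree f + degree ?h"
    using degree_mult_le[of f "pderiv ?h"] degree_pderiv_le_degree[of ?h] by linarith
  moreover have "degree (smult (of_nat (l - k) + s) (pderiv f * ?h)) \<le> degree f + degree ?h"
    using degree_smult_le[of _ "pderiv f * ?h"] degree_mult_le[of "pderiv f" ?h] degree_pderiv_le_degree[of f]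
      le_trans by (meson add_mono_thms_linordered_semiring(3))
  ultimately show ?case using Suc by (auto intro!: degree_add_le)
qed simp

lemma pderiv_twisted_term:
  fixes f h :: "'a::field poly"
  assumes "of_nat p = (0::'a)"
  shows "pderiv (f ^ Suc n * (h * (f ^ e) ^ i * [:0,1:] ^ (p * j)))
     = f ^ n * ((f * pderiv h + smult (of_nat (Suc n) + of_nat (i * e)) (pderiv f * h)) * (f ^ e) ^ i * [:0,1:] ^ (p * j))"
proof -
  have z: "pderiv ([:0,1:] ^ (p * j)) = (0 :: 'a poly)"
    using assms by (simp add: pderiv_power)
  have "f ^ Suc n * (h * (f ^ e) ^ i * [:0,1:] ^ (p * j)) = f ^ Suc (n + i * e) * h * [:0,1:] ^ (p * j)"
    by (simp add: power_add power_mult[symmetric] mult_ac)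
  hence "pderiv (f ^ Suc n * (h * (f ^ e) ^ i * [:0,1:] ^ (p * j)))
     = (f ^ Suc (n + i * e) * pderiv h + smult (of_nat (Suc (n + i * e))) (f ^ (n + i * e) * pderiv f) * h) * [:0,1:] ^ (p * j)"
    by (simp only: pderiv_mult z pderiv_power_Suc) (simp add: algebra_simps)
  also have "\<dots> = f ^ n * ((f * pderiv h + smult (of_nat (Suc n) + of_nat (i * e)) (pderiv f * h)) * (f ^ e) ^ i * [:0,1:] ^ (p * j))"
    by (simp add: power_add power_mult[symmetric] algebra_simps smult_add_left)
  finally show ?thesis .
qed

text \<open>The factor \<open>f ^ l\<close> keeps the exponents of f nonnegative, and powers of
  \<open>[:0,1:] ^ p\<close> are constants for differentiation. At a point x of the prime field with
  f(x)^e = a, the remaining large powers become a^i and x^j, so a polynomial of low degree decides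
  whether the derivative vanishes.\<close>

lemma iterated_pderiv_auxiliary:
  fixes f :: "'a::field poly"
  assumes "of_nat p = (0::'a)" "k \<le> l"
  shows "(pderiv ^^ k) (f ^ l * (\<Sum>i<d. \<Sum>j<J. h i j * (f ^ e) ^ i * [:0,1:] ^ (p * j)))
     = f ^ (l - k) * (\<Sum>i<d. \<Sum>j<J. twisted_deriv f l (of_nat (i * e)) k (h i j) * (f ^ e) ^ i * [:0,1:] ^ (p * j))"
  using assms(2)
proof (induction k)
  case (Suc k)
  have lk: "l - k = Suc (l - Suc k)" using Suc by simp
  have "(pderiv ^^ Suc k) (f ^ l * (\<Sum>i<d. \<Sum>j<J. h i j * (f ^ e) ^ i * [:0,1:] ^ (p * j)))
     = (\<Sum>i<d. \<Sum>j<J. pderiv (f ^ Suc (l - Suc k) * (twisted_deriv f l (of_nat (i * e)) k (h i j) * (f ^ e) ^ i * [:0,1:] ^ (p * j))))"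
    using Suc by (simp add: lk[symmetric] sum_distrib_left pderiv_sum)
  also have "\<dots> = f ^ (l - Suc k) * (\<Sum>i<d. \<Sum>j<J. twisted_deriv f l (of_nat (i * e)) (Suc k) (h i j) * (f ^ e) ^ i * [:0,1:] ^ (p * j))"
    by (simp only: pderiv_twisted_term[OF assms(1)] sum_distrib_left twisted_deriv.simps lk)
  finally show ?case .
qed simp

section \<open>Nonvanishing of the auxiliary polynomial\<close>

lemma power_dvd_pderiv:
  assumes "[:0,1:] ^ Suc M dvd (T :: 'a::field poly)"
  shows "[:0,1:] ^ M dvd pderiv T"
proof -
  obtain Q where "T = [:0,1:] ^ Suc M * Q" using assms by blast
  thus ?thesis by (simp only: pderiv_power_Suc_mult dvd_triv_left)
qed

lemma pderiv_root_power_mult: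
  fixes P :: "'a::field poly"
  shows "[:-x,1:] * pderiv ([:-x,1:] ^ a * P) = [:-x,1:] ^ a * (smult (of_nat a) P + [:-x,1:] * pderiv P)"
proof (cases a)
  case (Suc n)
  show ?thesis unfolding Suc pderiv_power_Suc_mult by (simp only: power_Suc mult.assoc)
qed simp

text \<open>Comparing the orders of vanishing at a root of \<^term>\<open>f\<close> whose multiplicity is prime to \<^term>\<open>d\<close>
  shows that a Wronskian-type expression of \<^term>\<open>h\<close> and \<^term>\<open>h0\<close> cannot vanish.\<close>

lemma twisted_wronskian_nonzero:
  fixes f h h0 :: "'a::field poly"
  assumes f: "f = [:-x,1:] ^ \<mu> * F" "poly F x \<noteq> 0" and cop: "coprime \<mu> d"
    and de: "of_nat (d * e) = (-1::'a)" and h: "h \<noteq> 0" "h0 \<noteq> 0" "degree h \<le> D" "degree h0 \<le> D"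
    and i: "i < d" "i0 < d" "i \<noteq> i0" and small: "d * (D + degree f) < CHAR('a)"
  shows "f * (h0 * pderiv h - h * pderiv h0) + smult (of_nat (i * e) - of_nat (i0 * e)) (pderiv f * (h * h0)) \<noteq> 0"
    (is "?W \<noteq> 0")
proof
  assume W: "?W = 0"
  define a b where "a = order x h" and "b = order x h0"
  obtain P where P: "h = [:-x,1:] ^ a * P" "\<not> [:-x,1:] dvd P"
    using order_decomp[OF h(1), of x] unfolding a_def by auto
  obtain Q where Q: "h0 = [:-x,1:] ^ b * Q" "\<not> [:-x,1:] dvd Q"
    using order_decomp[OF h(2), of x] unfolding b_def by auto
  have PQ: "poly P x \<noteq> 0" "poly Q x \<noteq> 0" using P(2) Q(2) by (auto simp: poly_eq_0_iff_dvd)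
  define L where "L = [:-x,1:]"
  have Lx: "poly L x = 0" and L0: "L \<noteq> 0" by (auto simp: L_def)
  define \<kappa> where "\<kappa> = (of_nat (i * e) - of_nat (i0 * e) :: 'a)"
  define Z where "Z = F * (Q * (smult (of_nat a) P + L * pderiv P) - P * (smult (of_nat b) Q + L * pderiv Q))
     + smult \<kappa> ((smult (of_nat \<mu>) F + L * pderiv F) * (P * Q))"
  have "L * ?W = f * (h0 * (L * pderiv h) - h * (L * pderiv h0)) + smult \<kappa> (L * pderiv f * (h * h0))"
    by (simp add: \<kappa>_def algebra_simps)
  also have "\<dots> = f * (h0 * (L ^ a * (smult (of_nat a) P + L * pderiv P)) - h * (L ^ b * (smult (of_nat b) Q + L * pderiv Q)))
     + smult \<kappa> (L ^ \<mu> * (smult (of_nat \<mu>) F + L * pderiv F) * (h * h0))"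
    unfolding L_def by (simp only: pderiv_root_power_mult[symmetric] P(1)[symmetric] Q(1)[symmetric] f(1)[symmetric])
  also have "\<dots> = L ^ (\<mu> + a + b) * Z"
    unfolding P(1) Q(1) f(1) Z_def L_def[symmetric] by (simp add: power_add algebra_simps)
  finally have "Z = 0" using W L0 by simp
  hence "poly Z x = 0" by simp
  hence "poly F x * poly Q x * poly P x * (of_nat a - of_nat b + \<kappa> * of_nat \<mu>) = 0"
    by (simp add: Z_def Lx algebra_simps)
  hence "of_nat a - of_nat b + \<kappa> * of_nat \<mu> = 0" using f(2) PQ by simp
  \<comment> \<open>Multiplying by d removes e, since d*e = -1 in the field. What is left is an
    integer smaller in absolute value than the characteristic, hence zero, and this forces d to
    divide i - i0.\<close>
  hence "of_nat d * (of_nat a - of_nat b + (of_nat i - of_nat i0) * of_nat e * of_nat \<mu>) = (0::'a)"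
    by (simp add: \<kappa>_def algebra_simps)
  hence "of_nat d * (of_nat a - of_nat b) + (of_nat i - of_nat i0) * of_nat \<mu> * of_nat (d * e) = (0::'a)"
    by (simp add: algebra_simps)
  hence "of_nat d * (of_nat a - of_nat b) + (of_nat i - of_nat i0) * of_nat \<mu> * (-1) = (0::'a)"
    by (simp only: de)
  hence *: "of_int (int d * (int a - int b) - (int i - int i0) * int \<mu>) = (0::'a)"
    by (simp add: algebra_simps)
  have f0: "f \<noteq> 0" using f by auto
  have \<mu>: "\<mu> \<le> degree f"
    using f f0 order_divides[of x \<mu> f] order_degree[OF f0, of x] by simp
  have ab: "a \<le> D" "b \<le> D" using order_degree h unfolding a_def b_def by (meson le_trans)+
  have "\<bar>int d * (int a - int b) - (int i - int i0) * int \<mu>\<bar> \<le> \<bar>int d * (int a - int b)\<bar> + \<bar>(int i - int i0) * int \<mu>\<bar>"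
    by linarith
  also have "\<dots> \<le> int d * int D + int d * int (degree f)"
    unfolding abs_mult using i ab \<mu> by (intro add_mono mult_mono) auto
  also have "\<dots> = int (d * (D + degree f))" by (simp add: algebra_simps)
  also have "\<dots> < int CHAR('a)" using small by linarith
  finally have "\<bar>int d * (int a - int b) - (int i - int i0) * int \<mu>\<bar> < int CHAR('a)" .
  moreover have "int CHAR('a) dvd int d * (int a - int b) - (int i - int i0) * int \<mu>"
    using * by (simp only: of_int_eq_0_iff_char_dvd)
  ultimately have "int d * (int a - int b) - (int i - int i0) * int \<mu> = 0"
    using zdvd_not_zless by (metis dvd_abs_iff zero_less_abs_iff)
  hence "int d dvd (int i - int i0) * int \<mu>" by (metis dvd_triv_left eq_iff_diff_eq_0)
  hence "int d dvd int i - int i0"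
    using cop by (simp add: coprime_commute coprime_dvd_mult_left_iff)
  moreover have "\<bar>int i - int i0\<bar> < int d" using i by linarith
  ultimately show False using i(3) by (metis dvd_abs_iff eq_iff_diff_eq_0 of_nat_eq_iff zdvd_not_zless zero_less_abs_iff)
qed

text \<open>Induction on the number of terms: a Wronskian with one chosen term removes that term and
  keeps the shape of the others, whose coefficients stay nonzero by
  \<open>twisted_wronskian_nonzero\<close>. It doubles \<open>D + degree f\<close> and loses one
  order of vanishing, which explains \<open>2 ^ n\<close> and the summand n. A single term vanishes
  at 0 only to the order of its coefficient, as f(0) is nonzero.\<close>

lemma small_degree_independence:
  fixes f :: "'a::field poly"
  assumes f: "f = [:-x,1:] ^ \<mu> * F" "poly F x \<noteq> 0" and cop: "coprime \<mu> d" and f0: "poly f 0 \<noteq> 0"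
    and de: "of_nat (d * e) = (-1::'a)"
    and I: "I \<subseteq> {..<d}" "card I = Suc n" "\<And>i. i \<in> I \<Longrightarrow> h i \<noteq> 0 \<and> degree (h i) \<le> D"
    and dvd: "[:0,1:] ^ M dvd (\<Sum>i\<in>I. h i * f ^ (e * i))"
    and small: "d * (2 ^ n * (D + degree f)) < CHAR('a)"
  shows "M \<le> 2 ^ n * (D + degree f) + n"
  using I dvd small
proof (induction n arbitrary: I h D M)
  case 0
  then obtain i where i: "I = {i}" by (metis card_1_singletonE One_nat_def)
  have fn0: "f \<noteq> 0" using f0 by auto
  have hi: "h i \<noteq> 0" "degree (h i) \<le> D" using 0 i by auto
  have "[:-0,1:] ^ M dvd h i * f ^ (e * i)" using 0 i by simp
  hence "M \<le> order 0 (h i * f ^ (e * i))"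
    using hi fn0 by (subst (asm) order_divides) auto
  also have "\<dots> = order 0 (h i)" using hi fn0 f0 by (simp add: order_mult order_0I)
  also have "\<dots> \<le> D" using order_degree[OF hi(1), of 0] hi(2) by linarith
  finally show ?case by simp
next
  case (Suc n)
  show ?case
  proof (cases M)
    case M: (Suc M')
    have fin: "finite I" using Suc.prems(1) finite_subset by blast
    obtain i0 where i0: "i0 \<in> I" using Suc.prems(2) by fastforce
    define T where "T = (\<Sum>i\<in>I. h i * f ^ (e * i))"
    define \<kappa> where "\<kappa> i = (of_nat (i * e) - of_nat (i0 * e) :: 'a)" for i
    define c where "c i = f * (h i0 * pderiv (h i) - h i * pderiv (h i0)) + smult (\<kappa> i) (pderiv f * (h i * h i0))" for i
    \<comment> \<open>U is f times the derivative of the term of index i0, divided by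
      \<open>f ^ (e * i0)\<close>. Thus \<open>h i0 * (f * pderiv T) - U * T\<close> is, up to
      powers of f, the Wronskian of T with that term.\<close>
    define U where "U = f * pderiv (h i0) + smult (of_nat (i0 * e)) (pderiv f * h i0)"
    have pf: "f * pderiv (f ^ k) = smult (of_nat k) (pderiv f * f ^ k)" for k
      by (cases k) (simp_all only: pderiv_power_Suc, simp_all add: algebra_simps)
    have "h i0 * (f * pderiv (h i * f ^ (e * i))) - U * (h i * f ^ (e * i)) = c i * f ^ (e * i)" for i
    proof -
      have "h i0 * (f * pderiv (h i * f ^ (e * i))) =
         h i0 * (f * pderiv (h i) * f ^ (e * i) + h i * (f * pderiv (f ^ (e * i))))"
        by (simp add: pderiv_mult algebra_simps)
      also have "\<dots> = h i0 * (f * pderiv (h i) * f ^ (e * i) + h i * smult (of_nat (e * i)) (pderiv f * f ^ (e * i)))"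
        by (simp only: pf)
      finally show ?thesis
        by (simp add: c_def U_def \<kappa>_def algebra_simps smult_diff_left)
    qed
    hence "h i0 * (f * pderiv T) - U * T = (\<Sum>i\<in>I. c i * f ^ (e * i))"
      by (simp add: T_def pderiv_sum sum_distrib_left sum_subtractf[symmetric])
    also have "\<dots> = (\<Sum>i\<in>I-{i0}. c i * f ^ (e * i))"
      using fin i0 by (subst sum.remove[of _ i0]) (auto simp: c_def \<kappa>_def)
    finally have eq: "(\<Sum>i\<in>I-{i0}. c i * f ^ (e * i)) = h i0 * (f * pderiv T) - U * T" by simp
    have "[:0,1:] ^ M' dvd T"
      unfolding T_def by (rule dvd_trans[OF le_imp_power_dvd Suc.prems(4)]) (simp add: M)
    moreover have "[:0,1:] ^ M' dvd pderiv T"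
      using Suc.prems(4) M power_dvd_pderiv unfolding T_def by blast
    ultimately have dvd': "[:0,1:] ^ M' dvd (\<Sum>i\<in>I-{i0}. c i * f ^ (e * i))"
      unfolding eq by (intro dvd_diff dvd_mult)
    have "M' \<le> 2 ^ n * ((2 * D + degree f) + degree f) + n"
    proof (rule Suc.IH[of "I - {i0}" c])
      show "card (I - {i0}) = Suc n" using Suc.prems(2) i0 fin by simp
      show "d * (2 ^ n * (2 * D + degree f + degree f)) < CHAR('a)"
        using Suc.prems(5) by (simp add: algebra_simps)
      show "c i \<noteq> 0 \<and> degree (c i) \<le> 2 * D + degree f" if i: "i \<in> I - {i0}" for i
      proof
        have hh: "degree (h i) \<le> D" "degree (h i0) \<le> D" "h i \<noteq> 0" "h i0 \<noteq> 0" using Suc.prems(3) i i0 by auto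
        have "d * (D + degree f) * 1 \<le> d * (D + degree f) * 2 ^ Suc n" by (intro mult_left_mono) auto
        also have "\<dots> < CHAR('a)" using Suc.prems(5) by (simp add: mult_ac)
        finally show "c i \<noteq> 0"
          unfolding c_def \<kappa>_def using hh i i0 Suc.prems(1)
          by (intro twisted_wronskian_nonzero[OF f cop de]) auto
        have "degree (h i0 * pderiv (h i)) \<le> 2 * D" "degree (h i * pderiv (h i0)) \<le> 2 * D"
          using degree_mult_le[of "h i0" "pderiv (h i)"] degree_mult_le[of "h i" "pderiv (h i0)"] hh
            degree_pderiv_le_degree[of "h i"] degree_pderiv_le_degree[of "h i0"] by linarith+
        hence "degree (h i0 * pderiv (h i) - h i * pderiv (h i0)) \<le> 2 * D" by (rule degree_diff_le)
        hence 1: "degree (f * (h i0 * pderiv (h i) - h i * pderiv (h i0))) \<le> 2 * D + degree f"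
          using degree_mult_le[of f "h i0 * pderiv (h i) - h i * pderiv (h i0)"] by linarith
        have "degree (smult (\<kappa> i) (pderiv f * (h i * h i0))) \<le> degree (pderiv f * (h i * h i0))"
          by (rule degree_smult_le)
        also have "\<dots> \<le> degree (pderiv f) + (degree (h i) + degree (h i0))"
          using degree_mult_le[of "pderiv f" "h i * h i0"] degree_mult_le[of "h i" "h i0"] by linarith
        also have "\<dots> \<le> 2 * D + degree f" using hh degree_pderiv_le_degree[of f] by linarith
        finally show "degree (c i) \<le> 2 * D + degree f" unfolding c_def using 1 by (intro degree_add_le)
      qed
    qed (use dvd' Suc.prems(1) in auto)
    thus ?thesis unfolding M by (simp add: algebra_simps)
  qed simp
qed

text \<open>The blocks may have degree p or more and overlap, so a vanishing sum does not make them
  vanish one by one. But every block beyond the lowest nonzero one carries a further factor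
  \<open>[:0,1:] ^ p\<close>, which must then divide the lowest as well.\<close>

lemma power_dvd_lowest_block:
  fixes Q :: "nat \<Rightarrow> 'a::field poly"
  assumes "(\<Sum>j<J. Q j * [:0,1:] ^ (p * j)) = 0" "j0 < J" "\<And>j. j < j0 \<Longrightarrow> Q j = 0"
  shows "[:0,1:] ^ p dvd Q j0"
proof -
  let ?X = "[:0,1:] :: 'a poly"
  have "{..<J} = {..<j0} \<union> {j0} \<union> {j0<..<J}" using assms(2) by auto
  hence "(\<Sum>j<J. Q j * ?X ^ (p * j)) = (\<Sum>j\<in>{..<j0} \<union> {j0} \<union> {j0<..<J}. Q j * ?X ^ (p * j))" by simp
  also have "\<dots> = (\<Sum>j<j0. Q j * ?X ^ (p * j)) + Q j0 * ?X ^ (p * j0) + (\<Sum>j\<in>{j0<..<J}. Q j * ?X ^ (p * j))"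
    by (subst sum.union_disjoint; (subst sum.union_disjoint)?) auto
  also have "(\<Sum>j<j0. Q j * ?X ^ (p * j)) = 0" using assms(3) by simp
  finally have "Q j0 * ?X ^ (p * j0) = - (\<Sum>j\<in>{j0<..<J}. Q j * ?X ^ (p * j))"
    using assms(1) by (simp add: eq_neg_iff_add_eq_0)
  moreover have "?X ^ (p + p * j0) dvd (\<Sum>j\<in>{j0<..<J}. Q j * ?X ^ (p * j))"
  proof (intro dvd_sum dvd_mult le_imp_power_dvd)
    fix j assume "j \<in> {j0<..<J}"
    hence "p * Suc j0 \<le> p * j" by (intro mult_le_mono2) auto
    thus "p + p * j0 \<le> p * j" by simp
  qed
  ultimately have "?X ^ p * ?X ^ (p * j0) dvd Q j0 * ?X ^ (p * j0)"
    by (simp only: power_add dvd_minus_iff)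
  thus ?thesis by (subst (asm) dvd_mult_cancel_right) auto
qed

text \<open>There are d * J * D free coefficients, and vanishing to order l at all solutions of
  f(x)^e = a follows from l * (D + l * degree f + J) linear conditions on them. A nontrivial choice
  gives a polynomial, nonzero by \<open>small_degree_independence\<close>, whose degree bounds l
  times the number of solutions.\<close>

lemma stepanov_poly:
  fixes f :: "'a::finite_field poly"
  assumes p: "CARD('a) = p" "CHAR('a) = p"
    and f: "f = [:-x0,1:] ^ \<mu> * F" "poly F x0 \<noteq> 0" and cop: "coprime \<mu> d" and f0: "poly f 0 \<noteq> 0"
    and de: "d * e = p - 1"
    and sys: "l * (D + l * degree f + J) < d * J * D" and l: "l \<le> p"
    and small: "d * (2 ^ d * (D + degree f)) < p"
  shows "l * card {x. poly f x ^ e = a} \<le> l * degree f + D + p * degree f + p * J"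
proof -
  let ?X = "[:0,1:] :: 'a poly"
  let ?m = "degree f"
  have p1: "p > 1" using p card_mono[of UNIV "{0::'a,1}"] by simp
  have D0: "D > 0" and J0: "J > 0" and d0: "d > 0" using sys by (auto intro: Nat.gr0I)
  have p0: "of_nat p = (0::'a)" using of_nat_CHAR[where ?'a = 'a] by (simp only: p(2))
  have "of_nat (d * e) = (of_nat p - 1 :: 'a)" unfolding de using p1 by (simp add: of_nat_diff)
  hence de': "of_nat (d * e) = (-1 :: 'a)" by (simp add: p0)
  have fn0: "f \<noteq> 0" using f0 by auto
  define h :: "(nat \<times> nat \<times> nat \<Rightarrow> 'a) \<Rightarrow> nat \<Rightarrow> nat \<Rightarrow> 'a poly"
    where "h c i j = (\<Sum>t<D. monom (c (i,j,t)) t)" for c i j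
  \<comment> \<open>At the solutions, and up to a power of f, \<open>V c k\<close> has the values of
    the k-th derivative of the auxiliary polynomial: f^e is replaced by a and the p-th power of the
    variable by the variable. The linear conditions say that \<open>V c k\<close> vanishes
    identically.\<close>
  define V where "V c k = (\<Sum>i<d. \<Sum>j<J. smult (a ^ i) (twisted_deriv f l (of_nat (i * e)) k (h c i j)) * ?X ^ j)" for c k
  define L where "L c = (\<lambda>(k,s). coeff (V c k) s)" for c
  have hdiff: "h (\<lambda>i. c i - c' i) i j = h c i j - h c' i j" for c c' i j
    by (simp add: h_def sum_subtractf diff_monom[symmetric])
  have "V (\<lambda>i. c i - c' i) k = V c k - V c' k" for c c' k
    by (simp add: V_def hdiff twisted_deriv_diff smult_diff_right left_diff_distrib sum_subtractf)
  hence Ladd: "L (\<lambda>i. c i - c' i) k = L c k - L c' k" for c c' k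
    by (cases k) (simp add: L_def)
  have hcoeff: "coeff (h c i j) t = (if t < D then c (i,j,t) else 0)" for c i j t
    by (simp add: h_def coeff_sum sum.delta')
  have hdeg: "degree (h c i j) \<le> D - 1" for c i j
    by (rule degree_le) (use D0 in \<open>auto simp: hcoeff\<close>)
  obtain c where c: "\<exists>i\<in>{..<d} \<times> {..<J} \<times> {..<D}. c i \<noteq> 0"
      "\<And>k. k \<in> {..<l} \<times> {..<D + l * ?m + J} \<Longrightarrow> L c k = 0"
    by (rule homogeneous_system_solution[of "{..<d} \<times> {..<J} \<times> {..<D}" "{..<l} \<times> {..<D + l * ?m + J}" L])
       (use sys Ladd in \<open>auto simp: card_cartesian_product mult.assoc\<close>)
  define H where "H = h c"
  have Hdeg: "degree (H i j) \<le> D - 1" for i j using hdeg by (simp add: H_def)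
  have V0: "V c k = 0" if k: "k < l" for k
  proof (rule poly_eqI)
    fix s
    have "degree (V c k) \<le> (D - 1) + k * ?m + (J - 1)" unfolding V_def
    proof (intro degree_sum_le)
      fix i j assume "i \<in> {..<d}" "j \<in> {..<J}"
      have "degree (smult (a ^ i) (twisted_deriv f l (of_nat (i * e)) k (h c i j)) * ?X ^ j)
         \<le> degree (twisted_deriv f l (of_nat (i * e)) k (h c i j)) + degree (?X ^ j)"
        using degree_mult_le degree_smult_le by (meson add_le_mono1 le_trans)
      also have "\<dots> \<le> (D - 1 + k * ?m) + (J - 1)"
        using degree_twisted_deriv_le[of f l "of_nat (i * e)" k "h c i j"] hdeg[of c i j] \<open>j \<in> {..<J}\<close>
        by (intro add_mono) (auto simp: degree_power_eq)
      finally show "degree (smult (a ^ i) (twisted_deriv f l (of_nat (i * e)) k (h c i j)) * ?X ^ j) \<le> D - 1 + k * ?m + (J - 1)" .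
    qed auto
    also have "\<dots> < D + l * ?m + J" using D0 k J0 mult_le_mono1[of k l ?m] by linarith
    finally show "coeff (V c k) s = coeff 0 s"
      using c(2)[of "(k,s)"] k by (cases "s < D + l * ?m + J") (auto simp: L_def coeff_eq_0)
  qed
  define G where "G = (\<Sum>i<d. \<Sum>j<J. H i j * (f ^ e) ^ i * ?X ^ (p * j))"
  have "G \<noteq> 0"
  proof
    assume G0: "G = 0"
    define Q where "Q j = (\<Sum>i<d. H i j * f ^ (e * i))" for j
    have "G = (\<Sum>j<J. Q j * ?X ^ (p * j))"
      unfolding G_def Q_def by (subst sum.swap) (simp add: sum_distrib_right power_mult)
    hence Qs: "(\<Sum>j<J. Q j * ?X ^ (p * j)) = 0" using G0 by simp
    obtain i1 j1 t1 where ijt: "i1 < d" "j1 < J" "t1 < D" "c (i1,j1,t1) \<noteq> 0" using c(1) by auto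
    hence "coeff (H i1 j1) t1 \<noteq> 0" by (simp add: H_def hcoeff)
    hence ex: "\<exists>j. j < J \<and> (\<exists>i<d. H i j \<noteq> 0)" using ijt by (intro exI[of _ j1] conjI exI[of _ i1]) auto
    define j0 where "j0 = (LEAST j. j < J \<and> (\<exists>i<d. H i j \<noteq> 0))"
    have j0: "j0 < J" "\<exists>i<d. H i j0 \<noteq> 0" using LeastI_ex[OF ex] unfolding j0_def by auto
    have "H i j = 0" if "j < j0" "i < d" for i j
      using not_less_Least[of j "\<lambda>j. j < J \<and> (\<exists>i<d. H i j \<noteq> 0)"] that j0(1) unfolding j0_def[symmetric] by auto
    hence "Q j = 0" if "j < j0" for j using that by (simp add: Q_def)
    hence dvd: "?X ^ p dvd Q j0" by (rule power_dvd_lowest_block[OF Qs j0(1)])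
    define I where "I = {i\<in>{..<d}. H i j0 \<noteq> 0}"
    have "I \<noteq> {}" "finite I" using j0(2) by (auto simp: I_def)
    then obtain n where n: "card I = Suc n" by (cases "card I") auto
    have "card I \<le> card {..<d}" by (rule card_mono) (auto simp: I_def)
    hence nd: "Suc n \<le> d" using n by simp
    have "Q j0 = (\<Sum>i\<in>I. H i j0 * f ^ (e * i))"
      unfolding Q_def I_def by (rule sum.mono_neutral_right) auto
    hence dvd': "?X ^ p dvd (\<Sum>i\<in>I. H i j0 * f ^ (e * i))" using dvd by simp
    \<comment> \<open>At most d terms survive, so \<open>2 ^ d\<close> also absorbs the extra
      summand n of the independence bound.\<close>
    have "2 * 2 ^ n \<le> (2::nat) ^ d" using nd power_increasing[of "Suc n" d "2::nat"] by simp
    moreover have "n < 2 ^ n" by (rule less_exp)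
    ultimately have nd2: "2 ^ n + n \<le> (2::nat) ^ d" by linarith
    have le: "2 ^ n * (D + ?m) + n \<le> 2 ^ d * (D + ?m)"
    proof -
      have "2 ^ n * (D + ?m) + n \<le> (2 ^ n + n) * (D + ?m)" using D0 by (simp add: algebra_simps trans_le_add1)
      also have "\<dots> \<le> 2 ^ d * (D + ?m)" by (intro mult_right_mono nd2) auto
      finally show ?thesis .
    qed
    have "p \<le> 2 ^ n * (D + ?m) + n"
    proof (rule small_degree_independence[OF f cop f0 de' _ n _ dvd'])
      show "H i j0 \<noteq> 0 \<and> degree (H i j0) \<le> D" if "i \<in> I" for i
        using that Hdeg[of i j0] D0 by (auto simp: I_def)
      have "2 ^ n * (D + ?m) \<le> 2 ^ d * (D + ?m)" using le by linarith
      hence "d * (2 ^ n * (D + ?m)) \<le> d * (2 ^ d * (D + ?m))" by (rule mult_le_mono2)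
      thus "d * (2 ^ n * (D + ?m)) < CHAR('a)" unfolding p(2) using small by (rule le_less_trans)
    qed (auto simp: I_def)
    also have "\<dots> \<le> d * (2 ^ d * (D + ?m))"
      using le mult_le_mono1[of 1 d "2 ^ d * (D + ?m)"] d0 by linarith
    finally show False using small by simp
  qed
  hence R0: "f ^ l * G \<noteq> 0" using fn0 by simp
  have "l * card {x. poly f x ^ e = a} \<le> degree (f ^ l * G)"
  proof (rule card_multiple_roots_le[OF R0])
    fix x assume "x \<in> {x. poly f x ^ e = a}"
    hence x: "poly f x ^ e = a" by simp
    have xp: "x ^ (p * j) = x ^ j" for j
      using finite_field_power_card_eq_same[of x] p by (simp add: power_mult)
    show "[:-x,1:] ^ l dvd f ^ l * G"
    proof (rule power_dvd_of_derivatives_vanish)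
      fix k assume k: "k < l"
      have "(pderiv ^^ k) (f ^ l * G) = f ^ (l - k) *
        (\<Sum>i<d. \<Sum>j<J. twisted_deriv f l (of_nat (i * e)) k (H i j) * (f ^ e) ^ i * ?X ^ (p * j))"
        unfolding G_def using k by (intro iterated_pderiv_auxiliary p0) simp
      also have "poly \<dots> x = poly (f ^ (l - k)) x * poly (V c k) x"
        by (simp add: V_def poly_sum H_def xp xp[unfolded mult.commute[of p]] x mult_ac)
      also have "\<dots> = 0" by (simp add: V0[OF k])
      finally show "poly ((pderiv ^^ k) (f ^ l * G)) x = 0" .
    next
      fix j assume j: "0 < j" "j < l"
      show "of_nat j \<noteq> (0::'a)"
      proof
        assume "of_nat j = (0::'a)"
        hence "p dvd j" using p by (simp add: of_nat_eq_0_iff_char_dvd)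
        thus False using j l by (auto dest: dvd_imp_le)
      qed
    qed
  qed simp
  also have "\<dots> \<le> l * ?m + degree G"
    using degree_mult_le[of "f ^ l" G] degree_power_le[of f l] by (simp add: mult.commute)
  also have "degree G \<le> D + p * ?m + p * J" unfolding G_def
  proof (intro degree_sum_le)
    fix i j assume ij: "i \<in> {..<d}" "j \<in> {..<J}"
    have "e * i \<le> d * e" using ij by (simp add: mult.commute)
    hence "e * i \<le> p" using de by linarith
    hence "degree ((f ^ e) ^ i) \<le> p * ?m"
      using degree_power_le[of f "e * i"] mult_le_mono2[of "e * i" p ?m]
      by (metis le_trans mult.commute power_mult)
    moreover have "degree (?X ^ (p * j)) \<le> p * J" using ij by (simp add: degree_power_eq)
    moreover have "degree (H i j * (f ^ e) ^ i * ?X ^ (p * j)) \<le> degree (H i j) + degree ((f ^ e) ^ i) + degree (?X ^ (p * j))"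
      using degree_mult_le[of "H i j * (f ^ e) ^ i" "?X ^ (p * j)"] degree_mult_le[of "H i j" "(f ^ e) ^ i"] by linarith
    ultimately show "degree (H i j * (f ^ e) ^ i * ?X ^ (p * j)) \<le> D + p * ?m + p * J"
      using Hdeg[of i j] by linarith
  qed auto
  finally show ?thesis by simp
qed

text \<open>A translation of \<open>stepanov_poly\<close> into congruences, for f the product of the
  (X + \<beta> i)^(r i). It mentions no field type and quantifies over everything but p, so that it
  can be carried over from a type with p elements. The conditions on \<beta> say that f(0) is
  nonzero and that -\<beta>(i0) is a root of multiplicity exactly r(i0).\<close>

definition stepanov_bound :: "nat \<Rightarrow> bool" where
  "stepanov_bound p \<longleftrightarrow> (\<forall>(n::nat) \<beta> r i0 d e l D J a m.
     (\<forall>i<n. 0 < \<beta> i \<and> \<beta> i < p) \<and> i0 < n \<and> (\<forall>i<n. i \<noteq> i0 \<longrightarrow> \<beta> i \<noteq> \<beta> i0) \<and>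
     coprime (r i0) d \<and> m = (\<Sum>i<n. r i) \<and> d * e = p - 1 \<and>
     l * (D + l * m + J) < d * J * D \<and> l \<le> p \<and> d * (2 ^ d * (D + m)) < p \<longrightarrow>
     l * card {x\<in>{..<p}. [(\<Prod>i<n. (x + \<beta> i) ^ r i) ^ e = a] (mod p)} \<le> l * m + D + p * m + p * J)"

lemma stepanov_bound_card: "stepanov_bound CARD('a::prime_card)"
  unfolding stepanov_bound_def
proof (intro allI impI, elim conjE)
  fix n i0 d e l D J a m :: nat and \<beta> r :: "nat \<Rightarrow> nat"
  let ?p = "CARD('a)"
  assume \<beta>: "\<forall>i<n. 0 < \<beta> i \<and> \<beta> i < ?p" and i0: "i0 < n" and uniq: "\<forall>i<n. i \<noteq> i0 \<longrightarrow> \<beta> i \<noteq> \<beta> i0"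
    and cop: "coprime (r i0) d" and m: "m = (\<Sum>i<n. r i)" and de: "d * e = ?p - 1"
    and sys: "l * (D + l * m + J) < d * J * D" and l: "l \<le> ?p" and small: "d * (2 ^ d * (D + m)) < ?p"
  define f :: "'a mod_ring poly" where "f = (\<Prod>i<n. [:of_nat (\<beta> i),1:] ^ r i)"
  have inj: "x = y" if "of_nat x = (of_nat y :: 'a mod_ring)" "x < ?p" "y < ?p" for x y
    using that by (simp add: of_nat_eq_iff_cong_CHAR cong_less_modulus_unique_nat)
  have deg: "degree f = m"
    unfolding f_def m by (subst degree_prod_eq_sum_degree) (auto simp: degree_power_eq)
  define F where "F = (\<Prod>i\<in>{..<n}-{i0}. [:of_nat (\<beta> i),1:] ^ r i :: 'a mod_ring poly)"
  have f: "f = [:-(-of_nat (\<beta> i0)),1:] ^ r i0 * F"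
    unfolding f_def F_def using i0 by (subst prod.remove[of _ i0]) auto
  have "of_nat (\<beta> i) - of_nat (\<beta> i0) \<noteq> (0 :: 'a mod_ring)" if "i < n" "i \<noteq> i0" for i
    using inj[of "\<beta> i" "\<beta> i0"] \<beta> uniq that i0 by auto
  hence Fx: "poly F (-of_nat (\<beta> i0)) \<noteq> 0" by (auto simp: F_def poly_prod)
  have "of_nat (\<beta> i) \<noteq> (0 :: 'a mod_ring)" if "i < n" for i
    using inj[of "\<beta> i" 0] \<beta> that by (metis of_nat_0 less_not_refl zero_less_card_finite)
  hence f0: "poly f 0 \<noteq> 0" by (auto simp: f_def poly_prod)
  define N where "N = {x\<in>{..<?p}. [(\<Prod>i<n. (x + \<beta> i) ^ r i) ^ e = a] (mod ?p)}"
  have "card N \<le> card {x. poly f x ^ e = (of_nat a :: 'a mod_ring)}"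
  proof (rule card_inj_on_le[of of_nat])
    show "inj_on (of_nat :: nat \<Rightarrow> 'a mod_ring) N" by (intro inj_onI) (auto simp: N_def intro: inj)
    show "of_nat ` N \<subseteq> {x. poly f x ^ e = (of_nat a :: 'a mod_ring)}"
    proof clarsimp
      fix x assume "x \<in> N"
      hence "of_nat ((\<Prod>i<n. (x + \<beta> i) ^ r i) ^ e) = (of_nat a :: 'a mod_ring)"
        by (simp only: N_def mem_Collect_eq of_nat_eq_iff_cong_CHAR semiring_char_mod_ring)
      thus "poly f (of_nat x) ^ e = (of_nat a :: 'a mod_ring)"
        by (simp add: f_def poly_prod add.commute)
    qed
  qed simp
  hence "l * card N \<le> l * card {x. poly f x ^ e = (of_nat a :: 'a mod_ring)}" by simp
  also have "\<dots> \<le> l * degree f + D + ?p * degree f + ?p * J"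
    by (rule stepanov_poly[OF _ _ f Fx cop f0 de]) (use sys l small deg in auto)
  finally show "l * card N \<le> l * m + D + ?p * m + ?p * J" by (simp add: deg)
qed

text \<open>Finite fields are types here, so a prime given as a term has no field attached to it.
  The type \<open>stepanov_index\<close> has as its cardinality a counterexample to the bound, if there is one;
  applying the bound for types of prime cardinality to it shows that there is none.\<close>

definition stepanov_prime :: nat where
  "stepanov_prime = (if \<exists>p. prime p \<and> \<not> stepanov_bound p then SOME p. prime p \<and> \<not> stepanov_bound p else 2)"

lemma prime_stepanov_prime: "prime stepanov_prime"
proof (cases "\<exists>p. prime p \<and> \<not> stepanov_bound p")
  case True
  thus ?thesis using someI_ex[OF True] by (simp add: stepanov_prime_def)
next
  case False
  show ?thesis unfolding stepanov_prime_def if_not_P[OF False] by simp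
qed

typedef stepanov_index = "{..<stepanov_prime}"
  using prime_gt_0_nat[OF prime_stepanov_prime] by (intro exI[of _ 0]) simp

lemma card_stepanov_index: "CARD(stepanov_index) = stepanov_prime"
  using type_definition.card[OF type_definition_stepanov_index] by simp

instance stepanov_index :: prime_card
  by standard (simp add: card_stepanov_index prime_stepanov_prime)

lemma stepanov:
  assumes "prime p"
  shows "stepanov_bound p"
proof (rule ccontr)
  assume "\<not> stepanov_bound p"
  hence ex: "\<exists>p. prime p \<and> \<not> stepanov_bound p" using assms by blast
  hence "\<not> stepanov_bound stepanov_prime"
    unfolding stepanov_prime_def using someI_ex[OF ex] by simp
  thus False using stepanov_bound_card[where 'a = stepanov_index] by (simp add: card_stepanov_index)
qed

section \<open>Mertens' theorems\<close>

abbreviation \<Lambda> :: "nat \<Rightarrow> real" where "\<Lambda> \<equiv> mangoldt"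

lemma card_multiples:
  assumes "d > 0"
  shows "card {k\<in>{1..n}. d dvd k} = n div (d::nat)"
proof -
  have "{k\<in>{1..n}. d dvd k} = (\<lambda>i. d * i) ` {1..n div d}"
  proof (intro equalityI subsetI)
    fix k assume "k \<in> {k\<in>{1..n}. d dvd k}"
    then obtain i where "k = d * i" "1 \<le> k" "k \<le> n" by auto
    thus "k \<in> (\<lambda>i. d * i) ` {1..n div d}"
      using assms by (intro image_eqI[of _ _ i]) (auto simp: less_eq_div_iff_mult_less_eq mult.commute Suc_le_eq)
  next
    fix k assume "k \<in> (\<lambda>i. d * i) ` {1..n div d}"
    thus "k \<in> {k\<in>{1..n}. d dvd k}"
      using assms by (auto simp: less_eq_div_iff_mult_less_eq mult.commute Suc_le_eq)
  qed
  moreover have "inj_on (\<lambda>i. d * i) {1..n div d}" using assms by (auto intro: inj_onI)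
  ultimately show ?thesis by (simp add: card_image)
qed

text \<open>Chebyshev's identity: \<open>ln k\<close> is the sum of \<Lambda> over the divisors of
  k, and d divides exactly \<open>n div d\<close> of the numbers from 1 to n.\<close>

lemma ln_fact_eq_sum_mangoldt: "ln (fact n) = (\<Sum>d=1..n. \<Lambda> d * real (n div d))"
proof -
  have "ln (fact n :: real) = (\<Sum>k=1..n. ln (real k))"
    by (induction n) (simp_all add: ln_mult)
  also have "\<dots> = (\<Sum>k=1..n. \<Sum>d | d dvd k. \<Lambda> d)"
  proof (rule sum.cong)
    fix k assume "k \<in> {1..n}"
    hence "k \<noteq> 0" by simp
    thus "ln (real k) = (\<Sum>d | d dvd k. \<Lambda> d)" using mangoldt_sum[of k, where ?'a = real] by simp
  qed simp
  also have "\<dots> = (\<Sum>k=1..n. \<Sum>d\<in>{d\<in>{1..n}. d dvd k}. \<Lambda> d)"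
  proof (rule sum.cong[OF refl])
    fix k assume k: "k \<in> {1..n}"
    hence "{d. d dvd k} = {d\<in>{1..n}. d dvd k}"
      using dvd_imp_le dvd_pos_nat by (force simp: Suc_le_eq)
    thus "(\<Sum>d | d dvd k. \<Lambda> d) = (\<Sum>d\<in>{d\<in>{1..n}. d dvd k}. \<Lambda> d)" by simp
  qed
  also have "\<dots> = (\<Sum>d=1..n. \<Sum>k\<in>{k\<in>{1..n}. d dvd k}. \<Lambda> d)"
    by (rule sum.swap_restrict) auto
  also have "\<dots> = (\<Sum>d=1..n. \<Lambda> d * real (n div d))"
    using card_multiples[of _ n] by (intro sum.cong) auto
  finally show ?thesis .
qed

text \<open>In the logarithm of the central binomial coefficient every d of this range has
  multiplicity exactly 1 and every other d a nonnegative one, while the coefficient itself is at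
  most \<open>2 ^ (2 * n)\<close>.\<close>

lemma sum_mangoldt_dyadic: "(\<Sum>d\<in>{n<..2*n}. \<Lambda> d) \<le> 2 * real n * ln 2"
proof -
  have "(\<Sum>d\<in>{n<..2*n}. \<Lambda> d) = (\<Sum>d\<in>{n<..2*n}. \<Lambda> d * (real (2 * n div d) - 2 * real (n div d)))"
  proof (rule sum.cong[OF refl])
    fix d assume d: "d \<in> {n<..2*n}"
    hence "2 * n div d = 1" by (intro div_nat_eqI) auto
    moreover have "n div d = 0" using d by simp
    ultimately show "\<Lambda> d = \<Lambda> d * (real (2 * n div d) - 2 * real (n div d))" by simp
  qed
  also have "\<dots> \<le> (\<Sum>d=1..2*n. \<Lambda> d * (real (2 * n div d) - 2 * real (n div d)))"
  proof (rule sum_mono2)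
    fix d
    have "2 * (n div d) \<le> 2 * n div d"
      by (metis div_mult1_eq le_add1 mult.commute nat_mult_div_cancel_disj div_times_less_eq_dividend less_eq_div_iff_mult_less_eq neq0_conv mult.assoc mult_le_mono2 div_by_0 mult_0_right le_refl)
    hence "2 * real (n div d) \<le> real (2 * n div d)" by (metis of_nat_le_iff of_nat_mult of_nat_numeral)
    thus "0 \<le> \<Lambda> d * (real (2 * n div d) - 2 * real (n div d))"
      using mangoldt_nonneg by simp
  qed auto
  also have "\<dots> = ln (fact (2 * n)) - 2 * ln (fact n)"
  proof -
    have "(\<Sum>d=1..n. \<Lambda> d * real (n div d)) = (\<Sum>d=1..2*n. \<Lambda> d * real (n div d))"
      by (rule sum.mono_neutral_left) auto
    thus ?thesis unfolding ln_fact_eq_sum_mangoldt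
      by (simp add: right_diff_distrib sum_subtractf sum_distrib_left mult_ac)
  qed
  also have "\<dots> = ln (real (2 * n choose n))"
    by (simp add: binomial_fact ln_div ln_mult)
  also have "\<dots> \<le> ln (2 ^ (2 * n))"
  proof -
    have "(2 * n choose n) \<le> (\<Sum>k\<le>2*n. 2 * n choose k)" by (rule member_le_sum) auto
    hence "(2 * n choose n) \<le> 2 ^ (2 * n)" using choose_row_sum[of "2 * n"] by simp
    hence "real (2 * n choose n) \<le> 2 ^ (2 * n)" by (metis of_nat_le_iff of_nat_numeral of_nat_power)
    thus ?thesis by (subst ln_le_cancel_iff) auto
  qed
  also have "\<dots> = 2 * real n * ln 2" by (simp add: ln_realpow)
  finally show ?thesis .
qed

lemma sum_mangoldt_le: "(\<Sum>d=1..n. \<Lambda> d) \<le> 6 * real n"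
proof (induction n rule: less_induct)
  case (less n)
  have ln2: "ln 2 \<le> (1::real)" using ln_le_minus_one[of 2] by simp
  have split: "(\<Sum>d=1..2*m. \<Lambda> d) \<le> (\<Sum>d=1..m. \<Lambda> d) + 2 * real m" for m
  proof -
    have "(\<Sum>d=1..2*m. \<Lambda> d) = (\<Sum>d\<in>{1..m} \<union> {m<..2*m}. \<Lambda> d)" by (rule sum.cong) auto
    also have "\<dots> = (\<Sum>d=1..m. \<Lambda> d) + (\<Sum>d\<in>{m<..2*m}. \<Lambda> d)" by (rule sum.union_disjoint) auto
    also have "\<dots> \<le> (\<Sum>d=1..m. \<Lambda> d) + 2 * real m * ln 2" using sum_mangoldt_dyadic by simp
    also have "2 * real m * ln 2 \<le> 2 * real m * 1" using ln2 by (intro mult_left_mono) auto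
    finally show ?thesis by simp
  qed
  show ?case
  proof (cases "n \<le> 1")
    case True
    hence "n = 0 \<or> n = 1" by auto
    thus ?thesis by auto
  next
    case False
    define m where "m = (n + 1) div 2"
    have m: "m < n" "n \<le> 2 * m" "2 * m \<le> n + 1" using False by (auto simp: m_def)
    have "(\<Sum>d=1..n. \<Lambda> d) \<le> (\<Sum>d=1..2*m. \<Lambda> d)"
      using m by (intro sum_mono2) (auto simp: mangoldt_nonneg)
    also have "\<dots> \<le> 6 * real m + 2 * real m" using split[of m] less.IH[OF m(1)] by linarith
    \<comment> \<open>The left side is 8m, hence at most 4n + 4; as n \<ge> 2, the constant 6
      survives the induction.\<close>
    also have "\<dots> \<le> 6 * real n"
    proof -
      have "2 * real m \<le> real n + 1" using m(3) by linarith
      moreover have "real n \<ge> 2" using False by simp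
      ultimately show ?thesis by linarith
    qed
    finally show ?thesis .
  qed
qed

section \<open>Mertens' theorems and primes in short ranges\<close>

definition mertens :: "nat \<Rightarrow> real" where "mertens n = (\<Sum>d=1..n. \<Lambda> d / real d)"

lemma ln_fact_le: "ln (fact n) \<le> real n * ln (real n)"
proof (cases "n = 0")
  case False
  have "fact n \<le> (real n) ^ n" using fact_le_power[of n, where ?'a = real] by simp
  hence "ln (fact n) \<le> ln (real n ^ n)" using False by (subst ln_le_cancel_iff) auto
  thus ?thesis using False by (simp add: ln_realpow)
qed simp

lemma ln_fact_ge: "ln (fact n) \<ge> real n * ln (real n) - real n"
proof (induction n)
  case (Suc n)
  show ?case
  proof (cases "n = 0")
    case False
    have "ln (1 + 1 / real n) \<le> 1 / real n" by (intro ln_add_one_self_le_self) auto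
    moreover have "1 + 1 / real n = real (Suc n) / real n" using False by (simp add: field_simps)
    ultimately have "ln (real (Suc n)) - ln (real n) \<le> 1 / real n" using False by (simp add: ln_div)
    hence "real n * (ln (real (Suc n)) - ln (real n)) \<le> 1" using False by (simp add: field_simps)
    moreover have "ln (fact (Suc n) :: real) = ln (real (Suc n)) + ln (fact n)"
      by (simp only: fact_Suc of_nat_mult) (simp add: ln_mult)
    ultimately show ?thesis using Suc by (simp add: algebra_simps)
  qed simp
qed simp

text \<open>Undoing the rounding in Chebyshev's identity costs at most \<Lambda>(d) for each d, in
  total 6n, whence the constant.\<close>

lemma mertens_upper:
  assumes "n > 0"
  shows "mertens n \<le> ln (real n) + 6"
proof -
  have "real n * mertens n = (\<Sum>d=1..n. \<Lambda> d * (real n / real d))"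
    by (simp add: mertens_def sum_distrib_left mult_ac)
  also have "\<dots> \<le> (\<Sum>d=1..n. \<Lambda> d * (real (n div d) + 1))"
  proof (intro sum_mono mult_left_mono mangoldt_nonneg)
    fix d
    have "real n / real d < of_int \<lfloor>real n / real d\<rfloor> + 1" by linarith
    thus "real n / real d \<le> real (n div d) + 1" by (simp add: floor_divide_of_nat_eq)
  qed
  also have "\<dots> = ln (fact n) + (\<Sum>d=1..n. \<Lambda> d)"
    by (simp add: ln_fact_eq_sum_mangoldt algebra_simps sum.distrib)
  also have "\<dots> \<le> real n * (ln (real n) + 6)"
    using ln_fact_le[of n] sum_mangoldt_le[of n] by (simp add: algebra_simps)
  finally show ?thesis using assms by simp
qed

lemma mertens_lower:
  assumes "n > 0"
  shows "mertens n \<ge> ln (real n) - 1"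
proof -
  have "real n * (ln (real n) - 1) \<le> ln (fact n)" using ln_fact_ge[of n] by (simp add: algebra_simps)
  also have "\<dots> \<le> (\<Sum>d=1..n. \<Lambda> d * (real n / real d))"
    unfolding ln_fact_eq_sum_mangoldt by (intro sum_mono mult_left_mono mangoldt_nonneg of_nat_div_le_of_nat)
  also have "\<dots> = real n * mertens n" by (simp add: mertens_def sum_distrib_left mult_ac)
  finally show ?thesis using assms by simp
qed

text \<open>Partial summation, in the form of an induction whose invariant carries the error term of the first
  theorem of Mertens.\<close>

lemma sum_mangoldt_div_ln_le:
  assumes "2 \<le> m" "m \<le> n"
  shows "(\<Sum>d\<in>{m<..n}. \<Lambda> d / (real d * ln (real d))) \<le> ln (ln (real n) / ln (real m)) + 7 / ln (real m)"
proof -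
  define E where "E k = mertens k - ln (real k)" for k
  define T where "T k = (\<Sum>d\<in>{m<..k}. \<Lambda> d / (real d * ln (real d)))" for k
  \<comment> \<open>E lies between -1 and 6. A step contributes
    \<open>E k * (1 / L - 1 / L')\<close>, at most 6 times a telescoping difference, and the term
    \<open>- 6 / ln n\<close> keeps track of it. The start needs E m \<ge> -1, so the other constant
    is 7 = 6 + 1.\<close>
  have "T n \<le> ln (ln (real n)) - ln (ln (real m)) + E n / ln (real n) + 7 / ln (real m) - 6 / ln (real n)"
    using assms(2)
  proof (induction n rule: dec_induct)
    case base
    have "ln (real m) > 0" using assms by simp
    moreover have "E m \<ge> -1" using mertens_lower[of m] assms by (simp add: E_def)
    ultimately show ?case by (simp add: T_def divide_simps)
  next
    case (step k)
    define L L' where "L = ln (real k)" and "L' = ln (real (Suc k))"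
    have L: "0 < L" "L < L'" using step assms by (auto simp: L_def L'_def)
    have "{m<..Suc k} = insert (Suc k) {m<..k}" using step by auto
    hence "T (Suc k) = T k + \<Lambda> (Suc k) / (real (Suc k) * L')"
      unfolding T_def L'_def by (simp del: of_nat_Suc)
    also have "\<Lambda> (Suc k) / (real (Suc k) * L') = (mertens (Suc k) - mertens k) / L'"
      by (simp add: mertens_def)
    also have "mertens (Suc k) - mertens k = E (Suc k) - E k + L' - L" by (simp add: E_def L_def L'_def)
    finally have T: "T (Suc k) = T k + (E (Suc k) - E k + L' - L) / L'" .
    have "ln (L / L') \<le> L / L' - 1" using L by (intro ln_le_minus_one) auto
    hence a: "1 - L / L' \<le> ln L' - ln L" using L by (simp add: ln_div)
    have "E k \<le> 6" using mertens_upper[of k] step assms by (simp add: E_def)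
    moreover have "1 / L' \<le> 1 / L" using L by (intro divide_left_mono) auto
    ultimately have "(E k - 6) * (1 / L - 1 / L') \<le> 0" by (intro mult_nonpos_nonneg) auto
    hence b: "E k / L - E k / L' - 6 / L + 6 / L' \<le> 0" by (simp add: algebra_simps diff_divide_distrib)
    have "(E (Suc k) - E k + L' - L) / L' = E (Suc k) / L' - E k / L' + (1 - L / L')"
      using L by (simp add: diff_divide_distrib add_divide_distrib)
    with T a b step.IH show ?case unfolding L_def[symmetric] L'_def[symmetric] by linarith
  qed
  moreover have "E n / ln (real n) \<le> 6 / ln (real n)"
    using mertens_upper[of n] assms by (intro divide_right_mono) (auto simp: E_def)
  moreover have "ln (ln (real n) / ln (real m)) = ln (ln (real n)) - ln (ln (real m))"
    using assms by (subst ln_div) auto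
  ultimately show ?thesis by (simp add: T_def)
qed

lemma sum_inverse_primes_le:
  assumes "2 \<le> m" "m \<le> n"
  shows "(\<Sum>q | prime q \<and> m < q \<and> q \<le> n. 1 / real q) \<le> ln (ln (real n) / ln (real m)) + 7 / ln (real m)"
proof -
  have "(\<Sum>q | prime q \<and> m < q \<and> q \<le> n. 1 / real q) = (\<Sum>d | prime d \<and> m < d \<and> d \<le> n. \<Lambda> d / (real d * ln (real d)))"
    using assms by (intro sum.cong) (auto dest: prime_gt_1_nat)
  also have "\<dots> \<le> (\<Sum>d\<in>{m<..n}. \<Lambda> d / (real d * ln (real d)))"
    using assms by (intro sum_mono2) (auto simp: mangoldt_nonneg intro!: divide_nonneg_nonneg mult_nonneg_nonneg)
  also note sum_mangoldt_div_ln_le[OF assms]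
  finally show ?thesis .
qed

lemma sum_mangoldt_nonprime_bounded:
  obtains K where "K \<ge> 0" "\<And>n. (\<Sum>d\<in>{d\<in>{1..n}. \<not> prime d}. \<Lambda> d / real d) \<le> K"
proof -
  \<comment> \<open>For a prime q, the powers q^k with k \<ge> 2 contribute at most 2 ln q / q^2,
    and ln q \<le> 2 \<surd>q turns this into \<open>g q\<close>.\<close>
  define g where "g q = 4 * real q powr (-3/2)" for q
  have sum: "summable g" unfolding g_def
    by (intro summable_mult) (simp add: summable_real_powr_iff)
  define K where "K = suminf g"
  show thesis
  proof
    show "K \<ge> 0" unfolding K_def by (intro suminf_nonneg sum) (simp add: g_def)
    fix n :: nat
    define P where "P = {q. prime q \<and> q \<le> n}"
    have finP: "finite P" by (rule finite_subset[of _ "{..n}"]) (auto simp: P_def)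
    define U where "U = {d\<in>{1..n}. \<not> prime d \<and> primepow d}"
    have "(\<Sum>d\<in>{d\<in>{1..n}. \<not> prime d}. \<Lambda> d / real d) = (\<Sum>d\<in>U. \<Lambda> d / real d)"
      unfolding U_def by (rule sum.mono_neutral_right) (auto simp: mangoldt_def)
    also have "U \<subseteq> (\<lambda>(q,k). q ^ k) ` (P \<times> {2..n})"
    proof
      fix d assume d: "d \<in> U"
      then obtain q k where qk: "prime q" "k > 0" "d = q ^ k" by (auto simp: U_def primepow_def)
      have "k \<noteq> 1" using d qk by (auto simp: U_def)
      moreover have "k \<le> n"
      proof -
        have "k < q ^ k" using qk prime_gt_1_nat by (intro power_gt_expt) auto
        thus ?thesis using d qk by (simp add: U_def)
      qed
      moreover have "q \<le> n"
      proof -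
        have "q \<le> q ^ k" using qk prime_gt_0_nat by (intro self_le_power) (auto simp: Suc_le_eq)
        thus ?thesis using d qk by (simp add: U_def)
      qed
      ultimately show "d \<in> (\<lambda>(q,k). q ^ k) ` (P \<times> {2..n})"
        using qk by (intro image_eqI[of _ _ "(q,k)"]) (auto simp: P_def)
    qed
    hence "(\<Sum>d\<in>U. \<Lambda> d / real d) \<le> (\<Sum>d\<in>(\<lambda>(q,k). q ^ k) ` (P \<times> {2..n}). \<Lambda> d / real d)"
      using finP by (intro sum_mono2) (auto simp: mangoldt_nonneg)
    also have "\<dots> \<le> (\<Sum>x\<in>P \<times> {2..n}. \<Lambda> ((\<lambda>(q,k). q ^ k) x) / real ((\<lambda>(q,k). q ^ k) x))"
      using finP by (intro sum_image_le[unfolded o_def]) (auto simp: mangoldt_nonneg)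
    also have "\<dots> = (\<Sum>q\<in>P. \<Sum>k=2..n. \<Lambda> (q ^ k) / real (q ^ k))"
      by (simp add: sum.cartesian_product case_prod_unfold)
    also have "\<dots> \<le> (\<Sum>q\<in>P. g q)"
    proof (rule sum_mono)
      fix q assume "q \<in> P"
      hence q: "prime q" by (simp add: P_def)
      define x where "x = 1 / real q"
      have q2: "real q \<ge> 2" using q prime_ge_2_nat by (metis of_nat_le_iff of_nat_numeral)
      have x: "0 < x" "x \<le> 1/2" using q2 by (auto simp: x_def field_simps)
      have "(\<Sum>k=2..n. \<Lambda> (q ^ k) / real (q ^ k)) = ln (real q) * (\<Sum>k=2..n. x ^ k)"
        unfolding sum_distrib_left using q by (intro sum.cong) (auto simp: x_def power_divide)
      also have "(\<Sum>k=2..n. x ^ k) \<le> 2 * x ^ 2"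
      proof -
        have "(1 - x) * (\<Sum>k=2..n. x ^ k) \<le> x ^ 2"
        proof (cases "2 \<le> n")
          case True
          thus ?thesis using sum_gp_multiplied[OF True, of x] x by simp
        qed simp
        moreover have "1/2 * (\<Sum>k=2..n. x ^ k) \<le> (1 - x) * (\<Sum>k=2..n. x ^ k)"
          using x by (intro mult_right_mono sum_nonneg) auto
        ultimately show ?thesis by linarith
      qed
      also have "ln (real q) \<le> 2 * real q powr (1/2)"
      proof -
        have "ln (real q powr (1/2)) \<le> real q powr (1/2)"
          using q2 by (intro less_imp_le[OF ln_less_self]) auto
        thus ?thesis using q2 by (simp add: ln_powr)
      qed
      finally have "(\<Sum>k=2..n. \<Lambda> (q ^ k) / real (q ^ k)) \<le> 2 * real q powr (1/2) * (2 * x ^ 2)"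
        using x q2 by (smt (verit) mult_right_mono mult_left_mono ln_ge_zero zero_le_power2)
      also have "x ^ 2 = real q powr (-2)" using q2 by (simp add: x_def powr_minus powr_numeral field_simps)
      also have "2 * real q powr (1/2) * (2 * real q powr (-2)) = g q"
        by (simp add: g_def powr_add[symmetric])
      finally show "(\<Sum>k=2..n. \<Lambda> (q ^ k) / real (q ^ k)) \<le> g q" .
    qed
    also have "\<dots> \<le> K" unfolding K_def using finP by (intro sum_le_suminf sum) (auto simp: g_def)
    finally show "(\<Sum>d\<in>{d\<in>{1..n}. \<not> prime d}. \<Lambda> d / real d) \<le> K" .
  qed
qed

lemma sum_ln_div_primes_ge:
  obtains K :: real where "K > 0"
    "\<And>w x. 1 \<le> w \<Longrightarrow> w \<le> x \<Longrightarrow> (\<Sum>q | prime q \<and> w < real q \<and> real q \<le> x. ln (real q) / real q) \<ge> ln (x / w) - K"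
proof -
  obtain K0 where K0: "K0 \<ge> 0" "\<And>n. (\<Sum>d\<in>{d\<in>{1..n}. \<not> prime d}. \<Lambda> d / real d) \<le> K0"
    using sum_mangoldt_nonprime_bounded by blast
  show thesis
  proof
    \<comment> \<open>8 = 1 + 6 + 1: the errors of the two bounds for \<open>mertens\<close>, and at
      most ln 2 for replacing x by its integer part. The proper prime powers cost K0.\<close>
    show "K0 + 8 > 0" using K0 by simp
    fix w x :: real assume wx: "1 \<le> w" "w \<le> x"
    define m n where "m = nat \<lfloor>w\<rfloor>" and "n = nat \<lfloor>x\<rfloor>"
    have m: "m \<ge> 1" "real m \<le> w" "w < real m + 1" using wx unfolding m_def by linarith+
    have n: "n \<ge> 1" "real n \<le> x" "x < real n + 1" using wx unfolding n_def by linarith+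
    have mn: "m \<le> n" using wx unfolding m_def n_def by (intro nat_mono floor_mono)
    have P: "{q. prime q \<and> w < real q \<and> real q \<le> x} = {q\<in>{m<..n}. prime q}"
      unfolding m_def n_def using wx by (auto simp: nat_less_iff le_nat_iff floor_less_iff le_floor_iff)
    define Q where "Q = {q\<in>{m<..n}. prime q}"
    have "mertens n = mertens m + (\<Sum>d\<in>{m<..n}. \<Lambda> d / real d)"
    proof -
      have "{1..n} = {1..m} \<union> {m<..n}" using mn by auto
      moreover have "{1..m} \<inter> {m<..n} = {}" by auto
      ultimately show ?thesis unfolding mertens_def by (simp only: sum.union_disjoint finite_atLeastAtMost finite_greaterThanAtMost)
    qed
    also have "(\<Sum>d\<in>{m<..n}. \<Lambda> d / real d) = (\<Sum>d\<in>Q. \<Lambda> d / real d) + (\<Sum>d\<in>{d\<in>{m<..n}. \<not> prime d}. \<Lambda> d / real d)"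
      unfolding Q_def by (subst sum.union_disjoint[symmetric]) (auto intro!: sum.cong)
    also have "(\<Sum>d\<in>{d\<in>{m<..n}. \<not> prime d}. \<Lambda> d / real d) \<le> (\<Sum>d\<in>{d\<in>{1..n}. \<not> prime d}. \<Lambda> d / real d)"
      by (rule sum_mono2) (auto simp: mangoldt_nonneg)
    also note K0(2)
    also have "(\<Sum>d\<in>Q. \<Lambda> d / real d) = (\<Sum>q\<in>Q. ln (real q) / real q)"
      by (rule sum.cong) (auto simp: Q_def)
    finally have "(\<Sum>q\<in>Q. ln (real q) / real q) \<ge> mertens n - mertens m - K0" by simp
    moreover have "mertens n \<ge> ln (real n) - 1" "mertens m \<le> ln (real m) + 6"
      using mertens_lower mertens_upper m n by auto
    moreover have "ln (real m) \<le> ln w" using m by (subst ln_le_cancel_iff) auto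
    moreover have "ln (real n) \<ge> ln x - 1"
    proof -
      have "real n \<ge> 1" using n by simp
      hence "0 < x" "0 < 2 * real n" "x \<le> 2 * real n" using n wx by linarith+
      hence "ln x \<le> ln (2 * real n)" by simp
      also have "\<dots> = ln 2 + ln (real n)" using n by (simp add: ln_mult)
      finally show ?thesis using ln_le_minus_one[of 2] by simp
    qed
    moreover have "ln (x / w) = ln x - ln w" using wx by (simp add: ln_div)
    ultimately show "(\<Sum>q | prime q \<and> w < real q \<and> real q \<le> x. ln (real q) / real q) \<ge> ln (x / w) - (K0 + 8)"
      unfolding P Q_def[symmetric] by linarith
  qed
qed

text \<open>With c = exp(-(K + 1)) the sum of ln q / q over the primes in the interval is at least
  1, while a single term is at most ln x / (c x). These primes will be the multipliers in Burgess'
  method, which have to be of comparable size.\<close>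

lemma many_primes_in_interval:
  obtains c :: real where "0 < c" "c < 1"
    "\<And>x. 1 \<le> c * x \<Longrightarrow> c * x \<le> ln x * card {q. prime q \<and> c * x < real q \<and> real q \<le> x}"
proof -
  obtain K :: real where K: "K > 0"
    "\<And>w x. 1 \<le> w \<Longrightarrow> w \<le> x \<Longrightarrow> (\<Sum>q | prime q \<and> w < real q \<and> real q \<le> x. ln (real q) / real q) \<ge> ln (x / w) - K"
    using sum_ln_div_primes_ge by blast
  define c where "c = exp (- (K + 1))"
  show thesis
  proof
    show c: "0 < c" "c < 1" using K by (auto simp: c_def)
    fix x assume x: "1 \<le> c * x"
    define P where "P = {q. prime q \<and> c * x < real q \<and> real q \<le> x}"
    have x0: "x > 0" using x c by (smt (verit) zero_less_mult_pos)
    have cx: "c * x \<le> x" using c x0 by simp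
    hence x1: "x \<ge> 1" using x by linarith
    have "1 = ln (x / (c * x)) - K" using x0 c by (simp add: c_def exp_minus ln_div)
    also have "\<dots> \<le> (\<Sum>q\<in>P. ln (real q) / real q)" unfolding P_def by (rule K(2)[OF x cx])
    also have "\<dots> \<le> (\<Sum>q\<in>P. ln x / (c * x))"
      using x x1 by (intro sum_mono frac_le) (auto simp: P_def)
    also have "\<dots> = ln x * card P / (c * x)" by simp
    finally show "c * x \<le> ln x * card P" using x by (simp add: field_simps)
  qed
qed

section \<open>Complete character sums\<close>

text \<open>The dominant term of Stepanov's bound is p J / l, which would be p / d for l = d J.
  Giving up a constant s in l makes the system solvable: with J about \<surd>p and D a constant
  proportion of p, the conditions beyond l * D number O(J^2) = O(D). The loss in p J / l is then
  O(\<surd>p).\<close>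

lemma stepanov_card_le:
  fixes d m :: nat
  assumes "d \<ge> 1"
  obtains C :: real and p0 :: nat where "C \<ge> 0"
    "\<And>p n \<beta> r i0 e a. prime p \<Longrightarrow> p \<ge> p0 \<Longrightarrow> (\<And>i. i < n \<Longrightarrow> 0 < \<beta> i \<and> \<beta> i < p) \<Longrightarrow> i0 < n \<Longrightarrow>
        (\<And>i. i < n \<Longrightarrow> i \<noteq> i0 \<Longrightarrow> \<beta> i \<noteq> \<beta> i0) \<Longrightarrow> coprime (r i0) d \<Longrightarrow> (\<Sum>i<n. r i) = m \<Longrightarrow> d * e = p - 1 \<Longrightarrow>
        real (card {x\<in>{..<p}. [(\<Prod>i<n::nat. (x + \<beta> i) ^ r i) ^ e = a] (mod p)}) \<le> real p / real d + C * sqrt (real p)"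
proof -
  \<comment> \<open>K is 4 * d * 2^d, so that D = p div K meets the smallness condition. By J^2
    \<le> p \<le> 2 K D, the excess conditions number less than s * D. The factor 4 in C comes from
    l \<ge> d \<surd>p / 4.\<close>
  define K where "K = d * 2 ^ (d + 2)"
  define s where "s = 2 * K * d * (d * m + 1) + 1"
  define C where "C = 4 * real (2 * m + 1 + s)"
  define p0 where "p0 = 4 * K * (m + 1) + d\<^sup>2 + (2 * s + 2)\<^sup>2 + 4"
  have K0: "K > 0" using assms by (simp add: K_def)
  show thesis
  proof
    show "C \<ge> 0" by (simp add: C_def)
    fix p n :: nat and \<beta> r :: "nat \<Rightarrow> nat" and i0 e a :: nat
    assume p: "prime p" "p \<ge> p0" and \<beta>: "\<And>i. i < n \<Longrightarrow> 0 < \<beta> i \<and> \<beta> i < p" and i0: "i0 < n"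
      and uniq: "\<And>i. i < n \<Longrightarrow> i \<noteq> i0 \<Longrightarrow> \<beta> i \<noteq> \<beta> i0" and cop: "coprime (r i0) d"
      and m: "(\<Sum>i<n. r i) = m" and de: "d * e = p - 1"
    define D where "D = p div K"
    define J where "J = nat \<lfloor>sqrt (real p)\<rfloor>"
    define l where "l = d * J - s"
    define N where "N = card {x\<in>{..<p}. [(\<Prod>i<n. (x + \<beta> i) ^ r i) ^ e = a] (mod p)}"
    have J: "real J \<le> sqrt (real p)" "sqrt (real p) < real J + 1"
      using floor_correct[of "sqrt (real p)"] by (auto simp: J_def)
    have "real J ^ 2 \<le> sqrt (real p) ^ 2" using J(1) by (intro power_mono) auto
    hence "real (J\<^sup>2) \<le> real p" by simp
    hence J2: "J\<^sup>2 \<le> p" by (simp only: of_nat_le_iff)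
    have "(2 * s + 2)\<^sup>2 \<le> p" using p(2) by (simp add: p0_def)
    hence "real ((2 * s + 2)\<^sup>2) \<le> real p" by (simp only: of_nat_le_iff)
    hence "real (2 * s + 2) \<le> sqrt (real p)" by (intro real_le_rsqrt) simp
    hence Js: "2 * s + 1 \<le> J" and sq2: "sqrt (real p) \<ge> 2" using J(2) by linarith+
    have "d\<^sup>2 \<le> p" using p(2) by (simp add: p0_def)
    hence "(real d)\<^sup>2 \<le> real p" by (metis of_nat_le_iff of_nat_power)
    hence dsq: "real d \<le> sqrt (real p)" by (intro real_le_rsqrt)
    have "d * J \<le> p"
    proof -
      have "real d * real J \<le> sqrt (real p) * sqrt (real p)" using dsq J by (intro mult_mono) auto
      hence "real (d * J) \<le> real p" by simp
      thus ?thesis by (simp only: of_nat_le_iff)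
    qed
    hence lp: "l \<le> p" by (simp add: l_def)
    have dJs: "2 * s < d * J" using Js assms mult_le_mono1[of 1 d J] by linarith
    hence ls: "l + s = d * J" by (simp add: l_def)
    have pK: "4 * K * (m + 1) \<le> p" using p(2) unfolding p0_def by linarith
    have DK: "K * D \<le> p" "p < K * D + K" unfolding D_def
      using K0 by (simp, metis add.commute dividend_less_times_div mult.commute)
    have D2: "p \<le> 2 * K * D"
    proof -
      have "4 * K * 1 \<le> 4 * K * (m + 1)" by (intro mult_le_mono2) simp
      hence "4 * K \<le> p" using pK by linarith
      thus ?thesis using DK by linarith
    qed
    have p_pos: "p > 0" using p(1) prime_gt_0_nat by blast
    hence D0: "D > 0" using D2 by (intro Nat.gr0I) auto
    have small: "d * (2 ^ d * (D + m)) < p"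
    proof -
      have "4 * (d * (2 ^ d * (D + m))) = K * D + K * m" by (simp add: K_def algebra_simps)
      moreover have "K * m \<le> 4 * K * (m + 1)" by simp
      ultimately show ?thesis using DK(1) pK p_pos by linarith
    qed
    have sys: "l * (D + l * m + J) < d * J * D"
    proof -
      have "l * (l * m + J) \<le> (d * J) * ((d * J) * m + J)"
        using ls by (intro mult_le_mono add_le_mono mult_le_mono1) auto
      also have "\<dots> = d * (d * m + 1) * J\<^sup>2" by (simp add: power2_eq_square algebra_simps)
      also have "\<dots> \<le> d * (d * m + 1) * (2 * K * D)" using J2 D2 by (intro mult_le_mono2) linarith
      also have "\<dots> < s * D" using D0 by (simp add: s_def algebra_simps)
      finally have "l * (l * m + J) < s * D" .
      moreover have "(l + s) * D = d * J * D" using ls by simp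
      ultimately show ?thesis by (simp add: algebra_simps)
    qed
    note bound = stepanov[OF p(1), unfolded stepanov_bound_def, THEN spec[of _ n], THEN spec[of _ \<beta>],
        THEN spec[of _ r], THEN spec[of _ i0], THEN spec[of _ d], THEN spec[of _ e], THEN spec[of _ l],
        THEN spec[of _ D], THEN spec[of _ J], THEN spec[of _ a], THEN spec[of _ m], THEN mp]
    have "l * N \<le> l * m + D + p * m + p * J"
      unfolding N_def by (rule bound) (use \<beta> i0 uniq cop m de sys lp small in blast)
    also have "\<dots> \<le> p * m + p + p * m + p * J"
      using lp by (intro add_le_mono mult_le_mono1) (auto simp: D_def)
    finally have "real (l * N) \<le> real (p * m + p + p * m + p * J)" by (simp only: of_nat_le_iff)
    hence main: "real l * real N \<le> real p * real J + (2 * real m + 1) * real p" by (simp add: algebra_simps)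
    have l_lower: "real l \<ge> real d * sqrt (real p) / 4"
    proof -
      have "2 * l \<ge> d * J" using dJs ls by linarith
      hence "2 * real l \<ge> real d * real J" by (metis of_nat_le_iff of_nat_mult of_nat_numeral)
      moreover have "real d * real J \<ge> real d * (sqrt (real p) / 2)"
        using J sq2 by (intro mult_left_mono) auto
      ultimately show ?thesis by (simp add: algebra_simps)
    qed
    have l0: "real l > 0" using l_lower assms p_pos
      by (smt (verit) divide_pos_pos mult_pos_pos of_nat_0_less_iff real_sqrt_gt_zero Suc_le_eq One_nat_def)
    have d1: "real d \<ge> 1" using assms by simp
    have ldJ: "real l = real d * real J - real s" using ls by (metis add_diff_cancel_right' of_nat_add of_nat_mult)
    have "real l * (real p / real d + C * sqrt (real p)) = real p * real J - real s * real p / real d + C * sqrt (real p) * real l"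
    proof -
      have "real l * (real p / real d) = real p * real J - real s * real p / real d"
        unfolding ldJ using d1 by (simp add: field_simps)
      thus ?thesis by (simp add: algebra_simps)
    qed
    moreover have "real s * real p / real d \<le> real s * real p"
      using d1 mult_left_mono[of 1 "real d" "real s * real p"] by (simp add: divide_le_eq)
    moreover have "C * sqrt (real p) * real l \<ge> C * sqrt (real p) * (1 * sqrt (real p) / 4)"
      using l_lower d1 by (intro mult_left_mono order.trans[OF _ l_lower] divide_right_mono mult_right_mono) (auto simp: C_def)
    moreover have "C * sqrt (real p) * (1 * sqrt (real p) / 4) = real (2 * m + 1 + s) * real p"
    proof -
      have "C * sqrt (real p) * (1 * sqrt (real p) / 4) = (C / 4) * (sqrt (real p) * sqrt (real p))" by simp
      also have "\<dots> = C / 4 * real p" by simp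
      finally have eq: "C * sqrt (real p) * (1 * sqrt (real p) / 4) = C / 4 * real p" .
      show ?thesis unfolding eq by (simp add: C_def)
    qed
    ultimately have "real l * real N \<le> real l * (real p / real d + C * sqrt (real p))"
      using main by (simp add: algebra_simps)
    hence "real N \<le> real p / real d + C * sqrt (real p)" using l0 by simp
    thus "real (card {x\<in>{..<p}. [(\<Prod>i<n. (x + \<beta> i) ^ r i) ^ e = a] (mod p)}) \<le> real p / real d + C * sqrt (real p)"
      by (simp add: N_def)
  qed
qed

section \<open>Multiplicative characters modulo a prime, as functions on the natural numbers\<close>

lemma primroot_generates:
  assumes "prime p" "residue_primroot p g" "\<not> p dvd t"
  shows "\<exists>k. [t = g ^ k] (mod p)"
proof -
  have "t mod p \<in> totatives p"
    using assms by (simp add: totatives_prime prime_gt_0_nat mod_greater_zero_iff_not_dvd)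
  then obtain i where "t mod p = g ^ i mod p"
    using residue_primroot_is_generator[OF prime_gt_1_nat[OF assms(1)] assms(2)] unfolding bij_betw_def by auto
  thus ?thesis by (auto simp: mod_cong_def)
qed

locale mod_char =
  fixes p :: nat and \<psi> :: "nat \<Rightarrow> complex"
  assumes prime: "prime p"
    and mult: "\<psi> (m * n) = \<psi> m * \<psi> n"
    and cong: "[m = n] (mod p) \<Longrightarrow> \<psi> m = \<psi> n"
    and zero_iff: "\<psi> n = 0 \<longleftrightarrow> p dvd n"
    and norm_le: "norm (\<psi> n) \<le> 1"
begin

lemma one [simp]: "\<psi> (Suc 0) = 1"
  using mult[of 1 1] zero_iff[of 1] prime by auto

lemma power: "\<psi> (n ^ k) = \<psi> n ^ k"
  by (induction k) (simp_all add: mult)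

lemma prod: "\<psi> (\<Prod>i\<in>A. f i) = (\<Prod>i\<in>A. \<psi> (f i))"
  by (induction A rule: infinite_finite_induct) (simp_all add: mult)

lemma norm_eq: "\<not> p dvd n \<Longrightarrow> norm (\<psi> n) = 1"
proof -
  assume n: "\<not> p dvd n"
  have "[n ^ (p - 1) = 1] (mod p)" by (rule fermat_theorem[OF prime n])
  hence "norm (\<psi> n) ^ (p - 1) = 1" by (metis cong One_nat_def norm_one norm_power one power)
  thus ?thesis
    using prime_gt_1_nat[OF prime] power_eq_imp_eq_base[of "norm (\<psi> n)" "p - 1" 1] by simp
qed

text \<open>The order of \<psi> as a character, read off at a primitive root; one is enough, since
  it generates the units. That d divides p - 1 is recorded because Stepanov's method works with the
  exponent e for which d*e = p - 1.\<close>

definition has_order :: "nat \<Rightarrow> bool" where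
  "has_order d \<longleftrightarrow> d dvd p - 1 \<and> (\<exists>g. residue_primroot p g \<and> (\<forall>k. \<psi> g ^ k = 1 \<longleftrightarrow> d dvd k))"

lemma has_order_pos: "has_order d \<Longrightarrow> d > 0"
  unfolding has_order_def using prime_gt_1_nat[OF prime] by (auto intro: Nat.gr0I)

lemma power_order:
  assumes "has_order d" "\<not> p dvd n"
  shows "\<psi> n ^ d = 1"
proof -
  obtain g where g: "residue_primroot p g" "\<And>k. \<psi> g ^ k = 1 \<longleftrightarrow> d dvd k"
    using assms(1) unfolding has_order_def by blast
  obtain i where "[n = g ^ i] (mod p)" using primroot_generates[OF prime g(1) assms(2)] by blast
  hence "\<psi> n = \<psi> g ^ i" by (metis cong power)
  thus ?thesis using g(2)[of d] by (metis dvd_refl power_mult mult.commute power_one)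
qed

text \<open>Conjugates become values of \<psi> too, so the moments below expand into sums of \<psi>
  over polynomial values.\<close>

lemma cnj_eq:
  assumes "has_order d" "d \<ge> 2"
  shows "cnj (\<psi> n) = \<psi> (n ^ (d - 1))"
proof (cases "p dvd n")
  case True
  hence "\<psi> n = 0" by (simp add: zero_iff)
  thus ?thesis using assms(2) by (simp add: power)
next
  case False
  have "\<psi> n * cnj (\<psi> n) = 1" using norm_eq[OF False] by (simp add: complex_norm_square[symmetric])
  moreover have "\<psi> n * \<psi> n ^ (d - 1) = 1"
    using power_order[OF assms(1) False] assms(2) by (simp flip: power_Suc)
  ultimately show ?thesis
    using zero_iff[of n] False by (metis mult_cancel_left power)
qed

text \<open>As the powers \<open>\<omega> ^ i\<close> with i < d sum to 0, each fibre size may be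
  replaced by its deficit from M; the deficits are nonnegative and add up to the right-hand side. A
  fibre lies in one solution set because, writing F x as g^k modulo p, the class i of k modulo d
  fixes (F x)^e as g^(i e).\<close>

lemma norm_sum_le_of_fibre_bound:
  fixes F :: "nat \<Rightarrow> nat" and M :: real
  assumes ord: "has_order d" "d \<ge> 2" and de: "d * e = p - 1"
    and bound: "\<And>a. real (card {x\<in>{..<p}. [F x ^ e = a] (mod p)}) \<le> M"
  shows "norm (\<Sum>x<p. \<psi> (F x)) \<le> real d * M - real p + real (card {x\<in>{..<p}. p dvd F x})"
proof -
  obtain g where g: "residue_primroot p g" "\<And>k. \<psi> g ^ k = 1 \<longleftrightarrow> d dvd k"
    using ord unfolding has_order_def by blast
  define \<omega> where "\<omega> = \<psi> g"
  have gcop: "coprime p g" and gord: "ord p g = p - 1"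
    using g(1) prime by (auto simp: residue_primroot_def totient_prime)
  have \<omega>0: "\<omega> \<noteq> 0" using g(2)[of d] ord(2) by (auto simp: \<omega>_def power_0_left)
  have \<omega>eq: "\<omega> ^ i = \<omega> ^ j \<longleftrightarrow> [i = j] (mod d)" for i j
  proof -
    have *: "\<omega> ^ i = \<omega> ^ j \<longleftrightarrow> [i = j] (mod d)" if "i \<le> j" for i j
    proof -
      have "\<omega> ^ j = \<omega> ^ i * \<omega> ^ (j - i)" using that by (simp flip: power_add)
      hence "\<omega> ^ i = \<omega> ^ j \<longleftrightarrow> \<omega> ^ (j - i) = 1" using \<omega>0 by auto
      thus ?thesis using g(2)[of "j - i"] cong_altdef_nat[OF that, of d] by (metis \<omega>_def cong_sym_eq)
    qed
    show ?thesis by (cases "i \<le> j") (use *[of i j] *[of j i] in \<open>auto simp: cong_sym_eq eq_commute\<close>)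
  qed
  define cls where "cls i = {x\<in>{..<p}. \<psi> (F x) = \<omega> ^ i}" for i
  define Z where "Z = {x\<in>{..<p}. p dvd F x}"
  note gen = primroot_generates[OF prime g(1)]
  have "cls i \<subseteq> {x\<in>{..<p}. [F x ^ e = g ^ (i * e)] (mod p)}" for i
  proof
    fix x assume "x \<in> cls i"
    hence x: "x < p" "\<psi> (F x) = \<omega> ^ i" by (auto simp: cls_def)
    have "\<not> p dvd F x" using x \<omega>0 zero_iff[of "F x"] by auto
    then obtain k where k: "[F x = g ^ k] (mod p)" using gen by blast
    have "\<omega> ^ k = \<omega> ^ i" using cong[OF k] x by (simp add: power \<omega>_def)
    hence "[k = i] (mod d)" using \<omega>eq by simp
    hence "[k * e = i * e] (mod (p - 1))" unfolding de[symmetric] mod_cong_def by (metis mult_mod_left)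
    hence 1: "[g ^ (k * e) = g ^ (i * e)] (mod p)" by (simp only: order_divides_expdiff[OF gcop] gord)
    have 2: "[F x ^ e = g ^ (k * e)] (mod p)" using cong_pow[OF k, of e] by (simp add: power_mult)
    show "x \<in> {x\<in>{..<p}. [F x ^ e = g ^ (i * e)] (mod p)}" using x(1) cong_trans[OF 2 1] by blast
  qed
  hence "card (cls i) \<le> card {x\<in>{..<p}. [F x ^ e = g ^ (i * e)] (mod p)}" for i
    by (intro card_mono) auto
  hence SM: "real (card (cls i)) \<le> M" for i using bound order.trans of_nat_le_iff by meson
  have union: "{..<p} = Z \<union> (\<Union>i<d. cls i)"
  proof (intro equalityI subsetI)
    fix x assume x: "x \<in> {..<p}"
    show "x \<in> Z \<union> (\<Union>i<d. cls i)"
    proof (cases "p dvd F x")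
      case False
      then obtain k where k: "[F x = g ^ k] (mod p)" using gen by blast
      have "\<psi> (F x) = \<omega> ^ k" using cong[OF k] by (simp add: power \<omega>_def)
      also have "\<dots> = \<omega> ^ (k mod d)" by (simp add: \<omega>eq mod_cong_def)
      finally show ?thesis using x ord(2) by (auto simp: cls_def intro!: bexI[of _ "k mod d"])
    qed (use x in \<open>auto simp: Z_def\<close>)
  qed (auto simp: Z_def cls_def)
  have disj: "Z \<inter> (\<Union>i<d. cls i) = {}"
  proof -
    have False if "x \<in> Z" "x \<in> cls i" for x i
      using that zero_iff[of "F x"] \<omega>0 by (simp add: Z_def cls_def)
    thus ?thesis by blast
  qed
  have disj_cls: "cls i \<inter> cls j = {}" if "i < d" "j < d" "i \<noteq> j" for i j
    using that \<omega>eq[of i j] by (auto simp: cls_def mod_cong_def)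
  have fin_cls: "finite (cls i)" for i by (simp add: cls_def)
  have "(\<Sum>x<p. \<psi> (F x)) = (\<Sum>x\<in>Z. \<psi> (F x)) + (\<Sum>x\<in>(\<Union>i<d. cls i). \<psi> (F x))"
    unfolding union by (rule sum.union_disjoint) (use disj fin_cls in \<open>auto simp: Z_def\<close>)
  also have "(\<Sum>x\<in>Z. \<psi> (F x)) = 0" by (intro sum.neutral) (auto simp: Z_def zero_iff)
  also have "(\<Sum>x\<in>(\<Union>i<d. cls i). \<psi> (F x)) = (\<Sum>i<d. \<Sum>x\<in>cls i. \<psi> (F x))"
    by (rule sum.UNION_disjoint) (use fin_cls disj_cls in auto)
  also have "\<dots> = (\<Sum>i<d. of_nat (card (cls i)) * \<omega> ^ i)"
    by (intro sum.cong) (auto simp: cls_def)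
  also have "\<dots> = (\<Sum>i<d. (of_nat (card (cls i)) - of_real M) * \<omega> ^ i) + of_real M * (\<Sum>i<d. \<omega> ^ i)"
    by (simp add: algebra_simps sum_subtractf sum_distrib_left)
  also have "(\<Sum>i<d. \<omega> ^ i) = 0"
  proof -
    have "\<omega> \<noteq> 1" using g(2)[of 1] ord(2) by (auto simp: \<omega>_def)
    moreover have "\<omega> ^ d = 1" using g(2)[of d] by (simp add: \<omega>_def)
    ultimately show ?thesis by (simp add: sum_gp_strict)
  qed
  finally have "norm (\<Sum>x<p. \<psi> (F x)) = norm (\<Sum>i<d. (of_nat (card (cls i)) - of_real M) * \<omega> ^ i)" by simp
  also have "\<dots> \<le> (\<Sum>i<d. norm ((of_nat (card (cls i)) - of_real M) * \<omega> ^ i))" by (rule norm_sum)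
  also have "\<dots> \<le> (\<Sum>i<d. M - real (card (cls i)))"
  proof (rule sum_mono)
    fix i
    have "norm (of_nat (card (cls i)) - of_real M :: complex) = M - real (card (cls i))"
      using SM[of i] by (metis abs_of_nonneg diff_ge_0_iff_ge norm_minus_commute norm_of_real of_real_diff of_real_of_nat_eq)
    moreover have "norm (\<omega> ^ i) \<le> 1" using norm_le[of g] by (simp add: \<omega>_def norm_power power_le_one)
    ultimately show "norm ((of_nat (card (cls i)) - of_real M) * \<omega> ^ i) \<le> M - real (card (cls i))"
      using SM[of i] by (simp add: norm_mult mult_left_le)
  qed
  also have "\<dots> = real d * M - real (\<Sum>i<d. card (cls i))" by (simp add: sum_subtractf)
  also have "(\<Sum>i<d. card (cls i)) = card (\<Union>i<d. cls i)"
    by (rule card_UN_disjoint[symmetric]) (use fin_cls disj_cls in auto)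
  also have "real (card (\<Union>i<d. cls i)) = real p - real (card Z)"
  proof -
    have "card {..<p} = card Z + card (\<Union>i<d. cls i)"
      unfolding union by (rule card_Un_disjoint) (use disj fin_cls in \<open>auto simp: Z_def\<close>)
    thus ?thesis by simp
  qed
  finally show ?thesis by (simp add: Z_def)
qed

end

text \<open>With p / d + O(\<surd>p) for each of the d fibres the main terms cancel, and the at most
  n zeros fit into the error. A shift that occurs only once, with exponent prime to d, keeps the
  polynomial away from the d-th powers, where there is no cancellation.\<close>

lemma character_sum_bound:
  fixes d m n :: nat
  assumes d: "d \<ge> 2"
  obtains C :: real and p0 :: nat where "C \<ge> 0"
    "\<And>p \<psi> \<beta> r i0. mod_char p \<psi> \<Longrightarrow> p \<ge> p0 \<Longrightarrow> mod_char.has_order p \<psi> d \<Longrightarrow>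
        (\<And>i. i < n \<Longrightarrow> 0 < \<beta> i \<and> \<beta> i < p) \<Longrightarrow> i0 < n \<Longrightarrow>
        (\<And>i. i < n \<Longrightarrow> i \<noteq> i0 \<Longrightarrow> \<beta> i \<noteq> \<beta> i0) \<Longrightarrow> coprime (r i0) d \<Longrightarrow> (\<Sum>i<n. r i) = m \<Longrightarrow>
        norm (\<Sum>x<p. \<psi> (\<Prod>i<n. (x + \<beta> i) ^ r i)) \<le> C * sqrt (real p)"
proof (rule stepanov_card_le[of d m])
  show "1 \<le> d" using d by simp
  fix C :: real and p0 :: nat
  assume C: "C \<ge> 0"
    and bound: "\<And>p n \<beta> r i0 e a. prime p \<Longrightarrow> p \<ge> p0 \<Longrightarrow> (\<And>i. i < n \<Longrightarrow> 0 < \<beta> i \<and> \<beta> i < p) \<Longrightarrow> i0 < n \<Longrightarrow>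
        (\<And>i. i < n \<Longrightarrow> i \<noteq> i0 \<Longrightarrow> \<beta> i \<noteq> \<beta> i0) \<Longrightarrow> coprime (r i0) d \<Longrightarrow> (\<Sum>i<n. r i) = m \<Longrightarrow> d * e = p - 1 \<Longrightarrow>
        real (card {x\<in>{..<p}. [(\<Prod>i<n::nat. (x + \<beta> i) ^ r i) ^ e = a] (mod p)}) \<le> real p / real d + C * sqrt (real p)"
  show thesis
  proof (rule that[of "real d * C + real n" p0])
    show "real d * C + real n \<ge> 0" using C by simp
    fix p i0 :: nat and \<psi> :: "nat \<Rightarrow> complex" and \<beta> r :: "nat \<Rightarrow> nat"
    assume *: "mod_char p \<psi>" "p \<ge> p0" "mod_char.has_order p \<psi> d"
        "\<And>i. i < n \<Longrightarrow> 0 < \<beta> i \<and> \<beta> i < p" "i0 < n"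
        "\<And>i. i < n \<Longrightarrow> i \<noteq> i0 \<Longrightarrow> \<beta> i \<noteq> \<beta> i0" "coprime (r i0) d" "(\<Sum>i<n. r i) = m"
    interpret mod_char p \<psi> by fact
    obtain e where e: "d * e = p - 1" using *(3) unfolding has_order_def by (metis dvdE)
    define F where "F x = (\<Prod>i<n. (x + \<beta> i) ^ r i)" for x
    have "norm (\<Sum>x<p. \<psi> (F x)) \<le> real d * (real p / real d + C * sqrt (real p)) - real p + real (card {x\<in>{..<p}. p dvd F x})"
      unfolding F_def
      by (rule norm_sum_le_of_fibre_bound[OF *(3) d e]) (rule bound[where n = n and \<beta> = \<beta> and r = r and ?i0.0 = i0, OF prime *(2) *(4-8) e])
    moreover have "card {x\<in>{..<p}. p dvd F x} \<le> n"
    proof -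
      have "{x\<in>{..<p}. p dvd F x} \<subseteq> (\<lambda>i. p - \<beta> i) ` {..<n}"
      proof
        fix x assume "x \<in> {x\<in>{..<p}. p dvd F x}"
        hence x: "x < p" "p dvd F x" by auto
        then obtain i where i: "i < n" "p dvd (x + \<beta> i) ^ r i"
          unfolding F_def using prime prime_dvd_prod_iff[of "{..<n}" p "\<lambda>i. (x + \<beta> i) ^ r i"] by auto
        hence "p dvd x + \<beta> i" using prime prime_dvd_power by blast
        then obtain k where k: "x + \<beta> i = p * k" by blast
        have "0 < p * k" "p * k < p * 2" using k x *(4)[OF i(1)] by linarith+
        hence "k = 1" by auto
        thus "x \<in> (\<lambda>i. p - \<beta> i) ` {..<n}" using k i by (intro image_eqI[of _ _ i]) auto
      qed
      thus ?thesis using surj_card_le[of "{..<n}"] by simp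
    qed
    hence "real (card {x\<in>{..<p}. p dvd F x}) \<le> real n * sqrt (real p)"
      using prime_gt_1_nat[OF prime] by (smt (verit) mult_left_le_imp_le mult_le_cancel_left1 of_nat_0_le_iff of_nat_1 of_nat_le_iff of_nat_less_iff real_sqrt_ge_1_iff)
    ultimately show "norm (\<Sum>x<p. \<psi> (\<Prod>i<n. (x + \<beta> i) ^ r i)) \<le> (real d * C + real n) * sqrt (real p)"
      using d by (simp add: F_def algebra_simps)
  qed
qed

section \<open>Burgess' bound\<close>

text \<open>A tuple without an isolated entry takes at most r values, so it is recovered from a list
  of r values and a map from its 2r positions into that list.\<close>

lemma card_repeated_tuples_le:
  assumes r: "r \<ge> 1"
  shows "card {\<beta> \<in> {..<2*r} \<rightarrow>\<^sub>E {1..B::nat}. \<forall>i<2*r. \<exists>j<2*r. j \<noteq> i \<and> \<beta> j = \<beta> i} \<le> r ^ (2 * r) * B ^ r"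
proof -
  define G where "G = (\<lambda>(v :: nat \<Rightarrow> nat, s :: nat \<Rightarrow> nat). \<lambda>i\<in>{..<2*r}. v (s i))"
  define \<Omega> where "\<Omega> = ({..<r} \<rightarrow>\<^sub>E {1..B}) \<times> ({..<2*r} \<rightarrow>\<^sub>E {..<r})"
  have "{\<beta> \<in> {..<2*r} \<rightarrow>\<^sub>E {1..B}. \<forall>i<2*r. \<exists>j<2*r. j \<noteq> i \<and> \<beta> j = \<beta> i} \<subseteq> G ` \<Omega>"
  proof
    fix \<beta> assume "\<beta> \<in> {\<beta> \<in> {..<2*r} \<rightarrow>\<^sub>E {1..B}. \<forall>i<2*r. \<exists>j<2*r. j \<noteq> i \<and> \<beta> j = \<beta> i}"
    hence \<beta>: "\<beta> \<in> {..<2*r} \<rightarrow>\<^sub>E {1..B}" and rep: "\<And>i. i < 2*r \<Longrightarrow> \<exists>j<2*r. j \<noteq> i \<and> \<beta> j = \<beta> i" by auto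
    define Im where "Im = \<beta> ` {..<2*r}"
    have "2 * card Im = (\<Sum>v\<in>Im. 2)" by simp
    also have "\<dots> \<le> (\<Sum>v\<in>Im. card {i\<in>{..<2*r}. \<beta> i = v})"
    proof (rule sum_mono)
      fix v assume "v \<in> Im"
      then obtain i where i: "i < 2*r" "v = \<beta> i" by (auto simp: Im_def)
      obtain j where j: "j < 2*r" "j \<noteq> i" "\<beta> j = \<beta> i" using rep[OF i(1)] by blast
      have "card {i, j} \<le> card {i\<in>{..<2*r}. \<beta> i = v}" using i j by (intro card_mono) auto
      thus "2 \<le> card {i\<in>{..<2*r}. \<beta> i = v}" using j by simp
    qed
    also have "\<dots> = card {..<2*r}"
      using sum.image_gen[of "{..<2*r}" "\<lambda>_. 1::nat" \<beta>] by (simp add: Im_def)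
    finally have k: "card Im \<le> r" by simp
    define k where "k = card Im"
    have fin: "finite Im" and ne: "Im \<noteq> {}" using r by (auto simp: Im_def lessThan_empty_iff)
    have k0: "k > 0" using fin ne by (simp add: k_def card_gt_0_iff)
    obtain h where h: "bij_betw h {0..<k} Im" using ex_bij_betw_nat_finite[OF fin] by (auto simp: k_def)
    have hIm: "h i \<in> Im" if "i < k" for i using h that by (auto simp: bij_betw_def)
    have Im: "Im \<subseteq> {1..B}" using \<beta> by (auto simp: Im_def)
    \<comment> \<open>Fewer than r values may occur; the list is padded with \<open>h 0\<close>,
      which is available as k > 0.\<close>
    define v where "v = (\<lambda>i\<in>{..<r}. if i < k then h i else h 0)"
    have "\<exists>m<k. h m = \<beta> i" if "i < 2*r" for i
    proof -
      have "\<beta> i \<in> h ` {0..<k}" using h that by (auto simp: bij_betw_def Im_def)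
      thus ?thesis by auto
    qed
    then obtain s where s: "\<And>i. i < 2*r \<Longrightarrow> s i < k \<and> h (s i) = \<beta> i" by metis
    have "(v, restrict s {..<2*r}) \<in> \<Omega>"
    proof -
      have "h i \<in> {1..B}" if "i < k" for i using hIm[OF that] Im by blast
      hence "v \<in> {..<r} \<rightarrow>\<^sub>E {1..B}" using k0 by (intro PiE_I) (auto simp: v_def)
      moreover have "restrict s {..<2*r} \<in> {..<2*r} \<rightarrow>\<^sub>E {..<r}"
        using s k less_le_trans by (intro PiE_I) (auto simp: k_def)
      ultimately show ?thesis by (simp add: \<Omega>_def)
    qed
    moreover have "\<beta> = G (v, restrict s {..<2*r})"
    proof
      fix i show "\<beta> i = G (v, restrict s {..<2*r}) i"
      proof (cases "i < 2 * r")
        case True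
        hence "s i < k" "s i < r" "h (s i) = \<beta> i" using s[OF True] k unfolding k_def by linarith+
        thus ?thesis using True by (simp add: G_def v_def)
      next
        case False
        thus ?thesis using PiE_arb[OF \<beta>, of i] by (simp add: G_def)
      qed
    qed
    ultimately show "\<beta> \<in> G ` \<Omega>" by blast
  qed
  hence "card {\<beta> \<in> {..<2*r} \<rightarrow>\<^sub>E {1..B}. \<forall>i<2*r. \<exists>j<2*r. j \<noteq> i \<and> \<beta> j = \<beta> i} \<le> card \<Omega>"
    by (rule surj_card_le[rotated]) (simp add: \<Omega>_def finite_PiE)
  also have "\<dots> = r ^ (2 * r) * B ^ r" by (simp add: \<Omega>_def card_cartesian_product card_PiE mult.commute)
  finally show ?thesis .
qed

text \<open>Expanding the 2r-th power gives one complete sum for each 2r-tuple of shifts, with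
  exponent 1 on the r plain factors and d - 1 on the r conjugate ones. Both are prime to d, so an
  isolated entry at any position yields square-root cancellation. The other tuples number O(B^r) and
  are estimated trivially by p.\<close>

lemma moment_bound:
  assumes d: "d \<ge> 2" and r: "r \<ge> 1"
  obtains C :: real and p0 :: nat where "C \<ge> 0"
    "\<And>p \<psi> B. mod_char p \<psi> \<Longrightarrow> p \<ge> p0 \<Longrightarrow> mod_char.has_order p \<psi> d \<Longrightarrow> B < p \<Longrightarrow>
       (\<Sum>x<p. norm (\<Sum>b=1..B. \<psi> (x + b)) ^ (2 * r)) \<le> C * (real B ^ r * real p + real B ^ (2 * r) * sqrt (real p))"
proof (rule character_sum_bound[OF d, of "2 * r" "r + r * (d - 1)"])
  define e where "e i = (if i < r then 1 else d - 1)" for i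
  fix C0 :: real and p0 :: nat
  assume C0: "C0 \<ge> 0" and bound: "\<And>p \<psi> \<beta> r' i0. mod_char p \<psi> \<Longrightarrow> p \<ge> p0 \<Longrightarrow> mod_char.has_order p \<psi> d \<Longrightarrow>
        (\<And>i. i < 2 * r \<Longrightarrow> 0 < \<beta> i \<and> \<beta> i < p) \<Longrightarrow> i0 < 2 * r \<Longrightarrow>
        (\<And>i. i < 2 * r \<Longrightarrow> i \<noteq> i0 \<Longrightarrow> \<beta> i \<noteq> \<beta> i0) \<Longrightarrow> coprime (r' i0) d \<Longrightarrow> (\<Sum>i<2*r. r' i) = r + r * (d - 1) \<Longrightarrow>
        norm (\<Sum>x<p. \<psi> (\<Prod>i<2*r. (x + \<beta> i) ^ r' i)) \<le> C0 * sqrt (real p)"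
  define C where "C = real (r ^ (2 * r)) + C0"
  show thesis
  proof (rule that[of C p0])
    show "C \<ge> 0" using C0 by (simp add: C_def)
    fix p :: nat and \<psi> :: "nat \<Rightarrow> complex" and B :: nat
    assume \<psi>: "mod_char p \<psi>" and p: "p \<ge> p0" and ord: "mod_char.has_order p \<psi> d" and B: "B < p"
    interpret mod_char p \<psi> by fact
    define T where "T x = (\<Sum>b=1..B. \<psi> (x + b))" for x
    define \<Omega> where "\<Omega> = {..<2*r} \<rightarrow>\<^sub>E {1..B}"
    define bad where "bad = {\<beta> \<in> \<Omega>. \<forall>i<2*r. \<exists>j<2*r. j \<noteq> i \<and> \<beta> j = \<beta> i}"
    have fin\<Omega>: "finite \<Omega>" by (simp add: \<Omega>_def finite_PiE)
    have badB: "card bad \<le> r ^ (2 * r) * B ^ r"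
      unfolding bad_def \<Omega>_def by (rule card_repeated_tuples_le[OF r])
    have card\<Omega>: "card \<Omega> = B ^ (2 * r)" by (simp add: \<Omega>_def card_PiE)
    have T2r: "complex_of_real (norm (T x) ^ (2 * r)) = (\<Sum>\<beta>\<in>\<Omega>. \<psi> (\<Prod>i<2*r. (x + \<beta> i) ^ e i))" for x
    proof -
      have cnjT: "cnj (T x) = (\<Sum>b=1..B. \<psi> ((x + b) ^ (d - 1)))"
        by (simp add: T_def cnj_eq[OF ord d])
      have "complex_of_real (norm (T x) ^ (2 * r)) = (T x * cnj (T x)) ^ r"
        by (simp only: power_mult of_real_power[of "(norm (T x))\<^sup>2" r] complex_norm_square)
      also have "\<dots> = T x ^ r * cnj (T x) ^ r" by (rule power_mult_distrib)
      also have "\<dots> = (\<Prod>i<2*r. if i < r then T x else cnj (T x))"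
      proof -
        have "{..<2*r} \<inter> {i. i < r} = {..<r}" "{..<2*r} \<inter> - {i. i < r} = {r..<2*r}" by auto
        thus ?thesis by (simp add: prod.If_cases)
      qed
      also have "\<dots> = (\<Prod>i<2*r. \<Sum>b=1..B. \<psi> ((x + b) ^ e i))"
        unfolding cnjT by (intro prod.cong refl) (simp add: e_def T_def)
      also have "\<dots> = (\<Sum>\<beta>\<in>\<Omega>. \<Prod>i<2*r. \<psi> ((x + \<beta> i) ^ e i))"
        unfolding \<Omega>_def by (rule prod_sum_PiE) auto
      finally show ?thesis by (simp add: prod)
    qed
    have e_sum: "(\<Sum>i<2*r. e i) = r + r * (d - 1)"
    proof -
      have "{..<2*r} \<inter> {i. i < r} = {..<r}" "{..<2*r} \<inter> - {i. i < r} = {r..<2*r}" by auto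
      thus ?thesis by (simp add: e_def sum.If_cases)
    qed
    have e_cop: "coprime (e i) d" for i using d coprime_diff_one_left_nat[of d] by (simp add: e_def)
    have good: "norm (\<Sum>x<p. \<psi> (\<Prod>i<2*r. (x + \<beta> i) ^ e i)) \<le> C0 * sqrt (real p)" if \<beta>: "\<beta> \<in> \<Omega>" "\<beta> \<notin> bad" for \<beta>
    proof -
      obtain i0 where i0: "i0 < 2*r" "\<And>j. j < 2*r \<Longrightarrow> j \<noteq> i0 \<Longrightarrow> \<beta> j \<noteq> \<beta> i0"
        using \<beta> by (auto simp: bad_def)
      show ?thesis
        by (rule bound[where ?i0.0 = i0 and r' = e and \<beta> = \<beta>, OF \<psi> p ord _ i0 e_cop e_sum])
           (use \<beta>(1) B in \<open>fastforce simp: \<Omega>_def PiE_def Pi_def\<close>)+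
    qed
    have triv: "norm (\<Sum>x<p. \<psi> (\<Prod>i<2*r. (x + \<beta> i) ^ e i)) \<le> real p" for \<beta>
      using norm_sum[of "\<lambda>x. \<psi> (\<Prod>i<2*r. (x + \<beta> i) ^ e i)" "{..<p}"]
        sum_mono[of "{..<p}" "\<lambda>x. norm (\<psi> (\<Prod>i<2*r. (x + \<beta> i) ^ e i))" "\<lambda>_. 1"] norm_le by fastforce
    have "complex_of_real (\<Sum>x<p. norm (T x) ^ (2 * r)) = (\<Sum>\<beta>\<in>\<Omega>. \<Sum>x<p. \<psi> (\<Prod>i<2*r. (x + \<beta> i) ^ e i))"
      unfolding of_real_sum T2r by (rule sum.swap)
    hence "norm (complex_of_real (\<Sum>x<p. norm (T x) ^ (2 * r))) \<le> (\<Sum>\<beta>\<in>\<Omega>. norm (\<Sum>x<p. \<psi> (\<Prod>i<2*r. (x + \<beta> i) ^ e i)))"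
      by (simp only: norm_sum)
    also have "\<dots> \<le> (\<Sum>\<beta>\<in>\<Omega>. (if \<beta> \<in> bad then real p else 0) + C0 * sqrt (real p))"
      by (rule sum_mono) (use good triv C0 in \<open>auto simp: add_increasing2\<close>)
    also have "\<dots> = real (card bad) * real p + real B ^ (2 * r) * (C0 * sqrt (real p))"
    proof -
      have "\<Omega> \<inter> bad = bad" by (auto simp: bad_def)
      thus ?thesis using fin\<Omega> by (simp add: sum.distrib sum.If_cases card\<Omega>)
    qed
    also have "\<dots> \<le> real (r ^ (2 * r) * B ^ r) * real p + real B ^ (2 * r) * (C0 * sqrt (real p))"
      using badB by (intro add_right_mono mult_right_mono) (simp_all only: of_nat_le_iff of_nat_0_le_iff)
    also have "\<dots> \<le> C * (real B ^ r * real p + real B ^ (2 * r) * sqrt (real p))"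
      using C0 by (simp add: C_def algebra_simps)
    finally show "(\<Sum>x<p. norm (\<Sum>b=1..B. \<psi> (x + b)) ^ (2 * r)) \<le> C * (real B ^ r * real p + real B ^ (2 * r) * sqrt (real p))"
      unfolding T_def[symmetric] norm_of_real by linarith
  qed
qed

context mod_char
begin

lemma norm_shifted_sum_diff_le: "norm ((\<Sum>n=1..N. \<psi> (n + h)) - (\<Sum>n=1..N. \<psi> n)) \<le> 2 * real h"
proof (induction h)
  case (Suc h)
  have "(\<Sum>n=1..N. \<psi> (n + Suc h)) - (\<Sum>n=1..N. \<psi> (n + h)) = \<psi> (N + Suc h) - \<psi> (Suc h)"
    by (induction N) (simp_all add: algebra_simps)
  also have "norm \<dots> \<le> norm (\<psi> (N + Suc h)) + norm (\<psi> (Suc h))" by (rule norm_triangle_ineq4)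
  also have "\<dots> \<le> 2" using norm_le[of "N + Suc h"] norm_le[of "Suc h"] by linarith
  finally show ?case
    using Suc norm_triangle_ineq[of "(\<Sum>n=1..N. \<psi> (n + Suc h)) - (\<Sum>n=1..N. \<psi> (n + h))" "(\<Sum>n=1..N. \<psi> (n + h)) - (\<Sum>n=1..N. \<psi> n)"]
    by simp
qed simp

text \<open>Since \<open>n + a b \<equiv> a (n / a + b)\<close>, an interval of length \<open>N\<close> on which the character sum is large
  yields, for every small \<open>a\<close>, many points \<open>n / a\<close> at which the short sum of length \<open>B\<close> is large.\<close>

lemma many_large_short_sums:
  fixes \<eta> :: real
  assumes \<eta>: "\<eta> > 0" and B: "B \<ge> 1" and a: "\<not> p dvd a" "8 * real a * real B \<le> \<eta> * real N"
    and large: "norm (\<Sum>n=1..N. \<psi> n) > \<eta> * real N"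
    and x: "\<And>n. [a * x n = n] (mod p)"
  shows "real (card {n\<in>{1..N}. norm (\<Sum>b=1..B. \<psi> (x n + b)) \<ge> \<eta> * real B / 4}) \<ge> \<eta> * real N / 2"
proof -
  define T where "T n = (\<Sum>b=1..B. \<psi> (x n + b))" for n
  define full where "full = (\<Sum>n=1..N. \<psi> n)"
  \<comment> \<open>The total \<eta> N is shared out: a quarter pays for the shifts, a quarter for
    the n below the threshold \<eta> B / 4, and the remaining half must come from G.\<close>
  define G where "G = {n\<in>{1..N}. norm (T n) \<ge> \<eta> * real B / 4}"
  have shift: "\<psi> (n + a * b) = \<psi> a * \<psi> (x n + b)" for n b
  proof -
    have "[a * x n + a * b = n + a * b] (mod p)" by (intro cong_add x cong_refl)
    hence "\<psi> (n + a * b) = \<psi> (a * x n + a * b)" by (metis cong)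
    also have "a * x n + a * b = a * (x n + b)" by (simp add: algebra_simps)
    finally show ?thesis by (simp add: mult)
  qed
  have "(\<Sum>b=1..B. \<Sum>n=1..N. \<psi> (n + a * b)) = \<psi> a * (\<Sum>n=1..N. T n)"
    unfolding T_def by (subst sum.swap) (simp add: shift sum_distrib_left)
  hence "norm (\<Sum>b=1..B. \<Sum>n=1..N. \<psi> (n + a * b)) = norm (\<Sum>n=1..N. T n)"
    by (simp add: norm_mult norm_eq[OF a(1)])
  also have "\<dots> \<le> (\<Sum>n=1..N. norm (T n))" by (rule norm_sum)
  also have "\<dots> \<le> (\<Sum>n=1..N. (if n \<in> G then real B else 0) + \<eta> * real B / 4)"
  proof (rule sum_mono)
    fix n assume n: "n \<in> {1..N}"
    have "norm (T n) \<le> (\<Sum>b=1..B. 1)" unfolding T_def by (rule sum_norm_le) (rule norm_le)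
    thus "norm (T n) \<le> (if n \<in> G then real B else 0) + \<eta> * real B / 4" using n \<eta> by (auto simp: G_def add_increasing2)
  qed
  also have "\<dots> = real (card G) * real B + \<eta> * real B / 4 * real N"
  proof -
    have "{1..N} \<inter> G = G" by (auto simp: G_def)
    thus ?thesis by (simp add: sum.distrib sum.If_cases)
  qed
  finally have upper: "norm (\<Sum>b=1..B. \<Sum>n=1..N. \<psi> (n + a * b)) \<le> real (card G) * real B + \<eta> * real B / 4 * real N" .
  have "norm ((\<Sum>b=1..B. \<Sum>n=1..N. \<psi> (n + a * b)) - of_nat B * full) = norm (\<Sum>b=1..B. (\<Sum>n=1..N. \<psi> (n + a * b)) - full)"
    by (simp add: sum_subtractf)
  also have "\<dots> \<le> (\<Sum>b=1..B. \<eta> * real N / 4)"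
  proof (rule sum_norm_le)
    fix b assume b: "b \<in> {1..B}"
    have "norm ((\<Sum>n=1..N. \<psi> (n + a * b)) - full) \<le> 2 * real (a * b)"
      unfolding full_def by (rule norm_shifted_sum_diff_le)
    also have "\<dots> \<le> 2 * (real a * real B)" using b by (simp add: mult_left_mono)
    also have "\<dots> \<le> \<eta> * real N / 4" using a(2) by simp
    finally show "norm ((\<Sum>n=1..N. \<psi> (n + a * b)) - full) \<le> \<eta> * real N / 4" .
  qed
  finally have "norm ((\<Sum>b=1..B. \<Sum>n=1..N. \<psi> (n + a * b)) - of_nat B * full) \<le> real B * (\<eta> * real N / 4)" by simp
  moreover have "norm (of_nat B * full) \<le> norm ((\<Sum>b=1..B. \<Sum>n=1..N. \<psi> (n + a * b)) - of_nat B * full) + norm (\<Sum>b=1..B. \<Sum>n=1..N. \<psi> (n + a * b))"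
    using norm_triangle_sub[of "of_nat B * full" "\<Sum>b=1..B. \<Sum>n=1..N. \<psi> (n + a * b)"]
    by (simp only: norm_minus_commute add.commute)
  moreover have "norm (of_nat B * full) \<ge> real B * (\<eta> * real N)"
    using large B by (simp add: norm_mult full_def)
  ultimately have "real B * (\<eta> * real N) \<le> real B * (real (card G) + \<eta> * real N / 2)"
    using upper by (simp add: algebra_simps)
  hence "\<eta> * real N \<le> real (card G) + \<eta> * real N / 2" using B by simp
  thus ?thesis by (simp add: G_def T_def)
qed

end

text \<open>Each multiplier a sends at least \<eta> N / 2 integers n to points n / a with a large
  short sum. By Cauchy-Schwarz these points are many unless there are many collisions n / a \<equiv>
  n' / a' modulo p. The multipliers are primes, so that distinct ones are coprime and collisions
  between them rare.\<close>

lemma burgess_counting: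
  fixes \<eta> w A :: real
  assumes "mod_char p \<psi>"
    and P: "\<And>a. a \<in> P \<Longrightarrow> prime a \<and> w < real a \<and> real a \<le> A" and ne: "P \<noteq> {}" and w: "w > 0" and NA: "real N * A < real p" "A < real p"
    and \<eta>: "\<eta> > 0" and B: "B \<ge> 1" and AB: "8 * A * real B \<le> \<eta> * real N" and N: "N \<ge> 1"
    and large: "norm (\<Sum>n=1..N. \<psi> n) > \<eta> * real N"
  shows "\<eta>\<^sup>2 * real N * real (card P) \<le> 4 * real (card {x\<in>{..<p}. norm (\<Sum>b=1..B. \<psi> (x + b)) \<ge> \<eta> * real B / 4}) * (1 + A / w)"
proof -
  interpret mod_char p \<psi> by fact
  define X where "X = {x\<in>{..<p}. norm (\<Sum>b=1..B. \<psi> (x + b)) \<ge> \<eta> * real B / 4}"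
  have A0: "A > 0" using P ne w by fastforce
  have sub: "P \<subseteq> {1..nat \<lfloor>A\<rfloor>}"
  proof
    fix a assume "a \<in> P"
    thus "a \<in> {1..nat \<lfloor>A\<rfloor>}" using P[of a] prime_gt_0_nat[of a] by (auto simp: le_nat_floor)
  qed
  have finP: "finite P" using finite_subset[OF sub] by simp
  have "card P \<le> nat \<lfloor>A\<rfloor>" using card_mono[OF _ sub] by simp
  hence "real (card P) \<le> real (nat \<lfloor>A\<rfloor>)" by (simp only: of_nat_le_iff)
  also have "\<dots> \<le> A" using A0 by (intro of_nat_floor) simp
  finally have cardP: "real (card P) \<le> A" .
  have ndvd: "\<not> p dvd a" if "a \<in> P" for a
  proof -
    have "real a < real p" "a > 0" using P[OF that] NA prime_gt_0_nat[of a] by auto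
    thus ?thesis by (auto dest: dvd_imp_le)
  qed
  have "\<exists>i. [a * i = 1] (mod p)" if "a \<in> P" for a
  proof -
    have "coprime a p" using ndvd[OF that] prime by (metis coprime_commute prime_imp_coprime)
    thus ?thesis using cong_solve_coprime_nat by simp
  qed
  then obtain iv where iv: "\<And>a. a \<in> P \<Longrightarrow> [a * iv a = 1] (mod p)" by metis
  define x where "x a n = (iv a * n) mod p" for a n
  have xp: "x a n < p" for a n using prime_gt_0_nat[OF prime] by (simp add: x_def)
  have ax: "[a * x a n = n] (mod p)" if "a \<in> P" for a n
  proof -
    have 1: "[a * x a n = a * (iv a * n)] (mod p)"
      unfolding x_def by (intro cong_mult cong_refl) (simp add: mod_cong_def)
    have 2: "[a * iv a * n = 1 * n] (mod p)" by (intro cong_mult cong_refl iv that)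
    show ?thesis using cong_trans[OF 1] 2 by (simp add: mult.assoc)
  qed
  define \<Omega> where "\<Omega> = P \<times> {1..N}"
  have fin\<Omega>: "finite \<Omega>" using finP by (simp add: \<Omega>_def)
  define fib where "fib y = {z\<in>\<Omega>. x (fst z) (snd z) = y}" for y
  define Q where "Q = {(z, z')\<in>\<Omega> \<times> \<Omega>. x (fst z) (snd z) = x (fst z') (snd z')}"
  have "real (card P) * (\<eta> * real N / 2) = (\<Sum>a\<in>P. \<eta> * real N / 2)" by simp
  also have "\<dots> \<le> (\<Sum>a\<in>P. real (card {n\<in>{1..N}. x a n \<in> X}))"
  proof (rule sum_mono)
    fix a assume a: "a \<in> P"
    have "8 * real a * real B \<le> 8 * A * real B" using P[OF a] by (intro mult_right_mono) auto
    hence "\<eta> * real N / 2 \<le> real (card {n\<in>{1..N}. norm (\<Sum>b=1..B. \<psi> (x a n + b)) \<ge> \<eta> * real B / 4})"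
      using AB by (intro many_large_short_sums[OF \<eta> B ndvd[OF a] _ large ax[OF a]]) auto
    thus "\<eta> * real N / 2 \<le> real (card {n\<in>{1..N}. x a n \<in> X})" by (simp add: X_def xp)
  qed
  also have "\<dots> = real (card (SIGMA a:P. {n\<in>{1..N}. x a n \<in> X}))" using finP by simp
  also have "(SIGMA a:P. {n\<in>{1..N}. x a n \<in> X}) = (\<Union>y\<in>X. fib y)" by (auto simp: fib_def \<Omega>_def)
  also have "card (\<Union>y\<in>X. fib y) = (\<Sum>y\<in>X. card (fib y))"
    by (rule card_UN_disjoint) (auto simp: X_def fib_def fin\<Omega>)
  finally have 1: "real (card P) * (\<eta> * real N / 2) \<le> (\<Sum>y\<in>X. real (card (fib y)))" by simp
  have "(real (card P) * (\<eta> * real N / 2))\<^sup>2 \<le> (\<Sum>y\<in>X. real (card (fib y)))\<^sup>2"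
    using \<eta> by (intro power_mono 1) auto
  also have "\<dots> \<le> (\<Sum>y\<in>X. (real (card (fib y)))\<^sup>2) * real (card X)" by (rule sum_squared_le_sum_of_squares)
  also have "(\<Sum>y\<in>X. (real (card (fib y)))\<^sup>2) = real (\<Sum>y\<in>X. card (fib y \<times> fib y))"
    by (simp add: card_cartesian_product power2_eq_square)
  also have "(\<Sum>y\<in>X. card (fib y \<times> fib y)) = card (\<Union>y\<in>X. fib y \<times> fib y)"
    by (rule card_UN_disjoint[symmetric]) (auto simp: X_def fib_def fin\<Omega>)
  finally have CS: "(real (card P) * (\<eta> * real N / 2))\<^sup>2 \<le> real (card (\<Union>y\<in>X. fib y \<times> fib y)) * real (card X)" .
  have "card (\<Union>y\<in>X. fib y \<times> fib y) \<le> card Q"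
  proof (rule card_mono)
    show "finite Q" by (rule finite_subset[of _ "\<Omega> \<times> \<Omega>"]) (auto simp: Q_def fin\<Omega>)
  qed (auto simp: Q_def fib_def)
  hence "real (card (\<Union>y\<in>X. fib y \<times> fib y)) \<le> real (card Q)" by (simp only: of_nat_le_iff)
  also have "real (card Q) \<le> real (card P) * real N * (1 + A / w)"
  proof -
    define Qa where "Qa = (\<lambda>(a, a'). {(n, n')\<in>{1..N} \<times> {1..N}. x a n = x a' n'})"
    \<comment> \<open>Both products stay below p by N A < p, so the congruence is an equality of
      integers.\<close>
    have eq: "n * a' = n' * a" if "a \<in> P" "a' \<in> P" "n \<in> {1..N}" "n' \<in> {1..N}" "x a n = x a' n'" for a a' n n'
    proof -
      have "[n * a' = a * x a n * a'] (mod p)" using cong_sym[OF ax[OF that(1)]] by (intro cong_mult cong_refl)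
      moreover have "[a' * x a' n' * a = n' * a] (mod p)" using ax[OF that(2)] by (intro cong_mult cong_refl)
      moreover have "a * x a n * a' = a' * x a' n' * a" using that(5) by simp
      ultimately have "[n * a' = n' * a] (mod p)" using cong_trans by metis
      moreover have "n * a' < p" "n' * a < p"
      proof -
        have "real n * real a' \<le> real N * A" "real n' * real a \<le> real N * A"
          using that P A0 by (auto intro!: mult_mono)
        thus "n * a' < p" "n' * a < p" using NA by (metis le_less_trans of_nat_less_iff of_nat_mult)+
      qed
      ultimately show ?thesis by (simp add: cong_less_modulus_unique_nat)
    qed
    have finQa: "finite (Qa z)" for z
      by (rule finite_subset[of _ "{1..N} \<times> {1..N}"]) (auto simp: Qa_def split: prod.splits)
    have inj: "inj_on fst (Qa (a, a'))" if "a \<in> P" "a' \<in> P" for a a'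
    proof (rule inj_onI)
      fix u v assume uv: "u \<in> Qa (a, a')" "v \<in> Qa (a, a')" "fst u = fst v"
      have "fst u * a' = snd u * a" "fst v * a' = snd v * a" using uv(1,2) that by (auto simp: Qa_def intro!: eq)
      hence "snd u * a = snd v * a" using uv(3) by metis
      moreover have "a > 0" using P[OF that(1)] prime_gt_0_nat by auto
      ultimately show "u = v" using uv(3) by (simp add: prod_eq_iff)
    qed
    have card_eq: "card (Qa (a, a)) \<le> N" if "a \<in> P" for a
    proof -
      have "fst ` Qa (a, a) \<subseteq> {1..N}" by (auto simp: Qa_def)
      from card_inj_on_le[OF inj[OF that that] this] show ?thesis by simp
    qed
    \<comment> \<open>Here a is coprime to a', so n is a multiple of a, and n determines n'.\<close>
    have card_neq: "real (card (Qa (a, a'))) \<le> real N / w" if "a \<in> P" "a' \<in> P" "a \<noteq> a'" for a a'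
    proof -
      have "fst ` Qa (a, a') \<subseteq> {n\<in>{1..N}. a dvd n}"
      proof safe
        fix n n' assume nn: "(n, n') \<in> Qa (a, a')"
        hence "n * a' = n' * a" by (intro eq that) (auto simp: Qa_def)
        hence "a dvd n * a'" by simp
        moreover have "coprime a a'" using P that by (simp add: primes_coprime)
        ultimately show "a dvd fst (n, n')" by (simp add: coprime_dvd_mult_left_iff)
        show "fst (n, n') \<in> {1..N}" using nn by (auto simp: Qa_def)
      qed
      hence "card (Qa (a, a')) \<le> card {n\<in>{1..N}. a dvd n}"
        by (intro card_inj_on_le[OF inj[OF that(1,2)]]) auto
      also have "\<dots> = N div a" using P[OF that(1)] prime_gt_0_nat by (intro card_multiples) auto
      finally have "real (card (Qa (a, a'))) \<le> real (N div a)" by simp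
      also have "\<dots> \<le> real N / real a" by (rule of_nat_div_le_of_nat)
      also have "\<dots> \<le> real N / w" using P[OF that(1)] w by (intro divide_left_mono) auto
      finally show ?thesis .
    qed
    have "card Q \<le> card (SIGMA z:P \<times> P. Qa z)"
    proof (rule card_inj_on_le)
      show "inj_on (\<lambda>(z, z'). ((fst z, fst z'), (snd z, snd z'))) Q" by (auto simp: inj_on_def)
      show "(\<lambda>(z, z'). ((fst z, fst z'), (snd z, snd z'))) ` Q \<subseteq> (SIGMA z:P \<times> P. Qa z)"
        by (auto simp: Q_def \<Omega>_def Qa_def)
      show "finite (SIGMA z:P \<times> P. Qa z)" using finP finQa by auto
    qed
    also have "\<dots> = (\<Sum>z\<in>P \<times> P. card (Qa z))" using finP finQa by simp
    also have "\<dots> = (\<Sum>a\<in>P. \<Sum>a'\<in>P. card (Qa (a, a')))" by (simp add: sum.cartesian_product)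
    finally have "real (card Q) \<le> real (\<Sum>a\<in>P. \<Sum>a'\<in>P. card (Qa (a, a')))" by (simp only: of_nat_le_iff)
    also have "\<dots> = (\<Sum>a\<in>P. \<Sum>a'\<in>P. real (card (Qa (a, a'))))" by simp
    also have "\<dots> \<le> (\<Sum>a\<in>P. \<Sum>a'\<in>P. (if a' = a then real N else 0) + real N / w)"
      using card_eq card_neq w by (intro sum_mono) (auto simp: add_increasing2)
    also have "\<dots> = real (card P) * real N + real (card P) * (real (card P) * (real N / w))"
      using finP by (simp add: sum.distrib algebra_simps)
    also have "\<dots> \<le> real (card P) * real N + real (card P) * (A * (real N / w))"
      using cardP w by (intro add_left_mono mult_left_mono mult_right_mono) auto
    also have "\<dots> = real (card P) * real N * (1 + A / w)" by (simp add: algebra_simps)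
    finally show ?thesis .
  qed
  finally have sq: "(real (card P) * (\<eta> * real N / 2))\<^sup>2 \<le> real (card P) * real N * (1 + A / w) * real (card X)"
    by (rule order.trans[OF CS mult_right_mono]) simp
  have "(real (card P) * real N) * (\<eta>\<^sup>2 * real N * real (card P)) = 4 * (real (card P) * (\<eta> * real N / 2))\<^sup>2"
    by (simp add: power2_eq_square)
  also have "\<dots> \<le> 4 * (real (card P) * real N * (1 + A / w) * real (card X))"
    by (intro mult_left_mono sq) simp
  also have "\<dots> = (real (card P) * real N) * (4 * real (card X) * (1 + A / w))" by (simp only: mult_ac)
  finally have "(real (card P) * real N) * (\<eta>\<^sup>2 * real N * real (card P)) \<le> (real (card P) * real N) * (4 * real (card X) * (1 + A / w))" .
  moreover have "real (card P) * real N > 0" using ne finP N by (simp add: card_gt_0_iff)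
  ultimately show ?thesis unfolding X_def by (rule mult_left_le_imp_le)
qed

text \<open>With B about p^(1/(2r)) the two terms of the moment bound balance, and only O(\<surd>p)
  points have a large short sum. If the sum over N terms were large, prime multipliers up to A =
  \<eta> N / (8 B) would give at least a constant times N A / ln p such points, and N A is at least
  a constant times p^(1/2 + \<delta>).\<close>

lemma burgess:
  fixes \<eta> \<delta> :: real
  assumes d: "d \<ge> 2" and \<eta>: "0 < \<eta>" "\<eta> \<le> 1" and \<delta>: "\<delta> > 0"
  obtains p0 :: nat where
    "\<And>p \<psi> N. mod_char p \<psi> \<Longrightarrow> p \<ge> p0 \<Longrightarrow> mod_char.has_order p \<psi> d \<Longrightarrow>
       real p powr (1/4 + \<delta>) \<le> 2 * real N \<Longrightarrow> real N \<le> sqrt (real p) \<Longrightarrow>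
       norm (\<Sum>n=1..N. \<psi> n) \<le> \<eta> * real N"
proof -
  \<comment> \<open>This makes \<theta> = 1/(2r) at most \<delta>, so dividing by B loses at most
    about p^\<delta> of the p^(2\<delta>) gained in N^2.\<close>
  define r where "r = nat \<lceil>1 / \<delta>\<rceil> + 1"
  have r1: "r \<ge> 1" by (simp add: r_def)
  define \<theta> where "\<theta> = 1 / (2 * real r)"
  have "1 / \<delta> \<le> real r" unfolding r_def by linarith
  hence "1 \<le> \<delta> * real r" using \<delta> by (simp add: field_simps)
  hence \<theta>: "0 < \<theta>" "\<theta> \<le> \<delta>" "\<theta> \<le> 1/2" "\<theta> * real r = 1/2" using r1 \<delta> by (auto simp: \<theta>_def field_simps)
  obtain C :: real and p1 :: nat where C: "C \<ge> 0" and moment: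
    "\<And>p \<psi> B. mod_char p \<psi> \<Longrightarrow> p \<ge> p1 \<Longrightarrow> mod_char.has_order p \<psi> d \<Longrightarrow> B < p \<Longrightarrow>
       (\<Sum>x<p. norm (\<Sum>b=1..B. \<psi> (x + b)) ^ (2 * r)) \<le> C * (real B ^ r * real p + real B ^ (2 * r) * sqrt (real p))"
    using moment_bound[OF d r1] by metis
  obtain c :: real where c: "0 < c" "c < 1" and primes:
    "\<And>x. 1 \<le> c * x \<Longrightarrow> c * x \<le> ln x * card {q. prime q \<and> c * x < real q \<and> real q \<le> x}"
    using many_primes_in_interval by metis
  \<comment> \<open>C1 comes from Markov's inequality for the 2r-th moment at the threshold \<eta> B
    / 4; C2 collects the constants in the final comparison of p^\<delta> with ln p.\<close>
  define C1 where "C1 = 2 * C * (4 / \<eta>) ^ (2 * r)"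
  define C2 where "C2 = 256 * C1 * (1 + 1 / c) / (\<eta> ^ 3 * c)"
  have "\<forall>\<^sub>F p::nat in sequentially. C2 * ln (real p) < real p powr \<delta>" using \<delta> by real_asymp
  moreover have "\<forall>\<^sub>F p::nat in sequentially. 1 \<le> c * (\<eta> * real p powr (1/4) / 32)" using c \<eta> by real_asymp
  moreover have "\<forall>\<^sub>F p::nat in sequentially. p \<ge> p1 + 5" by (rule eventually_ge_at_top)
  ultimately have "\<forall>\<^sub>F p::nat in sequentially. C2 * ln (real p) < real p powr \<delta> \<and> 1 \<le> c * (\<eta> * real p powr (1/4) / 32) \<and> p \<ge> p1 + 5"
    by eventually_elim auto
  then obtain p0 where p0: "\<And>p. p \<ge> p0 \<Longrightarrow> C2 * ln (real p) < real p powr \<delta> \<and> 1 \<le> c * (\<eta> * real p powr (1/4) / 32) \<and> p \<ge> p1 + 5"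
    by (auto simp: eventually_at_top_linorder)
  show thesis
  proof (rule that[of p0], rule ccontr)
    fix p N :: nat and \<psi> :: "nat \<Rightarrow> complex"
    assume \<psi>: "mod_char p \<psi>" and "p \<ge> p0" and ord: "mod_char.has_order p \<psi> d"
      and N: "real p powr (1/4 + \<delta>) \<le> 2 * real N" "real N \<le> sqrt (real p)"
      and "\<not> norm (\<Sum>n=1..N. \<psi> n) \<le> \<eta> * real N"
    hence large: "norm (\<Sum>n=1..N. \<psi> n) > \<eta> * real N" by simp
    interpret mod_char p \<psi> by fact
    have p: "C2 * ln (real p) < real p powr \<delta>" "1 \<le> c * (\<eta> * real p powr (1/4) / 32)" "p \<ge> p1" "real p \<ge> 5"
      using p0[OF \<open>p \<ge> p0\<close>] by auto
    have "real p powr (1/4 + \<delta>) > 0" using p by simp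
    hence "real N > 0" using N(1) by linarith
    hence N1: "N \<ge> 1" by simp
    define B where "B = nat \<lceil>real p powr \<theta>\<rceil>"
    have pth: "real p powr \<theta> \<ge> 1" using p \<theta> by (intro ge_one_powr_ge_zero) auto
    hence B: "real p powr \<theta> \<le> real B" "real B \<le> 2 * real p powr \<theta>" unfolding B_def by linarith+
    have BB: "real B \<le> 2 * real p powr \<delta>"
    proof -
      have "real p powr \<theta> \<le> real p powr \<delta>" using p \<theta> by (intro powr_mono) auto
      thus ?thesis using B(2) by linarith
    qed
    have pp: "real p powr (2 * \<delta>) = real p powr \<delta> * real p powr \<delta>" by (simp flip: powr_add)
    have B1: "B \<ge> 1" using B pth by linarith
    have "real p powr \<theta> \<le> real p powr (1/2)" using p \<theta> by (intro powr_mono) auto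
    also have "\<dots> = sqrt (real p)" by (simp add: powr_half_sqrt)
    finally have "real B \<le> 2 * sqrt (real p)" using B by linarith
    also have "\<dots> < real p"
    proof -
      have "2 < sqrt (real p)" using p by (intro real_less_rsqrt) auto
      hence "2 * sqrt (real p) < sqrt (real p) * sqrt (real p)" using p by (intro mult_strict_right_mono) auto
      thus ?thesis by simp
    qed
    finally have Bp: "B < p" by simp
    have Br: "sqrt (real p) \<le> real B ^ r"
    proof -
      have "(real p powr \<theta>) ^ r = real p powr (\<theta> * real r)"
        using p by (simp add: powr_power mult.commute[of \<theta>])
      hence "sqrt (real p) = (real p powr \<theta>) ^ r" unfolding \<theta>(4) by (simp add: powr_half_sqrt)
      also have "\<dots> \<le> real B ^ r" using B by (intro power_mono) auto
      finally show ?thesis .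
    qed
    define X where "X = {x\<in>{..<p}. norm (\<Sum>b=1..B. \<psi> (x + b)) \<ge> \<eta> * real B / 4}"
    have X: "real (card X) \<le> C1 * sqrt (real p)"
    proof -
      have "real (card X) * (\<eta> * real B / 4) ^ (2 * r) = (\<Sum>x\<in>X. (\<eta> * real B / 4) ^ (2 * r))" by simp
      also have "\<dots> \<le> (\<Sum>x\<in>X. norm (\<Sum>b=1..B. \<psi> (x + b)) ^ (2 * r))"
        using \<eta> by (intro sum_mono power_mono) (auto simp: X_def)
      also have "\<dots> \<le> (\<Sum>x<p. norm (\<Sum>b=1..B. \<psi> (x + b)) ^ (2 * r))"
        by (intro sum_mono2) (auto simp: X_def)
      also have "\<dots> \<le> C * (real B ^ r * real p + real B ^ (2 * r) * sqrt (real p))"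
        by (rule moment[OF \<psi> p(3) ord Bp])
      also have "\<dots> \<le> C * (real B ^ (2 * r) * sqrt (real p) + real B ^ (2 * r) * sqrt (real p))"
      proof (intro mult_left_mono add_right_mono C)
        have "real B ^ r * real p = (real B ^ r * sqrt (real p)) * sqrt (real p)" by (simp add: mult.assoc)
        also have "\<dots> \<le> (real B ^ r * real B ^ r) * sqrt (real p)"
          using Br by (intro mult_right_mono mult_left_mono) auto
        also have "real B ^ r * real B ^ r = real B ^ (2 * r)" by (simp add: mult_2 power_add)
        finally show "real B ^ r * real p \<le> real B ^ (2 * r) * sqrt (real p)" .
      qed
      also have "(\<eta> * real B / 4) ^ (2 * r) = (\<eta> / 4) ^ (2 * r) * real B ^ (2 * r)"
        by (simp add: power_mult_distrib power_divide)
      finally have "real B ^ (2 * r) * (real (card X) * (\<eta> / 4) ^ (2 * r)) \<le> real B ^ (2 * r) * (2 * C * sqrt (real p))"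
        by (simp add: algebra_simps)
      hence "real (card X) * (\<eta> / 4) ^ (2 * r) \<le> 2 * C * sqrt (real p)" using B1 by simp
      hence "(4 / \<eta>) ^ (2 * r) * (real (card X) * (\<eta> / 4) ^ (2 * r)) \<le> (4 / \<eta>) ^ (2 * r) * (2 * C * sqrt (real p))"
        using \<eta> by (intro mult_left_mono) auto
      moreover have "(4 / \<eta>) ^ (2 * r) * (\<eta> / 4) ^ (2 * r) = 1"
        using \<eta> by (simp add: power_mult_distrib[symmetric])
      ultimately show ?thesis by (simp add: C1_def algebra_simps)
    qed
    define A where "A = \<eta> * real N / (8 * real B)"
    have A0: "A > 0" using \<eta> N1 B1 by (simp add: A_def)
    have AB: "8 * A * real B = \<eta> * real N" using B1 by (simp add: A_def)
    have NA: "real N * A * 64 \<ge> \<eta> * sqrt (real p) * real p powr \<delta>"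
    proof -
      have "(real p powr (1/4 + \<delta>)) ^ 2 = real p powr ((1/4 + \<delta>) * real 2)"
        using p by (subst powr_power) (auto simp: mult.commute)
      also have "(1/4 + \<delta>) * real 2 = 1/2 + 2 * \<delta>" by simp
      finally have "sqrt (real p) * real p powr (2 * \<delta>) = (real p powr (1/4 + \<delta>)) ^ 2"
        by (simp only: powr_add powr_half_sqrt of_nat_0_le_iff)
      also have "\<dots> \<le> (2 * real N) ^ 2" by (intro power_mono N(1)) auto
      finally have "\<eta> * (sqrt (real p) * real p powr (2 * \<delta>)) \<le> \<eta> * (2 * real N)\<^sup>2" using \<eta> by (intro mult_left_mono) auto
      also have "\<dots> = real N * (8 * A * real B) * 4" unfolding AB by (simp add: power2_eq_square)
      also have "\<dots> = 32 * (real N * A) * real B" by simp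
      also have "\<dots> \<le> 32 * (real N * A) * (2 * real p powr \<delta>)"
        using A0 by (intro mult_left_mono BB) auto
      finally have "(\<eta> * sqrt (real p) * real p powr \<delta>) * real p powr \<delta> \<le> (real N * A * 64) * real p powr \<delta>"
        by (simp add: pp[unfolded mult.commute[of 2]] algebra_simps)
      thus ?thesis using p by (subst (asm) mult_le_cancel_right_pos) auto
    qed
    have AN: "A \<le> real N / 8"
    proof -
      have "A \<le> \<eta> * real N / 8" unfolding A_def using B1 \<eta> by (intro divide_left_mono) auto
      also have "\<dots> \<le> real N / 8" using \<eta> mult_right_mono[of \<eta> 1 "real N"] by simp
      finally show ?thesis .
    qed
    have NN: "real N * real N \<le> real p" using mult_mono[OF N(2) N(2)] by simp
    have NAp: "real N * A < real p"
    proof -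
      have "real N * A \<le> real N * (real N / 8)" by (intro mult_left_mono AN) simp
      also have "\<dots> \<le> real p / 8" using NN by simp
      finally show ?thesis using p by linarith
    qed
    have "real N \<le> real N * real N" using N1 by simp
    hence Ap: "A < real p" using AN NN p N1 by linarith
    have cA: "1 \<le> c * A"
    proof -
      have "real p powr (1/4) * real p powr \<delta> \<le> 2 * real N" using N(1) by (simp add: powr_add)
      also have "\<dots> = 16 * real B * A / \<eta>" using AB \<eta> by (simp add: field_simps)
      also have "\<dots> \<le> 16 * (2 * real p powr \<delta>) * A / \<eta>"
        using A0 \<eta> by (intro divide_right_mono mult_right_mono mult_left_mono BB) auto
      finally have "real p powr (1/4) * real p powr \<delta> \<le> (32 * A / \<eta>) * real p powr \<delta>" by (simp add: mult_ac)
      hence "real p powr (1/4) \<le> 32 * A / \<eta>" using p by (subst (asm) mult_le_cancel_right_pos) auto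
      hence "\<eta> * real p powr (1/4) / 32 \<le> A" using \<eta> by (simp add: field_simps)
      hence "c * (\<eta> * real p powr (1/4) / 32) \<le> c * A" using c by (intro mult_left_mono) auto
      thus ?thesis using p by linarith
    qed
    define P where "P = {q. prime q \<and> c * A < real q \<and> real q \<le> A}"
    have P1: "c * A \<le> ln A * card P" unfolding P_def by (rule primes[OF cA])
    have ne: "P \<noteq> {}" using P1 cA by auto
    have cardP: "c * A \<le> ln (real p) * card P"
    proof -
      have "ln A \<le> ln (real p)" using Ap A0 by simp
      thus ?thesis using P1 by (meson mult_right_mono of_nat_0_le_iff order.trans)
    qed
    have "\<eta>\<^sup>2 * real N * real (card P) \<le> 4 * real (card X) * (1 + A / (c * A))"
      unfolding X_def
      by (rule burgess_counting[OF \<psi> _ ne _ NAp Ap \<eta>(1) B1 _ N1 large]) (use AB A0 c in \<open>auto simp: P_def\<close>)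
    also have "A / (c * A) = 1 / c" using A0 by simp
    also have "4 * real (card X) * (1 + 1 / c) \<le> 4 * (C1 * sqrt (real p)) * (1 + 1 / c)"
      using X c by (intro mult_right_mono mult_left_mono) auto
    finally have main: "\<eta>\<^sup>2 * real N * real (card P) \<le> 4 * (C1 * sqrt (real p)) * (1 + 1 / c)" .
    have lnp: "ln (real p) > 0" using p by simp
    have "\<eta>\<^sup>2 * c * (\<eta> * sqrt (real p) * real p powr \<delta>) \<le> \<eta>\<^sup>2 * c * (real N * A * 64)"
      using NA c by (intro mult_left_mono) auto
    also have "\<dots> = 64 * \<eta>\<^sup>2 * real N * (c * A)" by simp
    also have "\<dots> \<le> 64 * \<eta>\<^sup>2 * real N * (ln (real p) * card P)"
      using cardP by (intro mult_left_mono) auto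
    also have "\<dots> = 64 * ln (real p) * (\<eta>\<^sup>2 * real N * real (card P))" by simp
    also have "\<dots> \<le> 64 * ln (real p) * (4 * (C1 * sqrt (real p)) * (1 + 1 / c))"
      using main lnp by (intro mult_left_mono) auto
    finally have "sqrt (real p) * (\<eta> ^ 3 * c * real p powr \<delta>) \<le> sqrt (real p) * (256 * C1 * (1 + 1 / c) * ln (real p))"
      by (simp add: power3_eq_cube power2_eq_square mult_ac)
    hence "\<eta> ^ 3 * c * real p powr \<delta> \<le> 256 * C1 * (1 + 1 / c) * ln (real p)" using p by simp
    hence "real p powr \<delta> \<le> C2 * ln (real p)" using \<eta> c by (simp add: C2_def field_simps)
    thus False using p(1) by linarith
  qed
qed

section \<open>Characters and orthogonality\<close>

context mod_char
begin

lemma has_order_ex: "\<exists>d. has_order d"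
proof -
  obtain g where g: "residue_primroot p g" using prime_primitive_root_exists[OF prime_gt_1_nat[OF prime] prime] by auto
  define \<omega> where "\<omega> = \<psi> g"
  have ndvd: "\<not> p dvd g"
    using g prime by (metis coprime_absorb_left not_prime_unit residue_primroot_def)
  have "[g ^ (p - 1) = 1] (mod p)" by (rule fermat_theorem[OF prime ndvd])
  hence \<omega>p: "\<omega> ^ (p - 1) = 1" by (metis One_nat_def \<omega>_def cong one power)
  define d where "d = (LEAST d. d > 0 \<and> \<omega> ^ d = 1)"
  have "\<exists>d. d > 0 \<and> \<omega> ^ d = 1" using \<omega>p prime_gt_1_nat[OF prime] by (intro exI[of _ "p - 1"]) auto
  from LeastI_ex[OF this] have d: "d > 0" "\<omega> ^ d = 1" unfolding d_def by auto
  have least: "\<not> (k > 0 \<and> \<omega> ^ k = 1)" if "k < d" for k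
    using not_less_Least[of k "\<lambda>d. d > 0 \<and> \<omega> ^ d = 1"] that unfolding d_def by blast
  have iff: "\<omega> ^ k = 1 \<longleftrightarrow> d dvd k" for k
  proof
    assume k: "\<omega> ^ k = 1"
    have "\<omega> ^ k = \<omega> ^ (d * (k div d) + k mod d)" by simp
    also have "\<dots> = (\<omega> ^ d) ^ (k div d) * \<omega> ^ (k mod d)" by (simp only: power_add power_mult)
    finally have "\<omega> ^ (k mod d) = 1" using k d by simp
    hence "k mod d = 0" using least[of "k mod d"] d by auto
    thus "d dvd k" by blast
  next
    assume "d dvd k"
    thus "\<omega> ^ k = 1" using d by (auto simp: power_mult)
  qed
  have "d dvd p - 1" using iff \<omega>p by blast
  thus ?thesis unfolding has_order_def using g iff \<omega>_def by blast
qed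

lemma sum_over_units:
  assumes "residue_primroot p g" "\<And>m n. [m = n] (mod p) \<Longrightarrow> f m = f n"
  shows "(\<Sum>n\<in>{0<..<p}. f n) = (\<Sum>i<p-1. f (g ^ i))"
proof -
  have "(\<Sum>i<p-1. f (g ^ i)) = (\<Sum>i<p-1. f (g ^ i mod p))"
    by (intro sum.cong refl assms(2)) (simp add: mod_cong_def)
  also have "\<dots> = (\<Sum>n\<in>totatives p. f n)"
    using residue_primroot_is_generator[OF prime_gt_1_nat[OF prime] assms(1)]
    by (intro sum.reindex_bij_betw) (simp add: totient_prime prime)
  finally show ?thesis by (simp add: totatives_prime prime)
qed

lemma order_one_imp_trivial:
  assumes "has_order 1" "\<not> p dvd n"
  shows "\<psi> n = 1"
  using power_order[OF assms] by simp

text \<open>Parseval: for J \<le> d the powers of \<psi> with exponents below J are distinct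
  characters, hence orthogonal. A character of large order therefore cannot be near 1 on a positive
  proportion of the residues, where the sum would be of size J.\<close>

lemma mean_square_of_powers:
  assumes ord: "has_order d" and J: "J \<le> d"
  shows "(\<Sum>n\<in>{0<..<p}. (norm (\<Sum>j<J. \<psi> n ^ j))\<^sup>2) = real (p - 1) * real J"
proof -
  obtain g where g: "residue_primroot p g" "\<And>k. \<psi> g ^ k = 1 \<longleftrightarrow> d dvd k"
    using ord unfolding has_order_def by blast
  define \<omega> where "\<omega> = \<psi> g"
  have d0: "d > 0" by (rule has_order_pos[OF ord])
  have \<omega>d: "\<omega> ^ d = 1" using g(2)[of d] by (simp add: \<omega>_def)
  have \<omega>p: "\<omega> ^ (p - 1) = 1" using g(2)[of "p - 1"] ord by (simp add: \<omega>_def has_order_def)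
  have n1: "norm \<omega> = 1"
  proof -
    have "norm \<omega> ^ d = 1" using \<omega>d by (metis norm_one norm_power)
    thus ?thesis using d0 power_eq_imp_eq_base[of "norm \<omega>" d 1] by simp
  qed
  hence cnj1: "\<omega> * cnj \<omega> = 1" by (simp add: complex_norm_square[symmetric])
  have ratio: "(\<Sum>n<p-1. (\<omega> ^ i * cnj \<omega> ^ j) ^ n) = (if i = j then of_nat (p - 1) else 0)" if ij: "i < d" "j < d" for i j
  proof (cases "i = j")
    case True
    have "\<omega> ^ i * cnj \<omega> ^ j = 1" using cnj1 by (simp add: True power_mult_distrib[symmetric])
    thus ?thesis using True by simp
  next
    case False
    have "\<omega> ^ i * cnj \<omega> ^ j \<noteq> 1"
    proof
      assume "\<omega> ^ i * cnj \<omega> ^ j = 1"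
      hence "\<omega> ^ i * (\<omega> * cnj \<omega>) ^ j = \<omega> ^ j" by (simp add: power_mult_distrib mult_ac)
      hence eq: "\<omega> ^ i = \<omega> ^ j" using cnj1 by simp
      have *: False if "\<omega> ^ i = \<omega> ^ j" "i < j" "j < d" for i j
      proof -
        have "\<omega> ^ j = \<omega> ^ i * \<omega> ^ (j - i)" using that(2) by (simp flip: power_add)
        hence "\<omega> ^ (j - i) = 1" using that n1 by auto
        hence "d dvd j - i" using g(2) by (simp add: \<omega>_def)
        thus False using that by (auto dest: dvd_imp_le)
      qed
      show False using *[of i j] *[of j i] eq ij False by (metis linorder_neqE_nat)
    qed
    moreover have "(\<omega> ^ i * cnj \<omega> ^ j) ^ (p - 1) = 1"
    proof -
      have "(\<omega> ^ i * cnj \<omega> ^ j) ^ (p - 1) = (\<omega> ^ (p - 1)) ^ i * cnj (\<omega> ^ (p - 1)) ^ j"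
        by (simp only: power_mult_distrib power_mult[symmetric] mult.commute[of "p - 1"] complex_cnj_power)
      thus ?thesis by (simp only: \<omega>p) simp
    qed
    ultimately show ?thesis using False by (simp add: sum_gp_strict)
  qed
  have "complex_of_real (\<Sum>n\<in>{0<..<p}. (norm (\<Sum>j<J. \<psi> n ^ j))\<^sup>2) = (\<Sum>n\<in>{0<..<p}. (\<Sum>j<J. \<psi> n ^ j) * cnj (\<Sum>j<J. \<psi> n ^ j))"
    unfolding of_real_sum complex_norm_square ..
  also have "\<dots> = (\<Sum>n<p-1. (\<Sum>j<J. \<psi> (g ^ n) ^ j) * cnj (\<Sum>j<J. \<psi> (g ^ n) ^ j))"
    by (rule sum_over_units[OF g(1)]) (metis cong)
  also have "\<dots> = (\<Sum>n<p-1. \<Sum>i<J. \<Sum>j<J. (\<omega> ^ i * cnj \<omega> ^ j) ^ n)"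
    by (intro sum.cong refl) (simp add: sum_product power \<omega>_def power_mult_distrib power_mult[symmetric] mult.commute)
  also have "\<dots> = (\<Sum>i<J. \<Sum>n<p-1. \<Sum>j<J. (\<omega> ^ i * cnj \<omega> ^ j) ^ n)" by (rule sum.swap)
  also have "\<dots> = (\<Sum>i<J. \<Sum>j<J. \<Sum>n<p-1. (\<omega> ^ i * cnj \<omega> ^ j) ^ n)"
    by (rule sum.cong[OF refl], rule sum.swap)
  also have "\<dots> = (\<Sum>i<J. \<Sum>j<J. if i = j then of_nat (p - 1) else 0)"
    using J by (intro sum.cong refl ratio) auto
  also have "\<dots> = complex_of_real (real (p - 1) * real J)" by simp
  finally show ?thesis by (simp only: of_real_eq_iff)
qed

end

text \<open>A discrete logarithm to the base g. Only its class modulo p - 1 is determined and only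
  that class enters the characters, so any choice serves; at multiples of p it has no
  meaning.\<close>

definition ind :: "nat \<Rightarrow> nat \<Rightarrow> nat \<Rightarrow> nat" where
  "ind p g n = (SOME i. [n = g ^ i] (mod p))"

definition unit_root :: "nat \<Rightarrow> complex" where "unit_root m = cis (2 * pi / real m)"

lemma unit_root_power_eq_1_iff:
  assumes "m > 0"
  shows "unit_root m ^ k = 1 \<longleftrightarrow> m dvd k"
proof -
  have "unit_root m ^ k = cis (2 * pi * real k / real m)" by (simp add: unit_root_def Complex.DeMoivre mult_ac)
  also have "\<dots> = 1 \<longleftrightarrow> (\<exists>n::int. 2 * pi * real k / real m = of_int n * 2 * pi)"
  proof
    assume "cis (2 * pi * real k / real m) = 1"
    hence "cos (2 * pi * real k / real m) = 1" by (simp add: complex_eq_iff)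
    thus "\<exists>n::int. 2 * pi * real k / real m = of_int n * 2 * pi" by (simp only: cos_one_2pi_int)
  next
    assume "\<exists>n::int. 2 * pi * real k / real m = of_int n * 2 * pi"
    then obtain n :: int where "2 * pi * real k / real m = 2 * pi * of_int n" by (auto simp: mult_ac)
    thus "cis (2 * pi * real k / real m) = 1" by (simp only: cis_multiple_2pi Ints_of_int)
  qed
  also have "\<dots> \<longleftrightarrow> m dvd k"
  proof
    assume "\<exists>n::int. 2 * pi * real k / real m = of_int n * 2 * pi"
    then obtain n :: int where "2 * pi * real k / real m = of_int n * 2 * pi" by blast
    hence "real k = of_int n * real m" using assms by (simp add: field_simps)
    hence "int k = n * int m" by (metis of_int_eq_iff of_int_mult of_int_of_nat_eq)
    thus "m dvd k" by (metis dvd_triv_right int_dvd_int_iff)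
  next
    assume "m dvd k"
    then obtain n where "k = m * n" by blast
    thus "\<exists>n::int. 2 * pi * real k / real m = of_int n * 2 * pi"
      using assms by (intro exI[of _ "int n"]) (simp add: field_simps)
  qed
  finally show ?thesis .
qed

definition char_of :: "nat \<Rightarrow> nat \<Rightarrow> nat \<Rightarrow> nat \<Rightarrow> complex" where
  "char_of p g k n = (if p dvd n then 0 else unit_root (p - 1) ^ (k * ind p g n))"

context
  fixes p g :: nat
  assumes prime: "prime p" and g: "residue_primroot p g"
begin

lemma primroot_power_cong_iff: "[g ^ i = g ^ j] (mod p) \<longleftrightarrow> [i = j] (mod (p - 1))"
  using g prime by (subst order_divides_expdiff) (auto simp: residue_primroot_def totient_prime)

lemma ind:
  assumes "\<not> p dvd n"
  shows "[n = g ^ ind p g n] (mod p)"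
proof -
  obtain i where "[n = g ^ i] (mod p)" using primroot_generates[OF prime g assms] by blast
  thus ?thesis unfolding ind_def by (rule someI)
qed

lemma unit_root_power_cong:
  assumes "[i = j] (mod (p - 1))"
  shows "unit_root (p - 1) ^ (k * i) = unit_root (p - 1) ^ (k * j)"
proof -
  have p1: "unit_root (p - 1) ^ (p - 1) = 1" using prime_gt_1_nat[OF prime] by (subst unit_root_power_eq_1_iff) auto
  have *: "unit_root (p - 1) ^ (k * i) = unit_root (p - 1) ^ (k * (i mod (p - 1)))" for i
  proof -
    have "unit_root (p - 1) ^ (k * i) = unit_root (p - 1) ^ (k * ((p - 1) * (i div (p - 1)) + i mod (p - 1)))" by simp
    also have "\<dots> = (unit_root (p - 1) ^ (p - 1)) ^ (k * (i div (p - 1))) * unit_root (p - 1) ^ (k * (i mod (p - 1)))"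
      by (simp only: power_mult[symmetric] power_add[symmetric]) (simp add: algebra_simps)
    finally show ?thesis by (simp only: p1) simp
  qed
  show ?thesis using assms *[of i] *[of j] by (simp add: mod_cong_def)
qed

lemma mod_char_char_of: "mod_char p (char_of p g k)"
proof
  show "prime p" by (rule prime)
  show "char_of p g k (m * n) = char_of p g k m * char_of p g k n" for m n
  proof (cases "p dvd m \<or> p dvd n")
    case False
    hence mn: "\<not> p dvd m * n" using prime by (simp add: prime_dvd_mult_iff)
    have 1: "[m * n = g ^ ind p g m * g ^ ind p g n] (mod p)" using False by (intro cong_mult ind) auto
    have "[g ^ ind p g (m * n) = g ^ (ind p g m + ind p g n)] (mod p)"
      using cong_trans[OF cong_sym[OF ind[OF mn]] 1] by (simp add: power_add)
    hence "[ind p g (m * n) = ind p g m + ind p g n] (mod (p - 1))" by (simp add: primroot_power_cong_iff)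
    hence "unit_root (p - 1) ^ (k * ind p g (m * n)) = unit_root (p - 1) ^ (k * (ind p g m + ind p g n))"
      by (rule unit_root_power_cong)
    thus ?thesis using False mn by (simp add: char_of_def power_add algebra_simps)
  qed (auto simp: char_of_def)
  show "char_of p g k m = char_of p g k n" if "[m = n] (mod p)" for m n
  proof (cases "p dvd m")
    case True
    thus ?thesis using that by (simp add: char_of_def cong_dvd_iff)
  next
    case False
    hence n: "\<not> p dvd n" using that by (simp add: cong_dvd_iff)
    have "[g ^ ind p g m = g ^ ind p g n] (mod p)"
      using cong_trans[OF cong_sym[OF ind[OF False]] cong_trans[OF that ind[OF n]]] .
    thus ?thesis using False n unit_root_power_cong by (simp add: char_of_def primroot_power_cong_iff)
  qed
  show "char_of p g k n = 0 \<longleftrightarrow> p dvd n" for n by (simp add: char_of_def unit_root_def)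
  show "norm (char_of p g k n) \<le> 1" for n by (simp add: char_of_def unit_root_def norm_power)
qed

lemma char_of_0: "\<not> p dvd n \<Longrightarrow> char_of p g 0 n = 1"
  by (simp add: char_of_def)

lemma char_of_nontrivial:
  assumes "0 < k" "k < p - 1"
  shows "char_of p g k g \<noteq> 1" "\<not> p dvd g"
proof -
  show ndvd: "\<not> p dvd g"
    using g prime by (metis coprime_absorb_left not_prime_unit residue_primroot_def)
  have "[g ^ 1 = g ^ ind p g g] (mod p)" using ind[OF ndvd] by simp
  hence "[ind p g g = 1] (mod (p - 1))" unfolding primroot_power_cong_iff by (rule cong_sym)
  hence "unit_root (p - 1) ^ (k * ind p g g) = unit_root (p - 1) ^ (k * 1)" by (rule unit_root_power_cong)
  also have "\<dots> \<noteq> 1" using assms by (subst unit_root_power_eq_1_iff) (auto dest: dvd_imp_le)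
  finally show "char_of p g k g \<noteq> 1" using ndvd by (simp add: char_of_def)
qed

lemma char_of_orthogonal:
  assumes n: "\<not> p dvd n" and b: "\<not> p dvd b"
  shows "(\<Sum>k<p-1. cnj (char_of p g k b) * char_of p g k n) = (if [n = b] (mod p) then of_nat (p - 1) else 0)"
proof -
  define \<zeta> where "\<zeta> = unit_root (p - 1)"
  have \<zeta>1: "\<zeta> * cnj \<zeta> = 1" by (simp add: \<zeta>_def unit_root_def complex_norm_square[symmetric])
  have \<zeta>p: "\<zeta> ^ (p - 1) = 1" unfolding \<zeta>_def using prime_gt_1_nat[OF prime] by (subst unit_root_power_eq_1_iff) auto
  define \<rho> where "\<rho> = \<zeta> ^ ind p g n * cnj \<zeta> ^ ind p g b"
  have \<rho>p: "\<rho> ^ (p - 1) = 1"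
  proof -
    have "\<rho> ^ (p - 1) = (\<zeta> ^ (p - 1)) ^ ind p g n * cnj (\<zeta> ^ (p - 1)) ^ ind p g b"
      by (simp only: \<rho>_def power_mult_distrib power_mult[symmetric] mult.commute[of "p - 1"] complex_cnj_power)
    thus ?thesis by (simp only: \<zeta>p) simp
  qed
  have "(\<Sum>k<p-1. cnj (char_of p g k b) * char_of p g k n) = (\<Sum>k<p-1. \<rho> ^ k)"
    using n b by (intro sum.cong refl)
      (simp add: char_of_def \<rho>_def \<zeta>_def power_mult_distrib power_mult[symmetric] mult.commute)
  also have "\<dots> = (if \<rho> = 1 then of_nat (p - 1) else 0)"
    using \<rho>p by (auto simp: sum_gp_strict)
  also have "\<rho> = 1 \<longleftrightarrow> [n = b] (mod p)"
  proof -
    have "\<rho> = 1 \<longleftrightarrow> \<rho> * \<zeta> ^ ind p g b = \<zeta> ^ ind p g b" using \<zeta>1 by auto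
    also have "\<rho> * \<zeta> ^ ind p g b = \<zeta> ^ ind p g n * (\<zeta> * cnj \<zeta>) ^ ind p g b"
      by (simp only: \<rho>_def power_mult_distrib mult_ac)
    also have "\<dots> = \<zeta> ^ ind p g n" by (simp only: \<zeta>1) simp
    also have "\<zeta> ^ i = \<zeta> ^ j \<longleftrightarrow> [i = j] (mod (p - 1))" for i j
    proof -
      have *: "\<zeta> ^ i = \<zeta> ^ j \<longleftrightarrow> [i = j] (mod (p - 1))" if "i \<le> j" for i j
      proof -
        have "\<zeta> ^ j = \<zeta> ^ i * \<zeta> ^ (j - i)" using that by (simp flip: power_add)
        hence "\<zeta> ^ i = \<zeta> ^ j \<longleftrightarrow> \<zeta> ^ (j - i) = 1" using \<zeta>1 by auto
        also have "\<dots> \<longleftrightarrow> (p - 1) dvd (j - i)"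
          unfolding \<zeta>_def using prime_gt_1_nat[OF prime] by (intro unit_root_power_eq_1_iff) auto
        also have "\<dots> \<longleftrightarrow> [i = j] (mod (p - 1))" using cong_altdef_nat[OF that] by (metis cong_sym_eq)
        finally show ?thesis .
      qed
      show ?thesis
        using *[of i j] *[of j i] by (cases "i \<le> j") (auto simp: cong_sym_eq eq_commute)
    qed
    also have "[ind p g n = ind p g b] (mod (p - 1)) \<longleftrightarrow> [g ^ ind p g n = g ^ ind p g b] (mod p)"
      by (rule primroot_power_cong_iff[symmetric])
    also have "\<dots> \<longleftrightarrow> [n = b] (mod p)"
      using ind[OF n] ind[OF b] by (meson cong_sym cong_trans)
    finally show ?thesis .
  qed
  finally show ?thesis .
qed

end

lemma prod_one_plus_eq_sum_Pow:
  fixes f :: "'a \<Rightarrow> 'b::comm_semiring_1"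
  assumes "finite A"
  shows "(\<Prod>x\<in>A. 1 + f x) = (\<Sum>B\<in>Pow A. \<Prod>x\<in>B. f x)"
  using assms
proof (induction A rule: finite_induct)
  case (insert a A)
  have "(\<Sum>B\<in>Pow (insert a A). \<Prod>x\<in>B. f x) = (\<Sum>B\<in>Pow A. \<Prod>x\<in>B. f x) + (\<Sum>B\<in>insert a ` Pow A. \<Prod>x\<in>B. f x)"
    unfolding Pow_insert using insert by (intro sum.union_disjoint) auto
  also have "(\<Sum>B\<in>insert a ` Pow A. \<Prod>x\<in>B. f x) = (\<Sum>B\<in>Pow A. \<Prod>x\<in>insert a B. f x)"
    using insert by (intro sum.reindex_cong[of "insert a"]) (auto simp: inj_on_def)
  also have "\<dots> = (\<Sum>B\<in>Pow A. f a * (\<Prod>x\<in>B. f x))"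
    using insert by (intro sum.cong refl prod.insert) (auto intro: finite_subset)
  finally show ?case using insert by (simp add: sum_distrib_left distrib_right sum.distrib)
qed simp

section \<open>Characters close to 1 on short intervals\<close>

lemma prod_primes_dvd:
  assumes "finite A" "\<And>q. q \<in> A \<Longrightarrow> prime q \<and> q dvd (n::nat)"
  shows "\<Prod>A dvd n"
  using assms
proof (induction A rule: finite_induct)
  case (insert q A)
  have "coprime q (\<Prod>A)" using insert by (intro prod_coprime_right) (metis insertCI primes_coprime)
  thus ?case using insert by (simp add: divides_mult)
qed simp

text \<open>Replacing \<open>ln q\<close> by its largest value leaves (2/15 - 1/8) / (2/15) = 1/16
  in the limit; 1/20 makes room for the bounded error K.\<close>

lemma sum_inverse_primes_ge:
  "\<forall>\<^sub>F p::nat in sequentially.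
     (\<Sum>q | prime q \<and> real p powr (1/8) < real q \<and> real q \<le> real p powr (2/15). 1 / real q) \<ge> 1/20"
proof -
  obtain K :: real where K: "K > 0"
    "\<And>w x. 1 \<le> w \<Longrightarrow> w \<le> x \<Longrightarrow> (\<Sum>q | prime q \<and> w < real q \<and> real q \<le> x. ln (real q) / real q) \<ge> ln (x / w) - K"
    using sum_ln_div_primes_ge by blast
  \<comment> \<open>1/600 is the slack (2/15 - 1/8) - (2/15)/20.\<close>
  have "\<forall>\<^sub>F p::nat in sequentially. ln (real p) \<ge> 600 * K" using K by real_asymp
  moreover have "\<forall>\<^sub>F p::nat in sequentially. p \<ge> 2" by (rule eventually_ge_at_top)
  ultimately show ?thesis
  proof eventually_elim
    case (elim p)
    define w x where "w = real p powr (1/8)" and "x = real p powr (2/15)"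
    define P where "P = {q. prime q \<and> w < real q \<and> real q \<le> x}"
    have wx: "1 \<le> w" "w \<le> x" using elim unfolding w_def x_def by (auto intro!: ge_one_powr_ge_zero powr_mono)
    have lnx: "ln x = 2/15 * ln (real p)" and lnw: "ln w = 1/8 * ln (real p)"
      using elim by (simp_all add: w_def x_def ln_powr)
    have lnx0: "ln x > 0" using elim by (simp add: lnx)
    have "ln (x / w) - K \<le> (\<Sum>q\<in>P. ln (real q) / real q)" unfolding P_def by (rule K(2)[OF wx])
    also have "\<dots> \<le> (\<Sum>q\<in>P. ln x * (1 / real q))"
    proof (rule sum_mono)
      fix q assume "q \<in> P"
      hence q: "0 < real q" "real q \<le> x" using wx by (auto simp: P_def)
      hence "ln (real q) \<le> ln x" by simp
      thus "ln (real q) / real q \<le> ln x * (1 / real q)" using q by (simp add: divide_right_mono)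
    qed
    also have "\<dots> = ln x * (\<Sum>q\<in>P. 1 / real q)" by (simp add: sum_distrib_left)
    finally have "ln x - ln w - K \<le> ln x * (\<Sum>q\<in>P. 1 / real q)" using wx by (simp add: ln_div)
    moreover have "ln x - ln w - K \<ge> ln x * (1/20)" using elim unfolding lnx lnw by simp
    ultimately have "ln x * (1/20) \<le> ln x * (\<Sum>q\<in>P. 1 / real q)" by linarith
    hence "1/20 \<le> (\<Sum>q\<in>P. 1 / real q)" using lnx0 by (simp only: mult_le_cancel_left_pos)
    thus ?case by (simp add: P_def w_def x_def)
  qed
qed

text \<open>Integers below \<open>p\<close> of the form \<open>q\<^sub>1 \<dots> q\<^sub>7 m\<close>, with primes \<open>q\<^sub>i\<close> between \<open>p\<^bsup>1/8\<^esup>\<close> and \<open>p\<^bsup>2/15\<^esup>\<close>, have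
  all eight factors small. As an integer below \<open>p\<close> has at most seven prime factors larger than \<open>p\<^bsup>1/8\<^esup>\<close>,
  each is represented a bounded number of times.\<close>

lemma many_products_of_small_factors:
  obtains \<kappa> :: real and p0 :: nat where "\<kappa> > 0"
    "\<And>p. p \<ge> p0 \<Longrightarrow> real (card {n\<in>{0<..<p}. \<exists>f m. n = m * (\<Prod>i<7. f i) \<and> real m \<le> real p powr (2/15) \<and>
        (\<forall>i<7::nat. f i > 0 \<and> real (f i) \<le> real p powr (2/15))}) \<ge> \<kappa> * real p"
proof -
  have "\<forall>\<^sub>F p::nat in sequentially. real p powr (1/15) \<ge> 4" by real_asymp
  moreover have "\<forall>\<^sub>F p::nat in sequentially. p \<ge> 2" by (rule eventually_ge_at_top)
  ultimately have "\<forall>\<^sub>F p::nat in sequentially. real p powr (1/15) \<ge> 4 \<and> p \<ge> 2 \<and>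
     (\<Sum>q | prime q \<and> real p powr (1/8) < real q \<and> real q \<le> real p powr (2/15). 1 / real q) \<ge> 1/20"
    using sum_inverse_primes_ge by eventually_elim auto
  then obtain p0 where p0: "\<And>p. p \<ge> p0 \<Longrightarrow> real p powr (1/15) \<ge> 4 \<and> p \<ge> 2 \<and>
     (\<Sum>q | prime q \<and> real p powr (1/8) < real q \<and> real q \<le> real p powr (2/15). 1 / real q) \<ge> 1/20"
    by (auto simp: eventually_at_top_linorder)
  \<comment> \<open>A factor 1/20 for each of the seven primes, 1/2 for rounding the number of m,
    and 7^7 for the multiplicity of representations.\<close>
  define \<kappa> :: real where "\<kappa> = (1/20) ^ 7 / (2 * 7 ^ 7)"
  show thesis
  proof (rule that[of \<kappa> p0])
    show "\<kappa> > 0" by (simp add: \<kappa>_def)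
    fix p assume "p \<ge> p0"
    note p = p0[OF this]
    define P where "P = {q. prime q \<and> real p powr (1/8) < real q \<and> real q \<le> real p powr (2/15)}"
    have finP: "finite P"
    proof (rule finite_subset)
      show "P \<subseteq> {..nat \<lfloor>real p powr (2/15)\<rfloor>}" by (auto simp: P_def le_nat_floor)
    qed simp
    have p1: "real p \<ge> 1" using p by simp
    define F where "F = {..<7::nat} \<rightarrow>\<^sub>E P"
    have finF: "finite F" unfolding F_def using finP by (intro finite_PiE) auto
    define prd where "prd f = (\<Prod>i<7::nat. f i)" for f :: "nat \<Rightarrow> nat"
    define M where "M f = (p - 1) div prd f" for f
    define \<Omega> where "\<Omega> = (SIGMA f:F. {1..M f})"
    define G where "G = {n\<in>{0<..<p}. \<exists>f m. n = m * (\<Prod>i<7. f i) \<and> real m \<le> real p powr (2/15) \<and>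
        (\<forall>i<7::nat. f i > 0 \<and> real (f i) \<le> real p powr (2/15))}"
    have fP: "prime (f i)" "real p powr (1/8) < real (f i)" "real (f i) \<le> real p powr (2/15)"
      if "f \<in> F" "i < 7" for f i using that by (auto simp: F_def P_def PiE_def Pi_def)
    have prd0: "prd f > 0" if "f \<in> F" for f
      unfolding prd_def using fP(1)[OF that] by (intro prod_pos) (auto simp: prime_gt_0_nat)
    have pw: "(real p powr u) ^ 7 = real p powr (7 * u)" for u using p1 by (simp add: powr_power)
    have prd_upper: "real (prd f) \<le> real p powr (14/15)" if "f \<in> F" for f
    proof -
      have "real (prd f) = (\<Prod>i<7. real (f i))" by (simp add: prd_def)
      also have "\<dots> \<le> (\<Prod>i<7::nat. real p powr (2/15))" using fP(3)[OF that] by (intro prod_mono) auto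
      also have "\<dots> = real p powr (14/15)" by (simp add: pw)
      finally show ?thesis .
    qed
    have prd_lower: "real (prd f) \<ge> real p powr (7/8)" if "f \<in> F" for f
    proof -
      have "real p powr (7/8) = (\<Prod>i<7::nat. real p powr (1/8))" by (simp add: pw)
      also have "\<dots> \<le> (\<Prod>i<7. real (f i))" using fP(2)[OF that] by (intro prod_mono) (auto intro: less_imp_le)
      also have "\<dots> = real (prd f)" by (simp add: prd_def)
      finally show ?thesis .
    qed
    have M_lower: "real (M f) \<ge> real p / 2 * (1 / real (prd f))" if f: "f \<in> F" for f
    proof -
      have "real p powr (1/15) * real (prd f) \<le> real p powr (1/15) * real p powr (14/15)"
        by (intro mult_left_mono prd_upper f) simp
      also have "\<dots> = real p" using p1 by (simp add: powr_add[symmetric])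
      finally have "4 * real (prd f) \<le> real p"
        using p mult_right_mono[of 4 "real p powr (1/15)" "real (prd f)"] by linarith
      hence r4: "real p / real (prd f) \<ge> 4" using prd0[OF f] by (simp add: field_simps)
      have 1: "real (p - 1) / real (prd f) < real (M f) + 1"
        unfolding M_def using floor_correct[of "real (p - 1) / real (prd f)"] by (simp add: floor_divide_of_nat_eq)
      have 2: "real p / real (prd f) - 1 \<le> real (p - 1) / real (prd f)"
        using prd0[OF f] p1 by (simp add: diff_divide_distrib of_nat_diff)
      have half: "X / 2 \<le> M" if "X - 1 < M + 1" "4 \<le> X" for X M :: real using that by linarith
      have eq: "real p / 2 * (1 / real (prd f)) = real p / real (prd f) / 2" by simp
      show ?thesis unfolding eq by (rule half[OF le_less_trans[OF 2 1] r4])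
    qed
    have "\<kappa> * real p * 7 ^ 7 = real p / 2 * (1/20) ^ 7" by (simp add: \<kappa>_def)
    also have "\<dots> \<le> real p / 2 * (\<Sum>q\<in>P. 1 / real q) ^ 7"
      using p unfolding P_def[symmetric] by (intro mult_left_mono power_mono) auto
    also have "(\<Sum>q\<in>P. 1 / real q) ^ 7 = (\<Prod>i<7::nat. \<Sum>q\<in>P. 1 / real q)" by simp
    also have "\<dots> = (\<Sum>f\<in>F. \<Prod>i<7. 1 / real (f i))" unfolding F_def by (rule prod_sum_PiE) (auto simp: finP)
    also have "\<dots> = (\<Sum>f\<in>F. 1 / real (prd f))" by (simp add: prd_def prod_dividef)
    also have "real p / 2 * \<dots> \<le> (\<Sum>f\<in>F. real (M f))"
      unfolding sum_distrib_left by (intro sum_mono M_lower)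
    also have "\<dots> = real (card \<Omega>)" unfolding \<Omega>_def using finF by simp
    also have "card \<Omega> \<le> card G * 7 ^ 7"
    proof -
      define h where "h = (\<lambda>(f, m). m * prd f)"
      have finG: "finite G" by (simp add: G_def)
      have hG: "h z \<in> G" if "z \<in> \<Omega>" for z
      proof -
        obtain f m where z: "z = (f, m)" by (cases z)
        have fm: "f \<in> F" "1 \<le> m" "m \<le> M f" using that by (auto simp: \<Omega>_def z)
        have "m * prd f \<le> M f * prd f" using fm by simp
        also have "\<dots> \<le> p - 1" by (simp add: M_def)
        finally have le: "m * prd f \<le> p - 1" .
        hence "real (m * prd f) \<le> real p" using p by linarith
        have "real m * real p powr (7/8) \<le> real m * real (prd f)" by (intro mult_left_mono prd_lower fm) simp
        also have "\<dots> \<le> real p" using \<open>real (m * prd f) \<le> real p\<close> by simp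
        also have "\<dots> = real p powr (1/8) * real p powr (7/8)" using p1 by (simp add: powr_add[symmetric])
        finally have "real m \<le> real p powr (1/8)" using p1 by simp
        also have "\<dots> \<le> real p powr (2/15)" using p1 by (intro powr_mono) auto
        finally have "real m \<le> real p powr (2/15)" .
        moreover have "0 < m * prd f" "m * prd f < p" using fm prd0 le p by auto
        ultimately show ?thesis unfolding G_def h_def z prd_def using fP[OF fm(1)]
          by (auto simp: prime_gt_0_nat intro!: exI[of _ f] exI[of _ m])
      qed
      have fibre: "card {z\<in>\<Omega>. h z = n} \<le> 7 ^ 7" if n: "n \<in> G" for n
      proof -
        define Q where "Q = {q\<in>P. q dvd n}"
        have finQ: "finite Q" using finP by (simp add: Q_def)
        have n0: "0 < n" "n < p" using n by (auto simp: G_def)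
        have cardQ: "card Q \<le> 7"
        proof (rule ccontr)
          assume "\<not> card Q \<le> 7"
          hence "card Q \<ge> 8" by simp
          then obtain Q' where Q': "Q' \<subseteq> Q" "card Q' = 8" "finite Q'" by (meson obtain_subset_with_card_n)
          have "(\<Prod>q\<in>Q'. q) dvd n"
            using Q' by (intro prod_primes_dvd) (auto simp: Q_def P_def)
          hence le: "(\<Prod>q\<in>Q'. q) \<le> n" using n0 by (auto dest: dvd_imp_le)
          have "real p = (\<Prod>q\<in>Q'. real p powr (1/8))" using Q' p1 by (simp add: powr_power)
          also have "\<dots> \<le> (\<Prod>q\<in>Q'. real q)"
            using Q' by (intro prod_mono) (auto simp: Q_def P_def)
          also have "\<dots> = real (\<Prod>q\<in>Q'. q)" by simp
          also have "\<dots> \<le> real n" using le by (simp only: of_nat_le_iff)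
          finally show False using n0 by simp
        qed
        have "card {z\<in>\<Omega>. h z = n} \<le> card ({..<7::nat} \<rightarrow>\<^sub>E Q)"
        proof (rule card_inj_on_le)
          show "inj_on fst {z\<in>\<Omega>. h z = n}"
          proof (rule inj_onI)
            fix u v assume uv: "u \<in> {z\<in>\<Omega>. h z = n}" "v \<in> {z\<in>\<Omega>. h z = n}" "fst u = fst v"
            hence "snd u * prd (fst u) = snd v * prd (fst u)" by (auto simp: h_def case_prod_unfold)
            moreover have "prd (fst u) > 0" using uv(1) by (intro prd0) (auto simp: \<Omega>_def)
            ultimately show "u = v" using uv(3) by (simp add: prod_eq_iff)
          qed
          show "fst ` {z\<in>\<Omega>. h z = n} \<subseteq> {..<7::nat} \<rightarrow>\<^sub>E Q"
          proof
            fix f assume "f \<in> fst ` {z\<in>\<Omega>. h z = n}"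
            then obtain m where fm: "(f, m) \<in> \<Omega>" "n = m * prd f" by (auto simp: h_def)
            hence fF: "f \<in> F" by (simp add: \<Omega>_def)
            have "f i dvd n" if "i < 7" for i
              using that unfolding fm(2) prd_def by (intro dvd_mult dvd_prodI) auto
            thus "f \<in> {..<7::nat} \<rightarrow>\<^sub>E Q" using fF by (auto simp: F_def Q_def PiE_def Pi_def)
          qed
          show "finite ({..<7::nat} \<rightarrow>\<^sub>E Q)" using finQ by (intro finite_PiE) auto
        qed
        also have "\<dots> = card Q ^ 7" by (simp add: card_PiE)
        also have "\<dots> \<le> 7 ^ 7" by (intro power_mono cardQ) simp
        finally show ?thesis .
      qed
      have "\<Omega> = (\<Union>n\<in>G. {z\<in>\<Omega>. h z = n})" using hG by auto
      hence "card \<Omega> \<le> (\<Sum>n\<in>G. card {z\<in>\<Omega>. h z = n})"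
        using card_UN_le[OF finG, of "\<lambda>n. {z\<in>\<Omega>. h z = n}"] by simp
      also have "\<dots> \<le> (\<Sum>n\<in>G. 7 ^ 7)" by (intro sum_mono fibre)
      finally show ?thesis by simp
    qed
    hence "real (card \<Omega>) \<le> real (card G * 7 ^ 7)" by (simp only: of_nat_le_iff)
    finally have "\<kappa> * real p * 7 ^ 7 \<le> real (card G) * 7 ^ 7" by simp
    thus "\<kappa> * real p \<le> real (card {n\<in>{0<..<p}. \<exists>f m. n = m * (\<Prod>i<7. f i) \<and> real m \<le> real p powr (2/15) \<and>
        (\<forall>i<7::nat. f i > 0 \<and> real (f i) \<le> real p powr (2/15))})"
      unfolding G_def[symmetric] by (subst (asm) mult_le_cancel_right_pos) auto
  qed
qed

text \<open>On the unit circle |1 + z|^2 = 4 - |1 - z|^2, and 1 - t \<le> exp(-t).\<close>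

lemma norm_one_plus_le:
  assumes "norm (z :: complex) = 1"
  shows "norm (1 + z) \<le> 2 * exp (- (norm (1 - z))\<^sup>2 / 8)"
proof (rule power2_le_imp_le)
  have z: "(Re z)\<^sup>2 + (Im z)\<^sup>2 = 1" using assms by (simp add: cmod_def)
  have "(norm (1 + z))\<^sup>2 + (norm (1 - z))\<^sup>2 = 2 + 2 * ((Re z)\<^sup>2 + (Im z)\<^sup>2)"
    unfolding cmod_power2 by (simp add: power2_eq_square algebra_simps)
  hence "(norm (1 + z))\<^sup>2 = 4 * (1 + (- (norm (1 - z))\<^sup>2 / 4))" using z by simp
  also have "\<dots> \<le> 4 * exp (- (norm (1 - z))\<^sup>2 / 4)"
    by (intro mult_left_mono exp_ge_add_one_self) simp
  also have "\<dots> = (2 * exp (- (norm (1 - z))\<^sup>2 / 8))\<^sup>2"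
  proof -
    have "4 * exp (- u / 4) = (2 * exp (- u / 8))\<^sup>2" for u :: real
      by (simp add: power2_eq_square flip: exp_add)
    thus ?thesis .
  qed
  finally show "(norm (1 + z))\<^sup>2 \<le> (2 * exp (- (norm (1 - z))\<^sup>2 / 8))\<^sup>2" .
qed simp

lemma norm_one_minus_power_le:
  assumes "norm (\<omega> :: complex) \<le> 1"
  shows "norm (1 - \<omega> ^ j) \<le> real j * norm (1 - \<omega>)"
proof (induction j)
  case (Suc j)
  have "1 - \<omega> ^ Suc j = (1 - \<omega> ^ j) + \<omega> ^ j * (1 - \<omega>)" by (simp add: algebra_simps)
  hence "norm (1 - \<omega> ^ Suc j) \<le> norm (1 - \<omega> ^ j) + norm (\<omega> ^ j) * norm (1 - \<omega>)"
    by (metis norm_mult norm_triangle_ineq)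
  also have "norm (\<omega> ^ j) * norm (1 - \<omega>) \<le> 1 * norm (1 - \<omega>)"
    using assms by (intro mult_right_mono) (auto simp: norm_power power_le_one)
  finally show ?case using Suc by (simp add: algebra_simps)
qed simp

lemma norm_one_minus_prod_le:
  assumes "\<And>i. i \<in> A \<Longrightarrow> norm (f i :: complex) \<le> 1"
  shows "norm (1 - (\<Prod>i\<in>A. f i)) \<le> (\<Sum>i\<in>A. norm (1 - f i))"
  using assms
proof (induction A rule: infinite_finite_induct)
  case (insert a A)
  have "1 - (\<Prod>i\<in>insert a A. f i) = (1 - f a) + f a * (1 - (\<Prod>i\<in>A. f i))"
    using insert by (simp add: algebra_simps)
  hence "norm (1 - (\<Prod>i\<in>insert a A. f i)) \<le> norm (1 - f a) + norm (f a) * norm (1 - (\<Prod>i\<in>A. f i))"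
    by (metis norm_mult norm_triangle_ineq)
  also have "norm (f a) * norm (1 - (\<Prod>i\<in>A. f i)) \<le> 1 * norm (1 - (\<Prod>i\<in>A. f i))"
    using insert by (intro mult_right_mono) auto
  also have "1 * norm (1 - (\<Prod>i\<in>A. f i)) \<le> (\<Sum>i\<in>A. norm (1 - f i))" using insert by simp
  finally show ?case using insert by simp
qed auto

text \<open>Otherwise the geometric sum of its d powers is 0, although each of them is within d |1 -
  \<omega>| of 1; this gives d \<le> d^2 |1 - \<omega>| < 1.\<close>

lemma root_of_unity_eq_1:
  assumes "(\<omega> :: complex) ^ d = 1" "d > 0" "norm \<omega> \<le> 1" "(real d)\<^sup>2 * norm (1 - \<omega>) < 1"
  shows "\<omega> = 1"
proof (rule ccontr)
  assume "\<omega> \<noteq> 1"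
  hence 0: "(\<Sum>j<d. \<omega> ^ j) = 0" using assms by (simp add: sum_gp_strict)
  have "real d = norm (\<Sum>j<d. 1 - \<omega> ^ j)" using 0 by (simp add: sum_subtractf)
  also have "\<dots> \<le> (\<Sum>j<d. real d * norm (1 - \<omega>))"
  proof (rule sum_norm_le)
    fix j assume "j \<in> {..<d}"
    hence "real j * norm (1 - \<omega>) \<le> real d * norm (1 - \<omega>)" by (intro mult_right_mono) auto
    thus "norm (1 - \<omega> ^ j) \<le> real d * norm (1 - \<omega>)" using norm_one_minus_power_le[OF assms(3), of j] by linarith
  qed
  also have "\<dots> = (real d)\<^sup>2 * norm (1 - \<omega>)" by (simp add: power2_eq_square)
  finally show False using assms by simp
qed

section \<open>Consequences of a small total distance between a character and 1\<close>

context mod_char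
begin

lemma not_dvd_small: "0 < n \<Longrightarrow> n < p \<Longrightarrow> \<not> p dvd n"
  by (auto dest: dvd_imp_le)

lemma norm_prod_one_plus_le:
  assumes "y < p"
  shows "norm (\<Prod>n=1..y. 1 + \<psi> n) \<le> 2 ^ y * exp (- (\<Sum>n=1..y. (norm (1 - \<psi> n))\<^sup>2) / 8)"
proof -
  have "norm (\<Prod>n=1..y. 1 + \<psi> n) = (\<Prod>n=1..y. norm (1 + \<psi> n))" by (simp add: prod_norm)
  also have "\<dots> \<le> (\<Prod>n=1..y. 2 * exp (- (norm (1 - \<psi> n))\<^sup>2 / 8))"
    using assms by (intro prod_mono conjI norm_one_plus_le norm_eq not_dvd_small) auto
  also have "\<dots> = 2 ^ y * exp (\<Sum>n=1..y. - (norm (1 - \<psi> n))\<^sup>2 / 8)"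
    by (simp add: prod.distrib exp_sum)
  also have "(\<Sum>n=1..y. - (norm (1 - \<psi> n))\<^sup>2 / 8) = - (\<Sum>n=1..y. (norm (1 - \<psi> n))\<^sup>2) / 8"
    by (simp add: sum_divide_distrib sum_negf)
  finally show ?thesis .
qed

text \<open>If \<open>\<psi>\<close> is close to 1 on average up to \<open>y\<close>, comparing \<open>\<psi> m\<close> with \<open>\<psi> (n m)\<close> shows that it is close to 1
  at every \<open>n\<close> somewhat smaller than \<open>y\<close>.\<close>

lemma norm_one_minus_small_le:
  assumes y: "y < p" and n: "0 < n" and M: "n * M \<le> y"
  shows "real M * (norm (1 - \<psi> n))\<^sup>2 \<le> 4 * (\<Sum>j=1..y. (norm (1 - \<psi> j))\<^sup>2)"
proof -
  define E where "E = (\<Sum>j=1..y. (norm (1 - \<psi> j))\<^sup>2)"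
  have "1 * M \<le> n * M" using n by (intro mult_le_mono1) simp
  hence My: "M \<le> y" using M by linarith
  have "real M * (norm (1 - \<psi> n))\<^sup>2 = (\<Sum>m=1..M. (norm (1 - \<psi> n))\<^sup>2)" by simp
  also have "\<dots> \<le> (\<Sum>m=1..M. 2 * (norm (1 - \<psi> m))\<^sup>2 + 2 * (norm (1 - \<psi> (n * m)))\<^sup>2)"
  proof (rule sum_mono)
    fix m assume m: "m \<in> {1..M}"
    hence "norm (\<psi> m) = 1" using My y by (intro norm_eq not_dvd_small) auto
    hence "norm (1 - \<psi> n) = norm (\<psi> m * (1 - \<psi> n))" by (simp add: norm_mult)
    also have "\<psi> m * (1 - \<psi> n) = (1 - \<psi> (n * m)) - (1 - \<psi> m)"
      unfolding mult by (simp add: algebra_simps)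
    also have "norm \<dots> \<le> norm (1 - \<psi> (n * m)) + norm (1 - \<psi> m)" by (rule norm_triangle_ineq4)
    finally have "(norm (1 - \<psi> n))\<^sup>2 \<le> (norm (1 - \<psi> (n * m)) + norm (1 - \<psi> m))\<^sup>2" by (intro power_mono) auto
    also have "\<dots> \<le> 2 * (norm (1 - \<psi> m))\<^sup>2 + 2 * (norm (1 - \<psi> (n * m)))\<^sup>2"
    proof -
      have "(v + u)\<^sup>2 \<le> 2 * u\<^sup>2 + 2 * v\<^sup>2" for u v :: real
        using zero_le_power2[of "u - v"] by (simp add: power2_eq_square algebra_simps)
      thus ?thesis .
    qed
    finally show "(norm (1 - \<psi> n))\<^sup>2 \<le> 2 * (norm (1 - \<psi> m))\<^sup>2 + 2 * (norm (1 - \<psi> (n * m)))\<^sup>2" .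
  qed
  finally have sum_le: "real M * (norm (1 - \<psi> n))\<^sup>2 \<le> \<dots>" .
  have split: "(\<Sum>m=1..M. 2 * (norm (1 - \<psi> m))\<^sup>2 + 2 * (norm (1 - \<psi> (n * m)))\<^sup>2)
     = 2 * (\<Sum>m=1..M. (norm (1 - \<psi> m))\<^sup>2) + 2 * (\<Sum>m=1..M. (norm (1 - \<psi> (n * m)))\<^sup>2)"
    by (simp only: sum.distrib sum_distrib_left)
  have E1: "(\<Sum>m=1..M. (norm (1 - \<psi> m))\<^sup>2) \<le> E" unfolding E_def using My by (intro sum_mono2) auto
  have "(\<Sum>m=1..M. (norm (1 - \<psi> (n * m)))\<^sup>2) = (\<Sum>j\<in>(\<lambda>m. n * m) ` {1..M}. (norm (1 - \<psi> j))\<^sup>2)"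
  proof -
    have "inj_on (\<lambda>m. n * m) {1..M}" using n by (auto intro: inj_onI)
    from sum.reindex[OF this, of "\<lambda>j. (norm (1 - \<psi> j))\<^sup>2"] show ?thesis by (simp only: o_def)
  qed
  also have "\<dots> \<le> E" unfolding E_def
  proof (rule sum_mono2)
    show "(\<lambda>m. n * m) ` {1..M} \<subseteq> {1..y}"
    proof safe
      fix m assume "m \<in> {1..M}"
      hence m: "m \<le> M" "m > 0" by auto
      have "n * m \<le> y" by (rule order.trans[OF mult_le_mono2[OF m(1)] M])
      thus "n * m \<in> {1..y}" using n m by (simp add: Suc_le_eq)
    qed
  qed auto
  finally show ?thesis using sum_le split E1 unfolding E_def[symmetric] by linarith
qed

lemma eq_1_of_prime_factors:
  assumes "\<And>q. prime q \<Longrightarrow> q dvd n \<Longrightarrow> \<psi> q = 1" "n > 0"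
  shows "\<psi> n = 1"
  using assms
proof (induction n rule: less_induct)
  case (less n)
  show ?case
  proof (cases "n = 1")
    case False
    then obtain q where q: "prime q" "q dvd n" using prime_factor_nat by blast
    then obtain k where k: "n = q * k" by blast
    have "k < n" "k > 0" using k less.prems(2) prime_gt_1_nat[OF q(1)] by auto
    have "\<psi> k = 1"
    proof (rule less.IH[OF \<open>k < n\<close> _ \<open>k > 0\<close>])
      fix q' assume "prime q'" "q' dvd k"
      thus "\<psi> q' = 1" by (intro less.prems(1)) (simp_all add: k)
    qed
    moreover have "\<psi> n = \<psi> q * \<psi> k" unfolding k by (rule mult)
    ultimately show ?thesis using less.prems(1)[OF q] by simp
  qed simp
qed

end

text \<open>If d exceeded J, the sum of J powers of \<psi> would have mean square J over the units.
  But on a proportion \<kappa> of the residues, the products of eight small integers, \<psi> is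
  within 8\<tau> of 1 and this sum is at least J / 2. Hence \<kappa> J \<le> 4, against the choice
  of J.\<close>

lemma order_bounded:
  obtains d0 p0 :: nat and \<tau> :: real where "\<tau> > 0"
    "\<And>p \<psi> d. mod_char p \<psi> \<Longrightarrow> p \<ge> p0 \<Longrightarrow> mod_char.has_order p \<psi> d \<Longrightarrow>
       (\<And>n. 0 < n \<Longrightarrow> real n \<le> real p powr (2/15) \<Longrightarrow> norm (1 - \<psi> n) \<le> \<tau>) \<Longrightarrow> d \<le> d0"
proof (rule many_products_of_small_factors)
  fix \<kappa> :: real and p0 :: nat
  assume \<kappa>: "\<kappa> > 0" and smooth:
    "\<And>p. p \<ge> p0 \<Longrightarrow> real (card {n\<in>{0<..<p}. \<exists>f m. n = m * (\<Prod>i<7. f i) \<and> real m \<le> real p powr (2/15) \<and>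
        (\<forall>i<7::nat. f i > 0 \<and> real (f i) \<le> real p powr (2/15))}) \<ge> \<kappa> * real p"
  define J where "J = nat \<lceil>4 / \<kappa>\<rceil> + 1"
  have J: "real J > 4 / \<kappa>" "real J \<ge> 1" unfolding J_def by linarith+
  \<comment> \<open>Chosen so that J * 8\<tau> = 1/2: eight factors lose 8\<tau>, and passing to
    powers below J loses a factor J.\<close>
  define \<tau> where "\<tau> = 1 / (16 * real J)"
  show thesis
  proof (rule that[of \<tau> p0 J])
    show "\<tau> > 0" using J by (simp add: \<tau>_def)
    fix p d :: nat and \<psi> :: "nat \<Rightarrow> complex"
    assume \<psi>: "mod_char p \<psi>" and p: "p \<ge> p0" and ord: "mod_char.has_order p \<psi> d"
      and close: "\<And>n. 0 < n \<Longrightarrow> real n \<le> real p powr (2/15) \<Longrightarrow> norm (1 - \<psi> n) \<le> \<tau>"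
    interpret mod_char p \<psi> by fact
    show "d \<le> J"
    proof (rule ccontr)
      assume "\<not> d \<le> J"
      hence Jd: "J \<le> d" by simp
      define G where "G = {n\<in>{0<..<p}. \<exists>f m. n = m * (\<Prod>i<7. f i) \<and> real m \<le> real p powr (2/15) \<and>
        (\<forall>i<7::nat. f i > 0 \<and> real (f i) \<le> real p powr (2/15))}"
      have G: "real J / 2 \<le> norm (\<Sum>j<J. \<psi> n ^ j)" if n: "n \<in> G" for n
      proof -
        obtain f :: "nat \<Rightarrow> nat" and m where fm: "n = m * (\<Prod>i<7. f i)" "real m \<le> real p powr (2/15)" and
          f: "\<And>i. i < 7 \<Longrightarrow> f i > 0 \<and> real (f i) \<le> real p powr (2/15)" and n0: "n > 0"
          using n unfolding G_def by auto
        have m0: "m > 0" using fm(1) n0 by (intro Nat.gr0I) auto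
        have "norm (1 - \<psi> n) = norm (1 - \<psi> m * (\<Prod>i<7. \<psi> (f i)))" by (simp add: fm(1) mult prod)
        also have "1 - \<psi> m * (\<Prod>i<7. \<psi> (f i)) = (1 - \<psi> m) + \<psi> m * (1 - (\<Prod>i<7. \<psi> (f i)))" by (simp add: algebra_simps)
        also have "norm \<dots> \<le> norm (1 - \<psi> m) + norm (\<psi> m) * norm (1 - (\<Prod>i<7. \<psi> (f i)))"
          by (metis norm_mult norm_triangle_ineq)
        also have "\<dots> \<le> \<tau> + 1 * (\<Sum>i<7. norm (1 - \<psi> (f i)))"
          by (intro add_mono mult_mono close m0 fm norm_le norm_one_minus_prod_le) auto
        also have "(\<Sum>i<7. norm (1 - \<psi> (f i))) \<le> (\<Sum>i<7::nat. \<tau>)" using f by (intro sum_mono close) auto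
        finally have n8: "norm (1 - \<psi> n) \<le> 8 * \<tau>" by simp
        have "norm (of_nat J - (\<Sum>j<J. \<psi> n ^ j)) = norm (\<Sum>j<J. 1 - \<psi> n ^ j)" by (simp add: sum_subtractf)
        also have "\<dots> \<le> (\<Sum>j<J. real J * (8 * \<tau>))"
        proof (rule sum_norm_le)
          fix j assume "j \<in> {..<J}"
          hence "real j * norm (1 - \<psi> n) \<le> real J * (8 * \<tau>)" using n8 by (intro mult_mono) auto
          thus "norm (1 - \<psi> n ^ j) \<le> real J * (8 * \<tau>)" using norm_one_minus_power_le[OF norm_le, of n j] by linarith
        qed
        also have "\<dots> = real J / 2" using J by (simp add: \<tau>_def)
        finally have "norm (of_nat J - (\<Sum>j<J. \<psi> n ^ j)) \<le> real J / 2" .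
        moreover have "norm (of_nat J :: complex) \<le> norm (of_nat J - (\<Sum>j<J. \<psi> n ^ j)) + norm (\<Sum>j<J. \<psi> n ^ j)"
          using norm_triangle_sub[of "of_nat J" "\<Sum>j<J. \<psi> n ^ j"] by (simp only: add.commute)
        ultimately show ?thesis by simp
      qed
      have "\<kappa> * real p * (real J / 2)\<^sup>2 \<le> real (card G) * (real J / 2)\<^sup>2"
        using smooth[OF p] unfolding G_def by (intro mult_right_mono) auto
      also have "\<dots> = (\<Sum>n\<in>G. (real J / 2)\<^sup>2)" by simp
      also have "\<dots> \<le> (\<Sum>n\<in>G. (norm (\<Sum>j<J. \<psi> n ^ j))\<^sup>2)"
        using J by (intro sum_mono power_mono G) auto
      also have "\<dots> \<le> (\<Sum>n\<in>{0<..<p}. (norm (\<Sum>j<J. \<psi> n ^ j))\<^sup>2)" by (intro sum_mono2) (auto simp: G_def)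
      also have "\<dots> = real (p - 1) * real J" by (rule mean_square_of_powers[OF ord Jd])
      also have "\<dots> \<le> real p * real J" by (intro mult_right_mono) auto
      finally have "(real p * real J) * (\<kappa> * real J) \<le> (real p * real J) * 4"
        by (simp add: power2_eq_square mult_ac)
      moreover have "real p * real J > 0" using J prime_gt_0_nat[OF prime] by simp
      ultimately have "\<kappa> * real J \<le> 4" by (rule mult_left_le_imp_le)
      thus False using J(1) \<kappa> by (simp add: field_simps)
    qed
  qed
qed

lemma sum_character_distance_ge:
  fixes \<epsilon> :: real
  assumes \<epsilon>: "0 < \<epsilon>" "\<epsilon> < 1/5"
  obtains p0 :: nat where
    "\<And>p \<psi> y u. mod_char p \<psi> \<Longrightarrow> p \<ge> p0 \<Longrightarrow> \<not> p dvd u \<Longrightarrow> \<psi> u \<noteq> 1 \<Longrightarrow> y < p \<Longrightarrow>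
       real p powr (1 / (4 * sqrt (exp 1)) + \<epsilon>) < real y \<Longrightarrow>
       16 * ln (real p) \<le> (\<Sum>n=1..y. (norm (1 - \<psi> n))\<^sup>2)"
proof (rule order_bounded)
  fix d0 p1 :: nat and \<tau> :: real
  assume \<tau>: "\<tau> > 0" and order_le: "\<And>p \<psi> d. mod_char p \<psi> \<Longrightarrow> p \<ge> p1 \<Longrightarrow> mod_char.has_order p \<psi> d \<Longrightarrow>
       (\<And>n. 0 < n \<Longrightarrow> real n \<le> real p powr (2/15) \<Longrightarrow> norm (1 - \<psi> n) \<le> \<tau>) \<Longrightarrow> d \<le> d0"
  define s where "s = sqrt (exp (1::real))"
  define c0 where "c0 = 1 / (4 * s)"
  \<comment> \<open>a is the exponent up to which \<psi> is shown to be 1, with \<epsilon>/2 given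
    up for passing from averages to single values; b is the exponent for Burgess' bound. As s \<ge>
    1, the \<epsilon>/2 in a outweighs the \<epsilon>/4 in b and keeps \<rho> below s =
    \<surd>e.\<close>
  define a where "a = c0 + \<epsilon> / 2"
  define b where "b = 1/4 + \<epsilon> / 4"
  define \<rho> where "\<rho> = b / a"
  \<comment> \<open>Of the margin 1 - 2 ln \<rho> = 3\<eta>, one \<eta> covers the errors in
    Mertens' theorem and in rounding, one is what Burgess' bound allows, and one is left for the
    contradiction.\<close>
  define \<eta> where "\<eta> = (1 - 2 * ln \<rho>) / 3"
  have e: "exp (1::real) \<ge> 2" "exp (1::real) \<le> 3"
    using exp_ge_add_one_self[of 1] exp_le by simp_all
  have s: "5/4 \<le> s" "s \<le> 15/8" unfolding s_def
    by (rule real_le_rsqrt; use e in \<open>simp add: power2_eq_square\<close>)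
       (rule real_le_lsqrt; use e in \<open>simp add: power2_eq_square\<close>)
  have c0: "2/15 \<le> c0" "c0 \<le> 1/5" using s by (auto simp: c0_def field_simps)
  \<comment> \<open>With c0 \<le> 1/5, the inequality a \<le> b follows from \<epsilon> < 1/5. The
    bound 2/15 \<le> a makes \<open>order_bounded\<close> applicable.\<close>
  have ab: "0 < a" "a \<le> b" "2/15 \<le> a" "b \<le> 1/2" using c0 \<epsilon> by (auto simp: a_def b_def)
  have \<rho>1: "1 \<le> \<rho>" using ab by (simp add: \<rho>_def)
  have "\<rho> < s"
  proof -
    have "s * a = 1/4 + s * (\<epsilon> / 2)" using s by (simp add: a_def c0_def field_simps)
    moreover have "s * (\<epsilon> / 2) \<ge> 1 * (\<epsilon> / 2)" using s \<epsilon> by (intro mult_right_mono) auto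
    ultimately have "b < s * a" using \<epsilon> by (simp add: b_def)
    thus ?thesis using ab by (simp add: \<rho>_def divide_less_eq)
  qed
  hence "ln \<rho> < ln s" using \<rho>1 by simp
  also have "ln s = 1/2" by (simp add: s_def ln_sqrt)
  finally have "ln \<rho> < 1/2" .
  moreover have "0 \<le> ln \<rho>" using \<rho>1 by simp
  ultimately have \<eta>: "0 < \<eta>" "\<eta> \<le> 1" by (simp_all add: \<eta>_def)
  \<comment> \<open>\<tau> is what the bound on the order asks for; the second entry is small enough
    that a d-th root of unity with d \<le> d0 this close to 1 equals 1.\<close>
  define \<sigma> where "\<sigma> = min \<tau> (1 / (2 * (real d0 + 1)\<^sup>2))"
  have \<sigma>: "\<sigma> > 0" using \<tau> by (simp add: \<sigma>_def)
  have \<epsilon>4: "\<epsilon> / 4 > 0" using \<epsilon> by simp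
  \<comment> \<open>The threshold in Burgess' bound depends on the order d. It is turned into a
    function of d, and the sum of its values up to d0 serves all possible orders at once.\<close>
  have "\<exists>P. \<forall>p \<psi> N. d \<ge> 2 \<longrightarrow> mod_char p \<psi> \<longrightarrow> p \<ge> P \<longrightarrow> mod_char.has_order p \<psi> d \<longrightarrow>
       real p powr (1/4 + \<epsilon>/4) \<le> 2 * real N \<longrightarrow> real N \<le> sqrt (real p) \<longrightarrow>
       norm (\<Sum>n=1..N. \<psi> n) \<le> \<eta> * real N" for d
  proof (cases "d \<ge> 2")
    case True
    show ?thesis by (rule burgess[OF True \<eta> \<epsilon>4]) blast
  qed simp
  then obtain P where P: "\<And>d p \<psi> N. d \<ge> 2 \<Longrightarrow> mod_char p \<psi> \<Longrightarrow> p \<ge> P d \<Longrightarrow> mod_char.has_order p \<psi> d \<Longrightarrow>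
       real p powr (1/4 + \<epsilon>/4) \<le> 2 * real N \<Longrightarrow> real N \<le> sqrt (real p) \<Longrightarrow>
       norm (\<Sum>n=1..N. \<psi> n) \<le> \<eta> * real N" by metis
  \<comment> \<open>L stands for ln p. Rounding p^a down costs at most a factor 2, hence ln 2; the
    14 is twice the 7 in the bound for reciprocals of primes. Neither affects the limit.\<close>
  have lim: "((\<lambda>L. 2 * ln (b * L / (a * L - ln 2)) + 14 / (a * L - ln 2)) \<longlongrightarrow> 2 * ln \<rho>) at_top"
    unfolding \<rho>_def divide_inverse[of b a] using ab by real_asymp
  have "3 * \<eta> = 1 - 2 * ln \<rho>" by (simp add: \<eta>_def)
  hence "2 * ln \<rho> < 1 - 2 * \<eta>" using \<eta> by linarith
  hence "\<forall>\<^sub>F L in at_top. 2 * ln (b * L / (a * L - ln 2)) + 14 / (a * L - ln 2) < 1 - 2 * \<eta>"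
    using order_tendstoD(2)[OF lim] by blast
  hence ev1: "\<forall>\<^sub>F p::nat in sequentially. 2 * ln (b * ln (real p) / (a * ln (real p) - ln 2)) + 14 / (a * ln (real p) - ln 2) < 1 - 2 * \<eta>"
    by (rule eventually_compose_filterlim) real_asymp
  \<comment> \<open>128 = 2 * 4 * 16: rounding p^(\<epsilon>/2) down, the factor in
    \<open>norm_one_minus_small_le\<close>, and the 16 ln p assumed for contradiction.\<close>
  have ev2: "\<forall>\<^sub>F p::nat in sequentially. 128 * ln (real p) < \<sigma>\<^sup>2 * real p powr (\<epsilon>/2)" using \<sigma> \<epsilon> by real_asymp
  have ev3: "\<forall>\<^sub>F p::nat in sequentially. real p powr (\<epsilon>/2) \<ge> 2" using \<epsilon> by real_asymp
  have ev4: "\<forall>\<^sub>F p::nat in sequentially. real p powr a \<ge> 4" using ab by real_asymp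
  have ev5: "\<forall>\<^sub>F p::nat in sequentially. p \<ge> 2 + p1 + (\<Sum>d\<le>d0. P d)" by (rule eventually_ge_at_top)
  have "\<forall>\<^sub>F p::nat in sequentially. 2 * ln (b * ln (real p) / (a * ln (real p) - ln 2)) + 14 / (a * ln (real p) - ln 2) < 1 - 2 * \<eta> \<and>
      128 * ln (real p) < \<sigma>\<^sup>2 * real p powr (\<epsilon>/2) \<and> real p powr (\<epsilon>/2) \<ge> 2 \<and> real p powr a \<ge> 4 \<and> p \<ge> 2 + p1 + (\<Sum>d\<le>d0. P d)"
    by (intro eventually_conj ev1 ev2 ev3 ev4 ev5)
  then obtain p0 where p0: "\<And>p. p \<ge> p0 \<Longrightarrow> 2 * ln (b * ln (real p) / (a * ln (real p) - ln 2)) + 14 / (a * ln (real p) - ln 2) < 1 - 2 * \<eta> \<and>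
      128 * ln (real p) < \<sigma>\<^sup>2 * real p powr (\<epsilon>/2) \<and> real p powr (\<epsilon>/2) \<ge> 2 \<and> real p powr a \<ge> 4 \<and> p \<ge> 2 + p1 + (\<Sum>d\<le>d0. P d)"
    unfolding eventually_at_top_linorder by blast
  show thesis
  proof (rule that[of p0], rule ccontr)
    fix p y u :: nat and \<psi> :: "nat \<Rightarrow> complex"
    assume \<psi>: "mod_char p \<psi>" and pp0: "p \<ge> p0" and u: "\<not> p dvd u" "\<psi> u \<noteq> 1" and y: "y < p"
      "real p powr (1 / (4 * sqrt (exp 1)) + \<epsilon>) < real y"
      and "\<not> 16 * ln (real p) \<le> (\<Sum>n=1..y. (norm (1 - \<psi> n))\<^sup>2)"
    hence small: "(\<Sum>n=1..y. (norm (1 - \<psi> n))\<^sup>2) < 16 * ln (real p)" by simp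
    interpret mod_char p \<psi> by fact
    have p: "2 * ln (b * ln (real p) / (a * ln (real p) - ln 2)) + 14 / (a * ln (real p) - ln 2) < 1 - 2 * \<eta>"
      "128 * ln (real p) < \<sigma>\<^sup>2 * real p powr (\<epsilon>/2)" "real p powr (\<epsilon>/2) \<ge> 2" "real p powr a \<ge> 4"
      "p \<ge> p1" "p \<ge> (\<Sum>d\<le>d0. P d)" "real p \<ge> 2"
      using p0[OF pp0] by auto
    define L where "L = ln (real p)"
    have close: "norm (1 - \<psi> n) \<le> \<sigma>" if n: "0 < n" "real n \<le> real p powr a" for n
    proof -
      define x where "x = real p powr (\<epsilon>/2)"
      define M where "M = nat \<lfloor>x\<rfloor>"
      have M: "real M \<le> x" "x < real M + 1" using p(3) unfolding M_def x_def by linarith+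
      have "real n * real M \<le> real p powr a * x" using M n by (intro mult_mono) auto
      also have "\<dots> = real p powr (c0 + \<epsilon>)" by (simp add: a_def x_def powr_add[symmetric] add.commute)
      also have "\<dots> < real y" using y(2) by (simp add: c0_def s_def)
      finally have "real (n * M) < real y" by simp
      hence "n * M \<le> y" by (simp only: of_nat_less_iff)
      hence "real M * (norm (1 - \<psi> n))\<^sup>2 \<le> 4 * (\<Sum>j=1..y. (norm (1 - \<psi> j))\<^sup>2)"
        by (rule norm_one_minus_small_le[OF y(1) n(1)])
      hence 1: "real M * (norm (1 - \<psi> n))\<^sup>2 \<le> 64 * L" using small by (simp add: L_def)
      have "x / 2 \<le> real M" using M p(3) by (simp add: x_def)
      hence "x / 2 * (norm (1 - \<psi> n))\<^sup>2 \<le> real M * (norm (1 - \<psi> n))\<^sup>2" by (intro mult_right_mono) auto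
      hence "x * (norm (1 - \<psi> n))\<^sup>2 \<le> x * \<sigma>\<^sup>2" using 1 p(2) by (simp add: x_def L_def mult.commute)
      moreover have "x > 0" using p(3) unfolding x_def by linarith
      ultimately have "(norm (1 - \<psi> n))\<^sup>2 \<le> \<sigma>\<^sup>2" by (rule mult_left_le_imp_le)
      thus ?thesis by (rule power2_le_imp_le) (use \<sigma> in simp)
    qed
    obtain d where ord: "has_order d" using has_order_ex by blast
    have d_le: "d \<le> d0"
    proof (rule order_le[OF \<psi> p(5) ord])
      fix n :: nat assume n: "0 < n" "real n \<le> real p powr (2/15)"
      have "real p powr (2/15) \<le> real p powr a" using p ab by (intro powr_mono) auto
      hence "norm (1 - \<psi> n) \<le> \<sigma>" using n by (intro close) auto
      thus "norm (1 - \<psi> n) \<le> \<tau>" by (simp add: \<sigma>_def)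
    qed
    have "d \<noteq> 1" using order_one_imp_trivial[OF _ u(1)] u(2) ord by metis
    hence d2: "d \<ge> 2" using has_order_pos[OF ord] by linarith
    have exact: "\<psi> n = 1" if n: "0 < n" "real n \<le> real p powr a" for n
    proof (rule root_of_unity_eq_1)
      note n(2)
      also have "real p powr a \<le> real p powr (1/2)" using ab p by (intro powr_mono) auto
      also have "\<dots> < real p powr 1" using p by (intro powr_less_mono) auto
      finally have "n < p" using p by simp
      thus "\<psi> n ^ d = 1" by (intro power_order[OF ord] not_dvd_small n)
      show "d > 0" using d2 by simp
      show "norm (\<psi> n) \<le> 1" by (rule norm_le)
      have "(real d)\<^sup>2 * norm (1 - \<psi> n) \<le> (real d0 + 1)\<^sup>2 * (1 / (2 * (real d0 + 1)\<^sup>2))"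
        using close[OF n] d_le by (intro mult_mono power_mono) (auto simp: \<sigma>_def)
      also have "\<dots> < 1"
      proof -
        have "(real d0 + 1)\<^sup>2 > 0" by simp
        thus ?thesis by (simp add: divide_simps)
      qed
      finally show "(real d)\<^sup>2 * norm (1 - \<psi> n) < 1" .
    qed
    define N m where "N = nat \<lfloor>real p powr b\<rfloor>" and "m = nat \<lfloor>real p powr a\<rfloor>"
    have pab: "real p powr a \<le> real p powr b" using p ab by (intro powr_mono) auto
    have N: "real N \<le> real p powr b" "real p powr b < real N + 1" unfolding N_def using pab p by linarith+
    have m: "real m \<le> real p powr a" "real p powr a < real m + 1" unfolding m_def using p by linarith+
    have mN: "m \<le> N" unfolding m_def N_def by (intro nat_mono floor_mono pab)
    have m2: "2 \<le> m" using m p(4) by simp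
    have N_pos: "real N > 0" using m2 mN by simp
    define Q where "Q = {q. prime q \<and> m < q \<and> q \<le> N}"
    have finQ: "finite Q" by (rule finite_subset[of _ "{..N}"]) (auto simp: Q_def)
    define Z where "Z = (\<Union>q\<in>Q. {n\<in>{1..N}. q dvd n})"
    have sumQ: "2 * (\<Sum>q\<in>Q. 1 / real q) < 1 - 2 * \<eta>"
    proof -
      have "ln (real p powr a / 2) \<le> ln (real m)" using m p(4,7) by (subst ln_le_cancel_iff) auto
      hence lnm: "a * L - ln 2 \<le> ln (real m)" using p by (simp add: ln_div ln_powr L_def)
      have "ln (real N) \<le> ln (real p powr b)" using N N_pos p by (subst ln_le_cancel_iff) auto
      hence lnN: "ln (real N) \<le> b * L" using p by (simp add: ln_powr L_def)
      have aL: "a * L - ln 2 > 0"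
      proof -
        have "ln 4 \<le> ln (real p powr a)" using p by (subst ln_le_cancel_iff) auto
        moreover have "ln (4::real) = 2 * ln 2" using ln_realpow[of 2 2] by simp
        moreover have "ln (2::real) > 0" by simp
        moreover have "ln (real p powr a) = a * L" using p(7) by (simp add: ln_powr L_def)
        ultimately show ?thesis by linarith
      qed
      have lnm0: "ln (real m) > 0" using lnm aL by linarith
      have lnN0: "ln (real N) > 0" using m2 mN by simp
      have "(\<Sum>q\<in>Q. 1 / real q) \<le> ln (ln (real N) / ln (real m)) + 7 / ln (real m)"
        unfolding Q_def by (rule sum_inverse_primes_le[OF m2 mN])
      also have "\<dots> \<le> ln (b * L / (a * L - ln 2)) + 7 / (a * L - ln 2)"
      proof (intro add_mono)
        have "ln (real N) / ln (real m) \<le> b * L / (a * L - ln 2)"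
          using lnN lnm aL lnN0 by (intro frac_le) auto
        thus "ln (ln (real N) / ln (real m)) \<le> ln (b * L / (a * L - ln 2))"
          using lnN0 lnm0 by (intro ln_mono) auto
        show "7 / ln (real m) \<le> 7 / (a * L - ln 2)" using lnm aL by (intro divide_left_mono) auto
      qed
      finally show ?thesis using p(1) by (simp add: L_def)
    qed
    have outside: "\<psi> n = 1" if n: "n \<in> {1..N}" "n \<notin> Z" for n
    proof (rule eq_1_of_prime_factors)
      fix q assume q: "prime q" "q dvd n"
      hence "q \<le> N" using n dvd_imp_le[of q n] by auto
      hence "q \<le> m" using n q by (auto simp: Z_def Q_def)
      hence "real q \<le> real p powr a" using m by linarith
      thus "\<psi> q = 1" using prime_gt_0_nat[OF q(1)] by (intro exact)
    qed (use n in auto)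
    have "card Z \<le> (\<Sum>q\<in>Q. card {n\<in>{1..N}. q dvd n})" unfolding Z_def by (rule card_UN_le[OF finQ])
    also have "\<dots> = (\<Sum>q\<in>Q. N div q)" by (intro sum.cong refl card_multiples) (auto simp: Q_def prime_gt_0_nat)
    finally have "real (card Z) \<le> real (\<Sum>q\<in>Q. N div q)" by (simp only: of_nat_le_iff)
    also have "\<dots> = (\<Sum>q\<in>Q. real (N div q))" by simp
    also have "\<dots> \<le> (\<Sum>q\<in>Q. real N / real q)" by (intro sum_mono of_nat_div_le_of_nat)
    also have "\<dots> = real N * (\<Sum>q\<in>Q. 1 / real q)" by (simp add: sum_distrib_left)
    finally have cardZ: "real (card Z) \<le> real N * (\<Sum>q\<in>Q. 1 / real q)" .
    have "norm (of_nat N - (\<Sum>n=1..N. \<psi> n)) = norm (\<Sum>n=1..N. 1 - \<psi> n)" by (simp add: sum_subtractf)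
    also have "\<dots> \<le> (\<Sum>n=1..N. if n \<in> Z then 2 else 0)"
    proof (rule sum_norm_le)
      fix n assume n: "n \<in> {1..N}"
      have "norm (1 - \<psi> n) \<le> norm (1::complex) + norm (\<psi> n)" by (rule norm_triangle_ineq4)
      thus "norm (1 - \<psi> n) \<le> (if n \<in> Z then 2 else 0)" using norm_le[of n] outside[OF n] by auto
    qed
    also have "\<dots> = 2 * real (card Z)"
    proof -
      have "{1..N} \<inter> Z = Z" by (auto simp: Z_def)
      thus ?thesis by (simp add: sum.If_cases)
    qed
    also have "\<dots> \<le> real N * (2 * (\<Sum>q\<in>Q. 1 / real q))" using cardZ by simp
    also have "\<dots> < real N * (1 - 2 * \<eta>)" using sumQ N_pos by (intro mult_strict_left_mono)
    finally have "norm (of_nat N - (\<Sum>n=1..N. \<psi> n)) < real N * (1 - 2 * \<eta>)" .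
    moreover have "norm (of_nat N :: complex) \<le> norm (of_nat N - (\<Sum>n=1..N. \<psi> n)) + norm (\<Sum>n=1..N. \<psi> n)"
      using norm_triangle_sub[of "of_nat N" "\<Sum>n=1..N. \<psi> n"] by (simp only: add.commute)
    moreover have "norm (\<Sum>n=1..N. \<psi> n) \<le> \<eta> * real N"
    proof (rule P[OF d2 \<psi> _ ord])
      have "P d \<le> (\<Sum>d\<le>d0. P d)" using d_le by (intro member_le_sum) auto
      thus "p \<ge> P d" using p by linarith
      show "real p powr (1/4 + \<epsilon>/4) \<le> 2 * real N" using N pab p(4) unfolding b_def by linarith
      have "real p powr b \<le> real p powr (1/2)" using p ab by (intro powr_mono) auto
      thus "real N \<le> sqrt (real p)" using N by (simp add: powr_half_sqrt)
    qed
    ultimately have "real N * \<eta> < 0" by (simp add: algebra_simps)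
    thus False using N_pos \<eta> by (simp add: mult_less_0_iff)
  qed
qed

section \<open>Subset products\<close>

lemma S_le: "S p y b \<le> 2 ^ y"
proof -
  have "S p y b \<le> card (Pow {1..y})" unfolding S_def by (intro card_mono) auto
  thus ?thesis by (simp add: card_Pow)
qed

text \<open>Expanding the product over subsets evaluates each character at every subset product. As
  y < p these are units, so orthogonality applies to them. b' represents b among the natural
  numbers, where the characters live.\<close>

lemma S_fourier:
  assumes p: "prime p" and g: "residue_primroot p g" and b: "\<not> p dvd b'" "[int b' = b] (mod int p)" and y: "y < p"
  shows "of_nat (p - 1) * of_nat (S p y b) = (\<Sum>k<p-1. cnj (char_of p g k b') * (\<Prod>n=1..y. 1 + char_of p g k n))"
proof -
  have cond: "[int n = b] (mod int p) \<longleftrightarrow> [n = b'] (mod p)" for n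
  proof -
    have "[int n = b] (mod int p) \<longleftrightarrow> [int n = int b'] (mod int p)" using b(2) by (meson cong_sym cong_trans)
    thus ?thesis by (simp add: cong_int_iff)
  qed
  have ndvd: "\<not> p dvd \<Prod>A" if "A \<in> Pow {1..y}" for A
  proof
    assume "p dvd \<Prod>A"
    moreover have "finite A" using that finite_subset by auto
    ultimately obtain n where "n \<in> A" "p dvd n" using p by (auto simp: prime_dvd_prod_iff)
    moreover have "1 \<le> n" "n \<le> y" using \<open>n \<in> A\<close> that by auto
    ultimately show False using y by (auto dest: dvd_imp_le)
  qed
  have "of_nat (p - 1) * of_nat (S p y b) = (\<Sum>A\<in>Pow {1..y}. if [\<Prod>A = b'] (mod p) then of_nat (p - 1) else (0::complex))"
  proof -
    have "{A. A \<subseteq> {1..y} \<and> [int (\<Prod>A) = b] (mod int p)} = Pow {1..y} \<inter> {A. [\<Prod>A = b'] (mod p)}"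
      unfolding cond by auto
    thus ?thesis by (simp add: S_def sum.If_cases)
  qed
  also have "\<dots> = (\<Sum>A\<in>Pow {1..y}. \<Sum>k<p-1. cnj (char_of p g k b') * char_of p g k (\<Prod>A))"
    using char_of_orthogonal[OF p g ndvd b(1)] by (intro sum.cong refl) simp
  also have "\<dots> = (\<Sum>k<p-1. \<Sum>A\<in>Pow {1..y}. cnj (char_of p g k b') * char_of p g k (\<Prod>A))" by (rule sum.swap)
  also have "\<dots> = (\<Sum>k<p-1. cnj (char_of p g k b') * (\<Prod>n=1..y. 1 + char_of p g k n))"
  proof (intro sum.cong refl)
    fix k
    interpret mod_char p "char_of p g k" by (rule mod_char_char_of[OF p g])
    show "(\<Sum>A\<in>Pow {1..y}. cnj (char_of p g k b') * char_of p g k (\<Prod>A)) =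
        cnj (char_of p g k b') * (\<Prod>n=1..y. 1 + char_of p g k n)"
      by (simp add: prod_one_plus_eq_sum_Pow prod sum_distrib_left)
  qed
  finally show ?thesis .
qed

theorem theorem1p2:
  fixes \<epsilon> :: real
  assumes "0 < \<epsilon>" and "\<epsilon> < 1/5"
  shows "\<exists>C::real. \<forall>(p::nat) (b::int) (y::nat).
           prime p \<and> \<not> int p dvd b \<and>
           real p powr (1 / (4 * sqrt (exp 1)) + \<epsilon>) < real y \<and> y < p \<longrightarrow>
           \<bar>real (S p y b) - 2 ^ y / (real p - 1)\<bar> \<le> C * 2 ^ y / (real p)^2"
proof (rule sum_character_distance_ge[OF assms])
  fix p0 :: nat
  assume distance: "\<And>p \<psi> y u. mod_char p \<psi> \<Longrightarrow> p \<ge> p0 \<Longrightarrow> \<not> p dvd u \<Longrightarrow> \<psi> u \<noteq> 1 \<Longrightarrow> y < p \<Longrightarrow>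
       real p powr (1 / (4 * sqrt (exp 1)) + \<epsilon>) < real y \<Longrightarrow>
       16 * ln (real p) \<le> (\<Sum>n=1..y. (norm (1 - \<psi> n))\<^sup>2)"
  show ?thesis
  \<comment> \<open>For p < p0 both quantities lie between 0 and 2^y, so their difference is at most
    2^y, and p^2 \<le> p0^2; the summand 1 is for large p.\<close>
  proof (intro exI[of _ "1 + (real p0)\<^sup>2"] allI impI, elim conjE)
    fix p y :: nat and b :: int
    assume p: "prime p" and b: "\<not> int p dvd b" and y: "real p powr (1 / (4 * sqrt (exp 1)) + \<epsilon>) < real y" "y < p"
    define R where "R = \<bar>real (S p y b) - 2 ^ y / (real p - 1)\<bar>"
    have p2: "real p \<ge> 2" using prime_ge_2_nat[OF p] by simp
    have "R * (real p)\<^sup>2 \<le> (1 + (real p0)\<^sup>2) * 2 ^ y"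
    proof (cases "p \<ge> p0")
      case False
      have "0 \<le> real (S p y b)" "real (S p y b) \<le> 2 ^ y"
        using S_le[of p y b] by (simp_all only: of_nat_0_le_iff) (metis of_nat_le_iff of_nat_numeral of_nat_power)
      moreover have "0 \<le> 2 ^ y / (real p - 1)" "2 ^ y / (real p - 1) \<le> 2 ^ y"
        using p2 by (auto simp: divide_le_eq mult_le_cancel_left1)
      ultimately have "R \<le> 2 ^ y" unfolding R_def by linarith
      moreover have "(real p)\<^sup>2 \<le> (real p0)\<^sup>2" using False by (intro power_mono) auto
      ultimately have "R * (real p)\<^sup>2 \<le> 2 ^ y * (real p0)\<^sup>2" by (intro mult_mono) auto
      also have "\<dots> \<le> (1 + (real p0)\<^sup>2) * 2 ^ y" by (simp add: algebra_simps)
      finally show ?thesis .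
    next
      case True
      obtain g where g: "residue_primroot p g" using prime_primitive_root_exists[OF prime_gt_1_nat[OF p] p] by blast
      define b' where "b' = nat (b mod int p)"
      have b'b: "[int b' = b] (mod int p)" using p prime_gt_0_nat by (simp add: b'_def mod_cong_def)
      have ndvd: "\<not> p dvd b'" using b b'b by (metis cong_dvd_iff int_dvd_int_iff)
      define T where "T k = cnj (char_of p g k b') * (\<Prod>n=1..y. 1 + char_of p g k n)" for k
      have T0: "T 0 = 2 ^ y"
      proof -
        have "char_of p g 0 n = 1" if "n \<in> {1..y}" for n
          using that y(2) by (intro char_of_0[OF p g]) (auto dest: dvd_imp_le)
        hence "(\<Prod>n=1..y. 1 + char_of p g 0 n) = (\<Prod>n=1..y. 2)" by (intro prod.cong) auto
        thus ?thesis using ndvd by (simp add: T_def char_of_0[OF p g])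
      qed
      have Tk: "norm (T k) \<le> 2 ^ y / (real p)\<^sup>2" if k: "k \<in> {0<..<p-1}" for k
      proof -
        interpret mod_char p "char_of p g k" by (rule mod_char_char_of[OF p g])
        have "16 * ln (real p) \<le> (\<Sum>n=1..y. (norm (1 - char_of p g k n))\<^sup>2)"
          using k char_of_nontrivial[OF p g, of k] y by (intro distance[where u = g] mod_char_char_of[OF p g] True) auto
        \<comment> \<open>16 over the 8 in the exponent leaves exp(-2 ln p), a saving of p^2 for
          each nontrivial character.\<close>
        hence "exp (- (\<Sum>n=1..y. (norm (1 - char_of p g k n))\<^sup>2) / 8) \<le> exp (- (ln (real p) + ln (real p)))" by simp
        also have "\<dots> = inverse (exp (ln (real p)) * exp (ln (real p)))" by (simp only: exp_minus exp_add)
        also have "\<dots> = 1 / (real p)\<^sup>2" using p2 by (simp add: power2_eq_square field_simps)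
        finally have "2 ^ y * exp (- (\<Sum>n=1..y. (norm (1 - char_of p g k n))\<^sup>2) / 8) \<le> 2 ^ y * (1 / (real p)\<^sup>2)"
          by (intro mult_left_mono) auto
        hence *: "norm (\<Prod>n=1..y. 1 + char_of p g k n) \<le> 2 ^ y / (real p)\<^sup>2"
          using norm_prod_one_plus_le[OF y(2)] by simp
        have "norm (T k) \<le> 1 * norm (\<Prod>n=1..y. 1 + char_of p g k n)"
          unfolding T_def norm_mult complex_mod_cnj by (intro mult_right_mono norm_le) simp
        thus ?thesis using * by simp
      qed
      have "{..<p-1} = insert 0 {0<..<p-1}" using p2 by auto
      hence "(\<Sum>k<p-1. T k) = T 0 + (\<Sum>k\<in>{0<..<p-1}. T k)" by simp
      hence "of_nat (p - 1) * of_nat (S p y b) - 2 ^ y = (\<Sum>k\<in>{0<..<p-1}. T k)"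
        using S_fourier[OF p g ndvd b'b y(2)] T0 by (simp add: T_def)
      hence "norm (of_nat (p - 1) * of_nat (S p y b) - 2 ^ y :: complex) \<le> (\<Sum>k\<in>{0<..<p-1}. 2 ^ y / (real p)\<^sup>2)"
        by (simp only:) (intro sum_norm_le Tk)
      \<comment> \<open>There are p - 2 nontrivial characters, so division by p - 1 leaves no more
        than the bound for one of them.\<close>
      also have "\<dots> = real (p - 2) * (2 ^ y / (real p)\<^sup>2)" by (simp add: numeral_2_eq_2)
      also have "\<dots> \<le> (real p - 1) * (2 ^ y / (real p)\<^sup>2)" using p2 by (intro mult_right_mono) auto
      also have "norm (of_nat (p - 1) * of_nat (S p y b) - 2 ^ y :: complex) = \<bar>(real p - 1) * real (S p y b) - 2 ^ y\<bar>"
      proof -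
        have "(of_nat (p - 1) * of_nat (S p y b) - 2 ^ y :: complex) = of_real ((real p - 1) * real (S p y b) - 2 ^ y)"
          using p2 by (simp add: of_nat_diff)
        thus ?thesis by (simp only: norm_of_real)
      qed
      also have "\<dots> = (real p - 1) * R"
      proof -
        have "(real p - 1) * real (S p y b) - 2 ^ y = (real p - 1) * (real (S p y b) - 2 ^ y / (real p - 1))"
          using p2 by (simp add: field_simps)
        thus ?thesis unfolding R_def using p2 by (simp add: abs_mult)
      qed
      finally have "R \<le> 2 ^ y / (real p)\<^sup>2" by (rule mult_left_le_imp_le) (use p2 in simp)
      hence "R * (real p)\<^sup>2 \<le> 2 ^ y" using p2 by (simp add: field_simps)
      also have "\<dots> \<le> (1 + (real p0)\<^sup>2) * 2 ^ y" by (simp add: algebra_simps)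
      finally show ?thesis .
    qed
    thus "\<bar>real (S p y b) - 2 ^ y / (real p - 1)\<bar> \<le> (1 + (real p0)\<^sup>2) * 2 ^ y / (real p)\<^sup>2"
      unfolding R_def[symmetric] using p2 by (simp add: le_divide_eq)
  qed
qed

end
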